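(* Let $G$ be a locally compact, Hausdorff, étale, principal, $\sigma$-compact, ample groupoid with dynamic asymptotic dimension at most $d$ (where $d\in\mathbb{N}$). Then $H_n(G)=0$ for all $n>d$, and $H_d(G)$ is torsion-free.
   Context: Groupoid notation: $G^0$ is the base (unit) space, $r,s:G\to G^0$ are range and source. A (locally compact Hausdorff) groupoid is étale if its open bisections form a basis of its topology (a bisection is a subset on which $r$ and $s$ are both homeomorphisms onto their images), ample if the compact open bisections form a basis, and principal if $r(g)=s(g)$ implies that $g$ is a unit. Dynamic asymptotic dimension: a locally compact Hausdorff étale groupoid $G$ has dynamic asymptotic dimension at most $d$ if for every relatively compact open subset $K\subseteq G$ there are open subsets $U_0,\dots,U_d$ of $G^0$ covering $r(K)\cup s(K)$ such that for each $i$ the set $\{g\in K\mid s(g),r(g)\in U_i\}$ is contained in a relatively compact subgroupoid of $G$. Groupoid homology: for a locally compact Hausdorff totally disconnected space $Y$ let $\mathbb{Z}[Y]=C_c(Y,\mathbb{Z})$ (compactly supported continuous integer-valued functions); a local homeomorphism $f:Y\to Z$ induces $f_*:\mathbb{Z}[Y]\to\mathbb{Z}[Z]$, $f_*(a)(z)=\sum_{y\in f^{-1}(z)}a(y)$. Let $G^{(0)}=G^0$ and, for $n\ge 1$, $G^{(n)}=\{(g_1,\dots,g_n)\in G^n\mid s(g_i)=r(g_{i+1})\text{ for }1\le i<n\}$. The face maps $\epsilon^n_i:G^{(n)}\to G^{(n-1)}$, $0\le i\le n$, are, for $n\ge2$: $\epsilon^n_0(g_1,\dots,g_n)=(g_2,\dots,g_n)$,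 $\epsilon^n_i(g_1,\dots,g_n)=(g_1,\dots,g_ig_{i+1},\dots,g_n)$ for $0<i<n$, $\epsilon^n_n(g_1,\dots,g_n)=(g_1,\dots,g_{n-1})$; and $\epsilon^1_0=s$, $\epsilon^1_1=r$. Then $H_*(G)$ is the homology of the chain complex $(\mathbb{Z}[G^{( * )}],\partial_* )$ with $\partial_n=\sum_{i=0}^n(-1)^i(\epsilon^n_i)_*$. *)

theory Defs
  imports "HOL-Analysis.Analysis" "HOL-Algebra.Elementary_Groups"
begin

section \<open>Topological groupoids\<close>

text \<open>
  The set of arrows is the topological space of the field \<open>top_of\<close>. The structure maps are total
  functions whose values matter only on arrows (for \<open>gcomp\<close>: on composable pairs of arrows).
  The base space consists of the unit arrows, so that range and source are maps into the
  groupoid itself.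
\<close>

record 'a top_groupoid =
  top_of :: "'a topology"
  rng :: "'a \<Rightarrow> 'a"
  src :: "'a \<Rightarrow> 'a"
  gcomp :: "'a \<Rightarrow> 'a \<Rightarrow> 'a"
  ginv :: "'a \<Rightarrow> 'a"

definition arrows :: "'a top_groupoid \<Rightarrow> 'a set" where
  "arrows G = topspace (top_of G)"

definition units :: "'a top_groupoid \<Rightarrow> 'a set" where
  "units G = rng G ` arrows G"

definition unit_space :: "'a top_groupoid \<Rightarrow> 'a topology" where
  "unit_space G = subtopology (top_of G) (units G)"

definition composable_pairs :: "'a top_groupoid \<Rightarrow> ('a \<times> 'a) set" where
  "composable_pairs G = {(g, h). g \<in> arrows G \<and> h \<in> arrows G \<and> src G g = rng G h}"

locale groupoid =
  fixes G :: "'a top_groupoid"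
  assumes rng_closed: "g \<in> arrows G \<Longrightarrow> rng G g \<in> arrows G"
    and src_closed: "g \<in> arrows G \<Longrightarrow> src G g \<in> arrows G"
    and rng_rng: "g \<in> arrows G \<Longrightarrow> rng G (rng G g) = rng G g"
    and src_rng: "g \<in> arrows G \<Longrightarrow> src G (rng G g) = rng G g"
    and rng_src: "g \<in> arrows G \<Longrightarrow> rng G (src G g) = src G g"
    and src_src: "g \<in> arrows G \<Longrightarrow> src G (src G g) = src G g"
    and comp_closed: "(g, h) \<in> composable_pairs G \<Longrightarrow> gcomp G g h \<in> arrows G"
    and rng_comp: "(g, h) \<in> composable_pairs G \<Longrightarrow> rng G (gcomp G g h) = rng G g"
    and src_comp: "(g, h) \<in> composable_pairs G \<Longrightarrow> src G (gcomp G g h) = src G h"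
    and comp_assoc: "(g, h) \<in> composable_pairs G \<Longrightarrow> (h, k) \<in> composable_pairs G \<Longrightarrow>
          gcomp G (gcomp G g h) k = gcomp G g (gcomp G h k)"
    and comp_unit_left: "g \<in> arrows G \<Longrightarrow> gcomp G (rng G g) g = g"
    and comp_unit_right: "g \<in> arrows G \<Longrightarrow> gcomp G g (src G g) = g"
    and ginv_closed: "g \<in> arrows G \<Longrightarrow> ginv G g \<in> arrows G"
    and rng_ginv: "g \<in> arrows G \<Longrightarrow> rng G (ginv G g) = src G g"
    and src_ginv: "g \<in> arrows G \<Longrightarrow> src G (ginv G g) = rng G g"
    and comp_ginv_right: "g \<in> arrows G \<Longrightarrow> gcomp G g (ginv G g) = rng G g"
    and comp_ginv_left: "g \<in> arrows G \<Longrightarrow> gcomp G (ginv G g) g = src G g"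

locale topological_groupoid = groupoid +
  assumes continuous_rng: "continuous_map (top_of G) (top_of G) (rng G)"
    and continuous_src: "continuous_map (top_of G) (top_of G) (src G)"
    and continuous_ginv: "continuous_map (top_of G) (top_of G) (ginv G)"
    and continuous_comp:
      "continuous_map (subtopology (prod_topology (top_of G) (top_of G)) (composable_pairs G))
         (top_of G) (\<lambda>(g, h). gcomp G g h)"

definition sigma_compact_space :: "'a topology \<Rightarrow> bool" where
  "sigma_compact_space X \<longleftrightarrow>
     (\<exists>K :: nat \<Rightarrow> 'a set. (\<forall>n. compactin X (K n)) \<and> (\<Union>n. K n) = topspace X)"

definition relatively_compactin :: "'a topology \<Rightarrow> 'a set \<Rightarrow> bool" where
  "relatively_compactin X S \<longleftrightarrow> S \<subseteq> topspace X \<and> compactin X (X closure_of S)"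

definition bisection :: "'a top_groupoid \<Rightarrow> 'a set \<Rightarrow> bool" where
  "bisection G B \<longleftrightarrow> B \<subseteq> arrows G
     \<and> homeomorphic_map (subtopology (top_of G) B) (subtopology (top_of G) (rng G ` B)) (rng G)
     \<and> homeomorphic_map (subtopology (top_of G) B) (subtopology (top_of G) (src G ` B)) (src G)"

text \<open>
  As usual for open bisections, the images in the base space are required to be open. Without
  this, having a basis of open bisections would not make range and source local homeomorphisms:
  take the space \<open>[0,1]\<close> of units together with two isolated mutually inverse arrows between
  0 and 1.
\<close>

definition open_bisection :: "'a top_groupoid \<Rightarrow> 'a set \<Rightarrow> bool" where
  "open_bisection G B \<longleftrightarrow> openin (top_of G) B \<and> bisection G B
     \<and> openin (unit_space G) (rng G ` B) \<and> openin (unit_space G) (src G ` B)"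

definition etale :: "'a top_groupoid \<Rightarrow> bool" where
  "etale G \<longleftrightarrow> openin (top_of G) = arbitrary union_of open_bisection G"

definition ample :: "'a top_groupoid \<Rightarrow> bool" where
  "ample G \<longleftrightarrow>
     openin (top_of G) = arbitrary union_of (\<lambda>B. open_bisection G B \<and> compactin (top_of G) B)"

definition principal_groupoid :: "'a top_groupoid \<Rightarrow> bool" where
  "principal_groupoid G \<longleftrightarrow> (\<forall>g \<in> arrows G. rng G g = src G g \<longrightarrow> g \<in> units G)"


section \<open>Dynamic asymptotic dimension\<close>

text \<open>Closure under composition and inversion implies closure under range and source.\<close>

definition subgroupoid :: "'a top_groupoid \<Rightarrow> 'a set \<Rightarrow> bool" where
  "subgroupoid G H \<longleftrightarrow> H \<subseteq> arrows G
     \<and> (\<forall>g \<in> H. ginv G g \<in> H)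
     \<and> (\<forall>g \<in> H. \<forall>h \<in> H. src G g = rng G h \<longrightarrow> gcomp G g h \<in> H)"

definition dad_at_most :: "'a top_groupoid \<Rightarrow> nat \<Rightarrow> bool" where
  "dad_at_most G d \<longleftrightarrow>
     (\<forall>K. openin (top_of G) K \<and> relatively_compactin (top_of G) K \<longrightarrow>
        (\<exists>U :: nat \<Rightarrow> 'a set.
           (\<forall>i\<le>d. openin (unit_space G) (U i))
           \<and> rng G ` K \<union> src G ` K \<subseteq> (\<Union>i\<le>d. U i)
           \<and> (\<forall>i\<le>d. \<exists>H. subgroupoid G H \<and> relatively_compactin (top_of G) H
                \<and> {g \<in> K. src G g \<in> U i \<and> rng G g \<in> U i} \<subseteq> H)))"
  for G :: "'a top_groupoid"


section \<open>Groupoid homology\<close>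

text \<open>Functions on a space are extended by 0 to the whole type.\<close>

definition cc_int :: "'b topology \<Rightarrow> ('b \<Rightarrow> int) set" where
  "cc_int Y = {a. continuous_map Y (discrete_topology UNIV) a
     \<and> compactin Y (Y closure_of {y \<in> topspace Y. a y \<noteq> 0})
     \<and> (\<forall>y. y \<notin> topspace Y \<longrightarrow> a y = 0)}"

definition cc_int_group :: "'b topology \<Rightarrow> ('b \<Rightarrow> int) monoid" where
  "cc_int_group Y = \<lparr>carrier = cc_int Y, mult = (\<lambda>a b y. a y + b y), one = (\<lambda>y. 0)\<rparr>"

text \<open>
  A fibre of a local homeomorphism may be infinite, but it meets the support of a compactly
  supported function in a finite set. The zero terms are left out since \<^const>\<open>sum\<close> is 0 on
  infinite sets.
\<close>

definition pushforward :: "'b topology \<Rightarrow> ('b \<Rightarrow> 'c) \<Rightarrow> ('b \<Rightarrow> int) \<Rightarrow> 'c \<Rightarrow> int" where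
  "pushforward Y f a z = (\<Sum>y \<in> {y \<in> topspace Y. f y = z \<and> a y \<noteq> 0}. a y)"

text \<open>
  Tuples of length \<open>n\<close> are extensional functions on \<open>{1..n}\<close>. So that all degrees have the same
  type, a unit \<open>x\<close> in degree 0 is represented by the function on \<open>{1}\<close> with value \<open>x\<close>.
\<close>

definition nerve :: "'a top_groupoid \<Rightarrow> nat \<Rightarrow> (nat \<Rightarrow> 'a) topology" where
  "nerve G n =
     (if n = 0 then product_topology (\<lambda>_. unit_space G) {1}
      else subtopology (product_topology (\<lambda>_. top_of G) {1..n})
             {g. \<forall>i. 1 \<le> i \<and> i < n \<longrightarrow> src G (g i) = rng G (g (i + 1))})"

definition face :: "'a top_groupoid \<Rightarrow> nat \<Rightarrow> nat \<Rightarrow> (nat \<Rightarrow> 'a) \<Rightarrow> nat \<Rightarrow> 'a" where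
  "face G n i g =
     (if n = 1 then (\<lambda>j\<in>{1}. if i = 0 then src G (g 1) else rng G (g 1))
      else if i = 0 then (\<lambda>j\<in>{1..n - 1}. g (j + 1))
      else if i < n then
        (\<lambda>j\<in>{1..n - 1}. if j < i then g j
                         else if j = i then gcomp G (g i) (g (i + 1))
                         else g (j + 1))
      else (\<lambda>j\<in>{1..n - 1}. g j))"

definition boundary :: "'a top_groupoid \<Rightarrow> nat \<Rightarrow> ((nat \<Rightarrow> 'a) \<Rightarrow> int) \<Rightarrow> (nat \<Rightarrow> 'a) \<Rightarrow> int" where
  "boundary G n a =
     (if n = 0 then (\<lambda>_. 0)
      else (\<lambda>z. \<Sum>i\<le>n. (-1) ^ i * pushforward (nerve G n) (face G n i) a z))"

abbreviation groupoid_chain_group :: "'a top_groupoid \<Rightarrow> nat \<Rightarrow> ((nat \<Rightarrow> 'a) \<Rightarrow> int) monoid" where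
  "groupoid_chain_group G n \<equiv> cc_int_group (nerve G n)"

text \<open>
  For \<open>n = 0\<close> the target of the zero map \<open>boundary G 0\<close> is immaterial, and the kernel below is
  the whole chain group.
\<close>

definition groupoid_homology :: "'a top_groupoid \<Rightarrow> nat \<Rightarrow> ((nat \<Rightarrow> 'a) \<Rightarrow> int) set monoid" where
  "groupoid_homology G n =
     (groupoid_chain_group G n)
       \<lparr>carrier := kernel (groupoid_chain_group G n) (groupoid_chain_group G (n - 1)) (boundary G n)\<rparr>
     Mod (boundary G (n + 1) ` carrier (groupoid_chain_group G (n + 1)))"

definition torsion_free_group :: "('b, 'm) monoid_scheme \<Rightarrow> bool" where
  "torsion_free_group H \<longleftrightarrow>
     (\<forall>x \<in> carrier H. \<forall>k::nat. k > 0 \<and> x [^]\<^bsub>H\<^esub> k = \<one>\<^bsub>H\<^esub> \<longrightarrow> x = \<one>\<^bsub>H\<^esub>)"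

end

theory Submission
  imports Defs "HOL-Library.Poly_Mapping"
begin

text \<open>
  Since \<open>G\<close> is principal, an element of the \<open>n\<close>-th nerve is a tuple \<open>(x\<^sub>0, \<dots>, x\<^sub>n)\<close> of units in one orbit,
  and the faces omit entries. Given finitely many chains, all of whose tuples have entries related
  by a compact set of arrows, the dynamic asymptotic dimension yields a partition of the units
  involved into compact open colours \<open>0, \<dots>, d\<close> such that related units of the same colour lie
  in the same class of a compact open equivalence relation that preserves colours. Such a relation
  has a continuous selector \<open>\<sigma>\<close>, so a tuple spans a simplex with vertices \<open>\<sigma> x\<^sub>i\<close> having at most one
  vertex of each colour. Sorting these vertices by colour gives a chain map that
  vanishes above degree \<open>d\<close>, and a prism operator is a homotopy from the identity to it. Hence
  \<open>b = \<partial> h b + h \<partial> b\<close> in degrees above \<open>d\<close>. This gives the vanishing, and if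
  \<open>k c = \<partial> b\<close> with \<open>c\<close> in degree \<open>d\<close>, then \<open>k \<partial> h c = \<partial> h \<partial> b = \<partial> b = k c\<close>, so \<open>c = \<partial> h c\<close>.
\<close>

text \<open>A chain is a compactly supported function whose support may be infinite, whereas the
  homotopy is a formula for finite formal sums of tuples. So the algebra is done in the free abelian
  group on lists of units, without topology, and \<open>ext\<close> carries it over to functions.
  Two things must then be regained. The sums have to be finite: each unit lies in finitely many
  tuples of a chain, and the fibres of \<sigma> are finite. The results have to be continuous with
  compact support: where the colours of the vertices are constant, an operator is a fixed integral
  combination of words in the vertices and their images, and each word keeps an original vertex, so
  on small compact open sets it induces an open injection of nerves. Relative compactness of the
  subgroupoids bounds the size of the classes, and this bound makes the relation generated by a
  compact open set of arrows compact open again. The selector is adapted to the given chains, so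
  there is no homotopy on the whole complex: the torsion argument needs one selector that serves
  both b and c.\<close>

abbreviation (input) coef :: "('b \<Rightarrow>\<^sub>0 int) \<Rightarrow> 'b \<Rightarrow> int" where
  "coef \<equiv> Poly_Mapping.lookup"

lemma frag_extend_frag_extend:
  "frag_extend f (frag_extend g c) = frag_extend (\<lambda>x. frag_extend f (g x)) c"
proof -
  have "Poly_Mapping.keys c \<subseteq> UNIV"
    by simp
  then show ?thesis
    by (induction c rule: frag_induction) (simp_all add: frag_extend_diff)
qed

lemma frag_extend_fun_diff:
  "frag_extend (\<lambda>x. f x - g x) c = frag_extend f c - frag_extend g c"
proof -
  have "Poly_Mapping.keys c \<subseteq> UNIV"
    by simp
  then show ?thesis
    by (induction c rule: frag_induction) (simp_all add: frag_extend_diff)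
qed

lemma frag_extend_fun_minus:
  "frag_extend (\<lambda>x. - f x) c = - frag_extend f c"
  using frag_extend_fun_diff[of "\<lambda>_. 0" f c] by (simp add: frag_extend_eq_0)

lemma coef_frag_extend:
  assumes "finite W" "Poly_Mapping.keys c \<subseteq> W"
  shows "coef (frag_extend f c) z = (\<Sum>w\<in>W. coef c w * coef (f w) z)"
proof -
  have "coef (frag_extend f c) z = (\<Sum>w\<in>Poly_Mapping.keys c. coef c w * coef (f w) z)"
    by (simp add: frag_extend_def Poly_Mapping.lookup_sum)
  also have "\<dots> = (\<Sum>w\<in>W. coef c w * coef (f w) z)"
    using assms by (intro sum.mono_neutral_left) (auto simp: in_keys_iff)
  finally show ?thesis .
qed

section \<open>Chains of tuples\<close>

definition tcone :: "'a \<Rightarrow> ('a list \<Rightarrow>\<^sub>0 int) \<Rightarrow> ('a list \<Rightarrow>\<^sub>0 int)" where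
  "tcone u = frag_extend (\<lambda>l. frag_of (u # l))"

definition del :: "nat \<Rightarrow> 'a list \<Rightarrow> 'a list" where
  "del i xs = take i xs @ drop (Suc i) xs"

definition bd :: "'a list \<Rightarrow> ('a list \<Rightarrow>\<^sub>0 int)" where
  "bd xs = (\<Sum>i<length xs. frag_cmul ((- 1) ^ i) (frag_of (del i xs)))"

lemma tcone_frag_of [simp]: "tcone u (frag_of l) = frag_of (u # l)"
  by (simp add: tcone_def)

lemma tcone_0 [simp]: "tcone u 0 = 0"
  by (simp add: tcone_def)

lemmas tcone_linear = frag_extend_diff[of "\<lambda>l. frag_of (_ # l)", folded tcone_def]
  frag_extend_minus[of "\<lambda>l. frag_of (_ # l)", folded tcone_def]
  frag_extend_add[of "\<lambda>l. frag_of (_ # l)", folded tcone_def]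

lemma keys_tcone: "Poly_Mapping.keys (tcone u c) \<subseteq> (#) u ` Poly_Mapping.keys c"
  unfolding tcone_def by (rule order_trans[OF keys_frag_extend]) auto

lemma bd_Nil [simp]: "bd [] = 0"
  by (simp add: bd_def)

text \<open>The tuples include the empty one, so that \<^const>\<open>bd\<close> is the augmented boundary: without the
  augmentation this formula would fail for \<open>w = []\<close>.\<close>

lemma bd_Cons: "bd (u # w) = frag_of w - tcone u (bd w)"
proof -
  have "bd (u # w) = frag_of w + (\<Sum>i<length w. frag_cmul ((- 1) ^ Suc i) (frag_of (u # del i w)))"
    unfolding bd_def length_Cons sum.lessThan_Suc_shift by (simp add: del_def)
  also have "(\<Sum>i<length w. frag_cmul ((- 1) ^ Suc i) (frag_of (u # del i w)))
      = - tcone u (bd w)"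
    unfolding bd_def tcone_def
    by (simp add: frag_extend_sum frag_extend_cmul flip: sum_negf)
  finally show ?thesis
    by simp
qed

lemma keys_bd: "xs \<in> Poly_Mapping.keys (bd w) \<Longrightarrow> \<exists>i<length w. xs = del i w"
  unfolding bd_def by (drule subsetD[OF keys_sum]) auto

lemma set_del: "set (del i w) \<subseteq> set w"
  using set_take_subset[of i w] set_drop_subset[of "Suc i" w] by (auto simp: del_def)

lemma length_del: "i < length w \<Longrightarrow> length (del i w) = length w - 1"
  by (auto simp: del_def)

text \<open>Linear extension of \<open>bd_Cons\<close>: on the augmented complex each cone is a
  contracting homotopy. The later boundary formulas are inductions on lists based on these two
  rules.\<close>

lemma bd_tcone: "frag_extend bd (tcone u c) = c - tcone u (frag_extend bd c)"
proof -
  have "frag_extend bd (tcone u c) = frag_extend (\<lambda>l. frag_of l - tcone u (bd l)) c"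
    unfolding tcone_def frag_extend_frag_extend by (simp add: bd_Cons tcone_def)
  also have "\<dots> = c - tcone u (frag_extend bd c)"
    unfolding frag_extend_fun_diff frag_expansion[symmetric] tcone_def frag_extend_frag_extend ..
  finally show ?thesis .
qed

text \<open>Applying \<open>bd\<close> to \<open>bd_Cons\<close> gives \<open>bd w\<close> minus
  \<open>bd w\<close> plus a cone over the boundary of \<open>bd w\<close>, so no signed pairs of
  faces have to be matched.\<close>

lemma bd_bd: "frag_extend bd (bd xs) = 0"
  by (induction xs) (simp_all add: bd_Cons frag_extend_diff bd_tcone)

section \<open>Sorting by colours, and the prism homotopy\<close>

text \<open>Only preservation of colours is global. That \<sigma> identifies entries of equal colour
  is required of single tuples, through \<open>compat\<close>, because it is achieved only for the
  tuples of given chains.\<close>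

locale selector =
  fixes col :: "'a \<Rightarrow> nat" and \<sigma> :: "'a \<Rightarrow> 'a"
  assumes col_\<sigma>: "col (\<sigma> x) = col x"
begin

text \<open>\<open>ins v w\<close> is the exterior product of \<open>v\<close> with the sorted tuple \<open>w\<close>.\<close>

fun ins :: "'a \<Rightarrow> 'a list \<Rightarrow> ('a list \<Rightarrow>\<^sub>0 int)" where
  "ins v [] = frag_of [v]"
| "ins v (u # w) = (if col v < col u then frag_of (v # u # w)
     else if col v = col u then 0 else - tcone u (ins v w))"

text \<open>The exterior product of the vertices \<open>\<sigma> x\<close>. The empty tuple goes to
  itself and not to 0, so that \<open>srt\<close> respects the augmentation as well.\<close>

fun srt :: "'a list \<Rightarrow> ('a list \<Rightarrow>\<^sub>0 int)" where
  "srt [] = frag_of []"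
| "srt (x # w) = frag_extend (ins (\<sigma> x)) (srt w)"

text \<open>Unfolded, the value of \<open>prism\<close> at \<open>[x\<^sub>0, \<dots>, x\<^sub>n]\<close> is the usual prism sum: the term number \<open>i\<close> is
  \<open>[x\<^sub>0, \<dots>, x\<^sub>i]\<close> followed by the sorted images under \<open>\<sigma>\<close> of \<open>x\<^sub>i, \<dots>, x\<^sub>n\<close>, with sign \<open>(- 1) ^ (i + 1)\<close>.\<close>

fun prism :: "'a list \<Rightarrow> ('a list \<Rightarrow>\<^sub>0 int)" where
  "prism [] = 0"
| "prism (x # w) = - tcone x (prism w + srt (x # w))"

abbreviation col_sorted :: "'a list \<Rightarrow> bool" where
  "col_sorted w \<equiv> sorted_wrt (<) (map col w)"

text \<open>Without this condition \<open>srt\<close> does not commute with the boundary: if x and y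
  have the same colour, \<open>srt [x, y]\<close> is 0, while \<open>srt\<close> of the boundary is
  \<open>[\<sigma> y]\<close> minus \<open>[\<sigma> x]\<close>.\<close>

definition compat :: "'a list \<Rightarrow> bool" where
  "compat w \<longleftrightarrow> (\<forall>x\<in>set w. \<forall>y\<in>set w. col x = col y \<longrightarrow> \<sigma> x = \<sigma> y)"

lemma keys_ins:
  "xs \<in> Poly_Mapping.keys (ins v w) \<Longrightarrow> col_sorted w \<Longrightarrow>
     col_sorted xs \<and> set xs = insert v (set w) \<and> length xs = Suc (length w)"
proof (induction v w arbitrary: xs rule: ins.induct)
  case (2 v u w)
  show ?case
  proof (cases "col v < col u")
    case True
    then show ?thesis using 2 by auto
  next
    case False
    with 2(2) have neq: "col v \<noteq> col u" and "xs \<in> Poly_Mapping.keys (tcone u (ins v w))"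
      by (auto split: if_splits)
    then obtain ys where ys: "xs = u # ys" "ys \<in> Poly_Mapping.keys (ins v w)"
      by (auto dest: subsetD[OF keys_tcone])
    have "col_sorted ys \<and> set ys = insert v (set w) \<and> length ys = Suc (length w)"
      using 2(1)[OF False neq ys(2)] 2(3) by simp
    then show ?thesis
      using 2(3) False neq by (auto simp: ys(1))
  qed
qed auto

lemma keys_srt:
  "xs \<in> Poly_Mapping.keys (srt w) \<Longrightarrow>
     col_sorted xs \<and> set xs = \<sigma> ` set w \<and> length xs = length w"
proof (induction w arbitrary: xs)
  case (Cons x w)
  then obtain l where "l \<in> Poly_Mapping.keys (srt w)" "xs \<in> Poly_Mapping.keys (ins (\<sigma> x) l)"
    by (auto dest: subsetD[OF keys_frag_extend])
  with Cons.IH[of l] keys_ins[of xs "\<sigma> x" l] show ?case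
    by simp
qed auto

lemma ins_less: "\<forall>x\<in>set l. col v < col x \<Longrightarrow> ins v l = frag_of (v # l)"
  by (cases l) auto

lemma ins_tcone:
  assumes "col u < col v"
  shows "frag_extend (ins v) (tcone u c) = - tcone u (frag_extend (ins v) c)"
  using assms
  unfolding tcone_def frag_extend_frag_extend
  by (simp add: tcone_def frag_extend_fun_minus)

lemma ins_tcone_same:
  assumes "col u = col v"
  shows "frag_extend (ins v) (tcone u c) = 0"
  using assms unfolding tcone_def frag_extend_frag_extend by (simp add: frag_extend_eq_0)

text \<open>Inserting \<open>v\<close> is an exterior multiplication, hence an antiderivation with respect to the
  boundary; if \<open>v\<close> already occurs in \<open>w\<close>, then it contracts the boundary of \<open>w\<close> to \<open>w\<close>.\<close>

lemma bd_ins: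
  assumes "col_sorted w" "\<forall>u\<in>set w. col u = col v \<longrightarrow> u = v"
  shows "frag_extend bd (ins v w) = frag_of w - frag_extend (ins v) (bd w)"
  using assms
proof (induction w)
  case (Cons u w)
  consider "col v < col u" | "col v = col u" | "col u < col v"
    by linarith
  then show ?case
  proof cases
    case 1
    \<comment> \<open>All faces have entries of larger colour than v, so on them
      \<open>ins v\<close> is the cone with apex v, and the claim is \<open>bd_Cons\<close>.\<close>
    have "frag_extend (ins v) (bd (u # w)) = tcone v (bd (u # w))"
      unfolding tcone_def
    proof (rule frag_extend_eq)
      fix l assume "l \<in> Poly_Mapping.keys (bd (u # w))"
      then have "set l \<subseteq> set (u # w)"
        using keys_bd set_del by metis
      then show "ins v l = frag_of (v # l)"
        using 1 Cons.prems(1) by (intro ins_less) fastforce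
    qed
    then show ?thesis
      using 1 by (simp add: bd_Cons[of v])
  next
    \<comment> \<open>Here \<open>ins v (u # w)\<close> is 0. On the other side \<open>ins v\<close>
      kills the faces that keep u and turns the face \<open>w\<close> back into
      \<open>u # w\<close>.\<close>
    case 2
    then have "u = v"
      using Cons.prems by auto
    moreover have "ins v w = frag_of (v # w)"
      using 2 Cons.prems(1) by (intro ins_less) auto
    ultimately show ?thesis
      using 2 by (simp add: bd_Cons frag_extend_diff ins_tcone_same)
  next
    case 3
    have IH: "frag_extend bd (ins v w) = frag_of w - frag_extend (ins v) (bd w)"
      using Cons by simp
    have "ins v (u # w) = - tcone u (ins v w)"
      using 3 by simp
    then have "frag_extend bd (ins v (u # w)) = - (ins v w - tcone u (frag_of w - frag_extend (ins v) (bd w)))"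
      by (simp only: frag_extend_minus bd_tcone IH)
    also have "\<dots> = frag_of (u # w) - frag_extend (ins v) (bd (u # w))"
      by (simp add: bd_Cons frag_extend_diff ins_tcone[OF 3] tcone_linear)
    finally show ?thesis .
  qed
qed (simp add: bd_Cons)

lemma compat_Cons: "compat (x # w) \<Longrightarrow> compat w"
  unfolding compat_def by (meson list.set_intros(2))

lemma bd_frag_ins:
  assumes "\<And>w. w \<in> Poly_Mapping.keys c \<Longrightarrow> col_sorted w \<and> (\<forall>u\<in>set w. col u = col v \<longrightarrow> u = v)"
  shows "frag_extend bd (frag_extend (ins v) c) = c - frag_extend (ins v) (frag_extend bd c)"
proof -
  have "frag_extend bd (frag_extend (ins v) c)
      = frag_extend (\<lambda>w. frag_of w - frag_extend (ins v) (bd w)) c"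
    unfolding frag_extend_frag_extend using assms by (intro frag_extend_eq) (auto simp: bd_ins)
  then show ?thesis
    unfolding frag_extend_fun_diff frag_expansion[symmetric] frag_extend_frag_extend .
qed

text \<open>Supplies the hypothesis of \<open>bd_ins\<close> for the terms of \<open>srt w\<close>:
  an entry of colour \<open>col (\<sigma> x)\<close> is some \<open>\<sigma> y\<close> with y of the
  colour of x.\<close>

lemma keys_srt_compat:
  assumes "compat (x # w)" "l \<in> Poly_Mapping.keys (srt w)"
  shows "col_sorted l \<and> (\<forall>u\<in>set l. col u = col (\<sigma> x) \<longrightarrow> u = \<sigma> x)"
proof -
  have "u = \<sigma> x" if u: "u \<in> set l" "col u = col (\<sigma> x)" for u
  proof -
    obtain y where y: "u = \<sigma> y" "y \<in> set w"
      using u(1) keys_srt[OF assms(2)] by auto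
    then have "col y = col x"
      using u(2) col_\<sigma> by metis
    then show ?thesis
      using assms(1) y unfolding compat_def by (metis list.set_intros)
  qed
  then show ?thesis
    using keys_srt[OF assms(2)] by blast
qed

text \<open>Both sides of the induction step equal \<open>srt w\<close> minus the insertion of
  \<open>\<sigma> x\<close> into the sorted boundary of \<open>w\<close>: the left by the
  antiderivation rule, the right because \<open>srt\<close> turns the cone with apex x into that
  insertion.\<close>

lemma bd_srt: "compat w \<Longrightarrow> frag_extend bd (srt w) = frag_extend srt (bd w)"
proof (induction w)
  case (Cons x w)
  have "frag_extend srt (tcone x (bd w)) = frag_extend (ins (\<sigma> x)) (frag_extend srt (bd w))"
    unfolding tcone_def frag_extend_frag_extend by simp
  then show ?case
    using Cons bd_frag_ins[of "srt w" "\<sigma> x"] keys_srt_compat[OF Cons.prems] compat_Cons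
    by (simp add: bd_Cons frag_extend_diff)
qed auto

lemma prism_tcone:
  "frag_extend prism (tcone x c)
     = - tcone x (frag_extend prism c + frag_extend (ins (\<sigma> x)) (frag_extend srt c))"
proof -
  have "Poly_Mapping.keys c \<subseteq> UNIV"
    by simp
  then show ?thesis
    by (induction c rule: frag_induction) (simp_all add: frag_extend_diff tcone_linear)
qed

text \<open>In the induction step everything except \<open>- srt (x # w)\<close> lies under the cone
  with apex x. There the induction hypothesis contributes \<open>w\<close> minus
  \<open>srt w\<close>, and the boundary formula for inserting \<open>\<sigma> x\<close> contributes
  \<open>srt w\<close>, so that \<open>x # w\<close> remains.\<close>

lemma prism_homotopy:
  "compat w \<Longrightarrow> frag_extend bd (prism w) + frag_extend prism (bd w) = frag_of w - srt w"
proof (induction w)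
  case (Cons x w)
  define p where "p = frag_extend prism (bd w)"
  define q where "q = frag_extend bd (prism w)"
  have IH: "q + p = frag_of w - srt w"
    using Cons compat_Cons by (auto simp: p_def q_def)
  have 1: "frag_extend prism (tcone x (bd w))
      = - tcone x (p + frag_extend (ins (\<sigma> x)) (frag_extend srt (bd w)))"
    unfolding p_def by (rule prism_tcone)
  have 2: "frag_extend bd (frag_extend (ins (\<sigma> x)) (srt w))
      = srt w - frag_extend (ins (\<sigma> x)) (frag_extend srt (bd w))"
    using bd_frag_ins[of "srt w" "\<sigma> x"] keys_srt_compat[OF Cons.prems] compat_Cons[OF Cons.prems]
    by (simp add: bd_srt)
  have "tcone x (q + p) = frag_of (x # w) - tcone x (srt w)"
    by (simp add: IH tcone_linear)
  then show ?case
    by (simp add: bd_Cons frag_extend_diff frag_extend_minus frag_extend_add bd_tcone 1 2 tcone_linear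
        flip: p_def q_def)
       (simp add: algebra_simps)
qed auto

text \<open>Degree n means n + 1 entries, so the length bound says that the degree exceeds d. A
  surviving term would need more distinct colours than the d + 1 available ones.\<close>

lemma srt_eq_0:
  assumes "\<forall>x\<in>set w. col x \<le> d" "length w > d + 1"
  shows "srt w = 0"
proof (rule ccontr)
  assume "srt w \<noteq> 0"
  then obtain xs where xs: "xs \<in> Poly_Mapping.keys (srt w)"
    by (meson all_not_in_conv keys_eq_empty)
  note k = keys_srt[OF xs]
  then have "distinct (map col xs)"
    by (simp add: strict_sorted_iff)
  then have "length xs = card (col ` set xs)"
    using distinct_card by fastforce
  also have "\<dots> \<le> card {..d}"
    using k assms(1) col_\<sigma> by (intro card_mono) auto
  finally show False
    using k assms(2) by simp
qed

end

section \<open>Extension to locally finite chains\<close>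

text \<open>Linear extension to functions of infinite support. A sum over an infinite set is 0, so
  the value is meaningful only where finitely many terms are nonzero; \<open>locally_finite\<close>
  and \<open>local_op\<close> ensure this at nonempty z.\<close>

definition ext :: "('b \<Rightarrow> ('c \<Rightarrow>\<^sub>0 int)) \<Rightarrow> ('b \<Rightarrow> int) \<Rightarrow> 'c \<Rightarrow> int" where
  "ext T A z = (\<Sum>y | A y \<noteq> 0 \<and> coef (T y) z \<noteq> 0. A y * coef (T y) z)"

definition locally_finite :: "('a list \<Rightarrow> int) \<Rightarrow> bool" where
  "locally_finite A \<longleftrightarrow> (\<forall>x. finite {y. A y \<noteq> 0 \<and> x \<in> set y})"

text \<open>Nothing is asked at the empty tuple, where the boundary has the augmentation as
  coefficient, possibly an infinite sum; hence the condition \<open>z \<noteq> []\<close> in results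
  below. The finite set depends on x alone, which makes the property stable under
  composition.\<close>

definition local_op :: "('a list \<Rightarrow> ('a list \<Rightarrow>\<^sub>0 int)) \<Rightarrow> bool" where
  "local_op T \<longleftrightarrow>
     (\<forall>x. \<exists>Z. finite Z \<and> (\<forall>y z. coef (T y) z \<noteq> 0 \<longrightarrow> x \<in> set z \<longrightarrow> set y \<inter> Z \<noteq> {}))"

lemma ext_eq:
  assumes "finite F" "\<And>y. A y \<noteq> 0 \<Longrightarrow> coef (T y) z \<noteq> 0 \<Longrightarrow> y \<in> F"
  shows "ext T A z = (\<Sum>y\<in>F. A y * coef (T y) z)"
  unfolding ext_def using assms by (intro sum.mono_neutral_left) auto

lemma locally_finite_UN:
  assumes "locally_finite A" "finite Z"
  shows "finite {y. A y \<noteq> 0 \<and> set y \<inter> Z \<noteq> {}}"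
proof -
  have "{y. A y \<noteq> 0 \<and> set y \<inter> Z \<noteq> {}} = (\<Union>x\<in>Z. {y. A y \<noteq> 0 \<and> x \<in> set y})"
    by auto
  then show ?thesis
    using assms by (simp add: locally_finite_def)
qed

lemma finite_ext_support:
  assumes "locally_finite A" "local_op T" "z \<noteq> []"
  shows "finite {y. A y \<noteq> 0 \<and> coef (T y) z \<noteq> 0}"
proof -
  obtain Z where "finite Z" "\<And>y. coef (T y) z \<noteq> 0 \<Longrightarrow> set y \<inter> Z \<noteq> {}"
    using assms(2,3) unfolding local_op_def by (metis list.set_sel(1))
  then show ?thesis
    using locally_finite_UN[OF assms(1)] by (smt (verit) Collect_mono finite_subset)
qed

text \<open>Finiteness propagates backwards from z: the intermediate w must meet \<open>Z\<close>,
  so y must meet the finite union of the \<open>N x\<close> with x in \<open>Z\<close>. Only the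
  finite sets \<open>Y\<close> and \<open>W\<close> matter, and the claim is an exchange of finite
  sums.\<close>

lemma ext_ext:
  assumes "locally_finite A" "local_op T" "local_op S" "z \<noteq> []"
  shows "ext S (ext T A) z = ext (\<lambda>y. frag_extend S (T y)) A z"
proof -
  obtain x where x: "x \<in> set z"
    using assms(4) by (cases z) auto
  obtain Z where Z: "finite Z" "\<And>w. coef (S w) z \<noteq> 0 \<Longrightarrow> set w \<inter> Z \<noteq> {}"
    using assms(3) x unfolding local_op_def by metis
  obtain N where N: "\<And>x. finite (N x)"
    "\<And>x y w. coef (T y) w \<noteq> 0 \<Longrightarrow> x \<in> set w \<Longrightarrow> set y \<inter> N x \<noteq> {}"
    using assms(2) unfolding local_op_def by metis
  define Y where "Y = {y. A y \<noteq> 0 \<and> set y \<inter> (\<Union>x\<in>Z. N x) \<noteq> {}}"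
  define W where "W = (\<Union>y\<in>Y. Poly_Mapping.keys (T y))"
  have finY: "finite Y"
    unfolding Y_def using Z(1) N(1) by (intro locally_finite_UN assms(1)) auto
  then have finW: "finite W"
    by (simp add: W_def)
  have in_Y: "y \<in> Y" if "A y \<noteq> 0" "coef (T y) w \<noteq> 0" "coef (S w) z \<noteq> 0" for y w
    using Z(2)[OF that(3)] N(2)[OF that(2)] that(1) unfolding Y_def by blast
  have T: "ext T A w = (\<Sum>y\<in>Y. A y * coef (T y) w)" if "coef (S w) z \<noteq> 0" for w
    using finY in_Y that by (intro ext_eq) auto
  have "ext S (ext T A) z = (\<Sum>w\<in>W. ext T A w * coef (S w) z)"
  proof (rule ext_eq[OF finW])
    fix w assume w: "ext T A w \<noteq> 0" "coef (S w) z \<noteq> 0"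
    then have "(\<Sum>y\<in>Y. A y * coef (T y) w) \<noteq> 0"
      by (simp add: T)
    then obtain y where "y \<in> Y" "A y * coef (T y) w \<noteq> 0"
      by (rule sum.not_neutral_contains_not_neutral)
    then show "w \<in> W"
      by (auto simp: W_def in_keys_iff)
  qed
  also have "\<dots> = (\<Sum>w\<in>W. \<Sum>y\<in>Y. A y * (coef (T y) w * coef (S w) z))"
  proof (rule sum.cong[OF refl])
    fix w
    show "ext T A w * coef (S w) z = (\<Sum>y\<in>Y. A y * (coef (T y) w * coef (S w) z))"
      by (cases "coef (S w) z = 0") (simp_all add: T sum_distrib_right mult.assoc)
  qed
  also have "\<dots> = (\<Sum>y\<in>Y. A y * (\<Sum>w\<in>W. coef (T y) w * coef (S w) z))"
    by (subst sum.swap) (simp add: sum_distrib_left)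
  also have "\<dots> = (\<Sum>y\<in>Y. A y * coef (frag_extend S (T y)) z)"
    by (intro sum.cong refl arg_cong2[of _ _ _ _ "(*)"] coef_frag_extend[OF finW, symmetric])
       (auto simp: W_def)
  also have "\<dots> = ext (\<lambda>y. frag_extend S (T y)) A z"
  proof (rule ext_eq[symmetric, OF finY])
    fix y assume y: "A y \<noteq> 0" "coef (frag_extend S (T y)) z \<noteq> 0"
    then have "z \<in> Poly_Mapping.keys (frag_extend S (T y))"
      by (simp add: in_keys_iff)
    then obtain w where "w \<in> Poly_Mapping.keys (T y)" "z \<in> Poly_Mapping.keys (S w)"
      by (auto dest: subsetD[OF keys_frag_extend])
    then show "y \<in> Y"
      using in_Y y(1) by (simp add: in_keys_iff)
  qed
  finally show ?thesis .
qed

lemma ext_cong: "(\<And>y. A y \<noteq> 0 \<Longrightarrow> S y = T y) \<Longrightarrow> ext S A = ext T A"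
  unfolding ext_def by (intro ext sum.cong) auto

lemma ext_fun_add:
  assumes "locally_finite A" "local_op S" "local_op T" "z \<noteq> []"
  shows "ext (\<lambda>y. S y + T y) A z = ext S A z + ext T A z"
proof -
  let ?F = "{y. A y \<noteq> 0 \<and> coef (S y) z \<noteq> 0} \<union> {y. A y \<noteq> 0 \<and> coef (T y) z \<noteq> 0}"
  have F: "finite ?F"
    using finite_ext_support assms by blast
  show ?thesis
    by (subst (1 2 3) ext_eq[OF F]) (auto simp: lookup_add distrib_left sum.distrib)
qed

lemma ext_add:
  assumes "locally_finite A" "locally_finite B" "local_op T" "z \<noteq> []"
  shows "ext T (\<lambda>y. A y + B y) z = ext T A z + ext T B z"
proof -
  let ?F = "{y. A y \<noteq> 0 \<and> coef (T y) z \<noteq> 0} \<union> {y. B y \<noteq> 0 \<and> coef (T y) z \<noteq> 0}"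
  have F: "finite ?F"
    using finite_ext_support assms by blast
  show ?thesis
    by (subst (1 2 3) ext_eq[OF F]) (auto simp: distrib_right sum.distrib)
qed

text \<open>For nonzero k the index sets agree, so the identity persists where the sum is infinite
  and hence 0. This makes the homotopy homogeneous on arbitrary functions.\<close>

lemma ext_cmult: "ext T (\<lambda>y. k * A y) z = k * ext T A z"
  by (cases "k = 0") (simp_all add: ext_def sum_distrib_left mult.assoc)

lemma ext_frag_of [simp]: "ext frag_of A = A"
proof
  show "ext frag_of A z = A z" for z
    by (subst ext_eq[of "{z}"]) (auto split: if_splits)
qed

lemma local_op_compose:
  assumes "local_op T" "local_op S"
  shows "local_op (\<lambda>y. frag_extend S (T y))"
  unfolding local_op_def
proof
  fix x
  obtain Z where Z: "finite Z" "\<And>w z. coef (S w) z \<noteq> 0 \<Longrightarrow> x \<in> set z \<Longrightarrow> set w \<inter> Z \<noteq> {}"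
    using assms(2) unfolding local_op_def by metis
  obtain N where N: "\<And>x. finite (N x)"
    "\<And>x y w. coef (T y) w \<noteq> 0 \<Longrightarrow> x \<in> set w \<Longrightarrow> set y \<inter> N x \<noteq> {}"
    using assms(1) unfolding local_op_def by metis
  have "set y \<inter> (\<Union>x\<in>Z. N x) \<noteq> {}" if "coef (frag_extend S (T y)) z \<noteq> 0" "x \<in> set z" for y z
  proof -
    have "z \<in> Poly_Mapping.keys (frag_extend S (T y))"
      using that(1) by (simp add: in_keys_iff)
    then obtain w where "w \<in> Poly_Mapping.keys (T y)" "z \<in> Poly_Mapping.keys (S w)"
      by (auto dest: subsetD[OF keys_frag_extend])
    then have "coef (T y) w \<noteq> 0" "coef (S w) z \<noteq> 0"
      by (simp_all add: in_keys_iff)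
    then show ?thesis
      using Z(2)[of w z] that(2) N(2)[of y w] by blast
  qed
  then show "\<exists>Z. finite Z \<and> (\<forall>y z. coef (frag_extend S (T y)) z \<noteq> 0 \<longrightarrow> x \<in> set z \<longrightarrow> set y \<inter> Z \<noteq> {})"
    using Z(1) N(1) by (intro exI[of _ "\<Union>x\<in>Z. N x"]) auto
qed

lemma local_op_bd: "local_op bd"
  unfolding local_op_def
proof
  fix x :: 'a
  have "set y \<inter> {x} \<noteq> {}" if "coef (bd y) z \<noteq> 0" "x \<in> set z" for y z
    using that keys_bd[of z y] set_del[of _ y] by (auto simp: in_keys_iff)
  then show "\<exists>Z. finite Z \<and> (\<forall>y z. coef (bd y) z \<noteq> 0 \<longrightarrow> x \<in> set z \<longrightarrow> set y \<inter> Z \<noteq> {})"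
    by (intro exI[of _ "{x}"]) auto
qed

text \<open>A token \<open>(b, j)\<close> stands for the entry number \<open>j\<close> of a tuple, or for its image under \<open>\<sigma>\<close> if
  \<open>b\<close> holds. On tuples with a given colour pattern the operators above are given by fixed words
  of tokens.\<close>

definition tok :: "('a \<Rightarrow> 'a) \<Rightarrow> 'a list \<Rightarrow> bool \<times> nat \<Rightarrow> 'a" where
  "tok \<sigma> xs t = (if fst t then \<sigma> (xs ! snd t) else xs ! snd t)"

definition word_chain :: "('a \<Rightarrow> 'a) \<Rightarrow> (int \<times> (bool \<times> nat) list) list \<Rightarrow> 'a list \<Rightarrow> ('a list \<Rightarrow>\<^sub>0 int)" where
  "word_chain \<sigma> L xs = (\<Sum>(e, ts)\<leftarrow>L. frag_cmul e (frag_of (map (tok \<sigma> xs) ts)))"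

definition shift :: "bool \<times> nat \<Rightarrow> bool \<times> nat" where
  "shift t = (fst t, Suc (snd t))"

lemma tok_shift [simp]: "tok \<sigma> (x # w) (shift t) = tok \<sigma> w t"
  by (simp add: tok_def shift_def)

lemma tcone_word_chain:
  "tcone x (word_chain \<sigma> L w) = word_chain \<sigma> (map (\<lambda>(e, ts). (e, (False, 0) # map shift ts)) L) (x # w)"
proof (induction L)
  case (Cons a L)
  have "tok \<sigma> (x # w) (False, 0) = x"
    by (simp add: tok_def)
  moreover have "tcone x (frag_cmul e c) = frag_cmul e (tcone x c)" for e c
    by (simp add: tcone_def frag_extend_cmul)
  ultimately show ?case
    using Cons by (cases a) (simp add: word_chain_def tcone_linear comp_def)
qed (simp add: word_chain_def)

lemma minus_word_chain: "- word_chain \<sigma> L w = word_chain \<sigma> (map (\<lambda>(e, ts). (- e, ts)) L) w"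
  by (induction L) (auto simp: word_chain_def)

text \<open>The words are the faces of the index list \<open>[0..<n]\<close>: a face depends on
  positions alone, so one list \<open>L\<close> serves all tuples of length n.\<close>

lemma bd_word:
  "\<exists>L. (\<forall>(e, ts)\<in>set L. length ts = n - 1 \<and> (\<forall>t\<in>set ts. \<not> fst t \<and> snd t < n))
     \<and> (\<forall>xs. length xs = n \<longrightarrow> bd xs = word_chain \<sigma> L xs)"
proof -
  define L where "L = map (\<lambda>i. ((- 1) ^ i :: int, map (Pair False) (del i [0..<n]))) [0..<n]"
  have "bd xs = word_chain \<sigma> L xs" if "length xs = n" for xs
  proof -
    have "map (tok \<sigma> xs) (map (Pair False) (del i [0..<n])) = del i (map ((!) xs) [0..<n])" for i
      by (simp add: del_def take_map drop_map tok_def)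
    then have "map (tok \<sigma> xs) (map (Pair False) (del i [0..<n])) = del i xs" for i
      using that map_nth by metis
    then show ?thesis
      unfolding word_chain_def bd_def L_def
      using that by (simp add: comp_def interv_sum_list_conv_sum_set_nat atLeast0LessThan)
  qed
  moreover have "\<forall>(e, ts)\<in>set L. length ts = n - 1 \<and> (\<forall>t\<in>set ts. \<not> fst t \<and> snd t < n)"
  proof -
    have "length (del i [0..<n]) = n - 1 \<and> (\<forall>j\<in>set (del i [0..<n]). j < n)" if "i < n" for i
      using set_del[of i "[0..<n]"] length_del[of i "[0..<n]"] that by auto
    then show ?thesis
      by (auto simp: L_def)
  qed
  ultimately show ?thesis
    by blast
qed

context selector
begin

lemma keys_prism:
  "z \<in> Poly_Mapping.keys (prism y) \<Longrightarrow> z \<noteq> [] \<and> set z \<subseteq> set y \<union> \<sigma> ` set y \<and> length z = Suc (length y)"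
proof (induction y arbitrary: z)
  case (Cons x w)
  then obtain l where l: "z = x # l" "l \<in> Poly_Mapping.keys (prism w + srt (x # w))"
    by (auto simp del: srt.simps dest: subsetD[OF keys_tcone])
  then consider "l \<in> Poly_Mapping.keys (prism w)" | "l \<in> Poly_Mapping.keys (srt (x # w))"
    using subsetD[OF keys_add l(2)] by auto
  then show ?case
  proof cases
    case 1
    then show ?thesis
      using Cons.IH[of l] l(1) by auto
  next
    case 2
    then show ?thesis
      using keys_srt[of l "x # w"] l(1) by auto
  qed
qed auto

text \<open>The finite fibres of \<sigma> enter here: an entry x of a term of \<open>prism y\<close>
  is an entry of \<open>y\<close> or the image of one.\<close>

lemma local_op_prism:
  assumes "\<And>x. finite (\<sigma> -` {x})"
  shows "local_op prism"
  unfolding local_op_def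
proof
  fix x
  have "set y \<inter> insert x (\<sigma> -` {x}) \<noteq> {}" if "coef (prism y) z \<noteq> 0" "x \<in> set z" for y z
    using that keys_prism[of z y] by (auto simp: in_keys_iff)
  then show "\<exists>Z. finite Z \<and> (\<forall>y z. coef (prism y) z \<noteq> 0 \<longrightarrow> x \<in> set z \<longrightarrow> set y \<inter> Z \<noteq> {})"
    using assms by (intro exI[of _ "insert x (\<sigma> -` {x})"]) auto
qed

text \<open>Insertion only compares colours, so position and sign are determined by the list of
  colours. A repeated colour is covered by \<open>e = 0\<close>, with an arbitrary position.\<close>

lemma ins_word:
  "\<exists>e k. k \<le> length q \<and> (\<forall>v w. col v = c \<longrightarrow> map col w = q \<longrightarrow>
     ins v w = frag_cmul e (frag_of (take k w @ v # drop k w)))"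
proof (induction q)
  case Nil
  show ?case
    by (rule exI[of _ 1], rule exI[of _ 0]) simp
next
  case (Cons b q)
  then obtain e k where ek: "k \<le> length q" "\<And>v w. col v = c \<Longrightarrow> map col w = q \<Longrightarrow>
      ins v w = frag_cmul e (frag_of (take k w @ v # drop k w))"
    by auto
  consider "c < b" | "c = b" | "b < c"
    by linarith
  then show ?case
  proof cases
    case 1
    have "ins v w = frag_cmul 1 (frag_of (take 0 w @ v # drop 0 w))"
      if "col v = c" "map col w = b # q" for v w
      using that 1 by (cases w) auto
    then show ?thesis
      by (intro exI[of _ "1::int"] exI[of _ "0::nat"] conjI allI impI) (assumption | simp)+
  next
    case 2
    have "ins v w = frag_cmul 0 (frag_of (take 0 w @ v # drop 0 w))"
      if "col v = c" "map col w = b # q" for v w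
      using that 2 by (cases w) auto
    then show ?thesis
      by (intro exI[of _ "0::int"] exI[of _ "0::nat"] conjI allI impI) (assumption | simp)+
  next
    case 3
    have "ins v w = frag_cmul (- e) (frag_of (take (Suc k) w @ v # drop (Suc k) w))"
      if vw: "col v = c" "map col w = b # q" for v w
    proof -
      obtain u l where w: "w = u # l" "col u = b" "map col l = q"
        using vw(2) by (cases w) auto
      have "ins v w = - tcone u (frag_cmul e (frag_of (take k l @ v # drop k l)))"
        using ek(2)[OF vw(1) w(3)] 3 w vw(1) by simp
      also have "\<dots> = frag_cmul (- e) (frag_of (take (Suc k) w @ v # drop (Suc k) w))"
        by (simp add: tcone_def frag_extend_cmul w(1))
      finally show ?thesis .
    qed
    then show ?thesis
      using ek(1) by (metis Suc_le_mono length_Cons)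
  qed
qed

lemma srt_word:
  "\<exists>e ts. length ts = length p \<and> (\<forall>t\<in>set ts. fst t \<and> snd t < length p)
     \<and> (\<forall>xs. map col xs = p \<longrightarrow> srt xs = frag_cmul e (frag_of (map (tok \<sigma> xs) ts)))"
proof (induction p)
  case Nil
  have "srt xs = frag_cmul 1 (frag_of (map (tok \<sigma> xs) []))" if "map col xs = []" for xs
    using that by simp
  then show ?case
    by (intro exI[of _ "1::int"] exI[of _ "[]"]) auto
next
  case (Cons c p)
  then obtain e ts where ts: "length ts = length p" "\<forall>t\<in>set ts. fst t \<and> snd t < length p"
    "\<And>xs. map col xs = p \<Longrightarrow> srt xs = frag_cmul e (frag_of (map (tok \<sigma> xs) ts))"
    by auto
  \<comment> \<open>The colours of the sorted tail; they depend on \<open>p\<close> alone because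
    \<sigma> preserves colours.\<close>
  define q where "q = map (\<lambda>t. p ! snd t) ts"
  obtain e' k where k: "k \<le> length q" "\<And>v w. col v = c \<Longrightarrow> map col w = q \<Longrightarrow>
      ins v w = frag_cmul e' (frag_of (take k w @ v # drop k w))"
    using ins_word[of q c] by auto
  define us where "us = take k (map shift ts) @ (True, 0) # drop k (map shift ts)"
  have "srt xs = frag_cmul (e * e') (frag_of (map (tok \<sigma> xs) us))" if xs: "map col xs = c # p" for xs
  proof -
    obtain x w where w: "xs = x # w" "col x = c" "map col w = p"
      using xs by (cases xs) auto
    have "map col (map (tok \<sigma> w) ts) = q"
      unfolding q_def map_map
    proof (rule map_cong[OF refl])
      fix t assume "t \<in> set ts"
      then have "fst t" "snd t < length w"
        using ts(2) w(3) by auto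
      then show "(col \<circ> tok \<sigma> w) t = p ! snd t"
        by (simp add: tok_def col_\<sigma> flip: w(3))
    qed
    then have "ins (\<sigma> x) (map (tok \<sigma> w) ts)
        = frag_cmul e' (frag_of (take k (map (tok \<sigma> w) ts) @ \<sigma> x # drop k (map (tok \<sigma> w) ts)))"
      using w(2) by (intro k(2)) (auto simp: col_\<sigma>)
    also have "take k (map (tok \<sigma> w) ts) @ \<sigma> x # drop k (map (tok \<sigma> w) ts) = map (tok \<sigma> xs) us"
      by (simp add: us_def w(1) take_map drop_map tok_def shift_def)
    finally show ?thesis
      by (simp add: w(1) ts(3)[OF w(3)] frag_extend_cmul)
  qed
  moreover have "length us = length (c # p)"
    using k(1) ts(1) by (simp add: us_def q_def)
  moreover have "\<forall>t\<in>set us. fst t \<and> snd t < length (c # p)"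
  proof
    fix t assume "t \<in> set us"
    then have "t = (True, 0) \<or> t \<in> set (map shift ts)"
      unfolding us_def using set_take_subset set_drop_subset by fastforce
    then show "fst t \<and> snd t < length (c # p)"
      using ts(2) by (auto simp: shift_def)
  qed
  ultimately show ?case
    by blast
qed

text \<open>The clause on \<open>hd ts\<close> records that each term starts with the original first
  vertex. This unmoved vertex later makes the induced maps of nerves open and locally
  injective.\<close>

lemma prism_word:
  "\<exists>L. (\<forall>(e, ts)\<in>set L. length ts = Suc (length p) \<and> hd ts = (False, 0) \<and> (\<forall>t\<in>set ts. snd t < length p))
     \<and> (\<forall>xs. map col xs = p \<longrightarrow> prism xs = word_chain \<sigma> L xs)"
proof (induction p)
  case Nil
  show ?case
    by (rule exI[of _ "[]"]) (simp add: word_chain_def)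
next
  case (Cons c p)
  then obtain L where L: "\<And>e ts. (e, ts) \<in> set L \<Longrightarrow>
      length ts = Suc (length p) \<and> (\<forall>t\<in>set ts. snd t < length p)"
    "\<And>xs. map col xs = p \<Longrightarrow> prism xs = word_chain \<sigma> L xs"
    by fast
  obtain e0 ts0 where s: "length ts0 = length (c # p)" "\<forall>t\<in>set ts0. fst t \<and> snd t < length (c # p)"
    "\<And>xs. map col xs = c # p \<Longrightarrow> srt xs = frag_cmul e0 (frag_of (map (tok \<sigma> xs) ts0))"
    using srt_word[of "c # p"] by blast
  define L' where "L' = map (\<lambda>(e, ts). (- e, ts)) (map (\<lambda>(e, ts). (e, (False, 0) # map shift ts)) L
      @ [(e0, (False, 0) # ts0)])"
  have "prism xs = word_chain \<sigma> L' xs" if xs: "map col xs = c # p" for xs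
  proof -
    obtain x w where w: "xs = x # w" "col x = c" "map col w = p"
      using xs by (cases xs) auto
    have "tok \<sigma> xs (False, 0) = x"
      by (simp add: tok_def w)
    then have "tcone x (srt xs) = word_chain \<sigma> [(e0, (False, 0) # ts0)] xs"
      by (simp add: s(3)[OF xs] tcone_def frag_extend_cmul word_chain_def)
    moreover have "prism xs = - (tcone x (prism w) + tcone x (srt xs))"
      by (simp add: w(1) tcone_linear)
    ultimately show ?thesis
      unfolding L'_def minus_word_chain[symmetric]
      using L(2)[OF w(3)] tcone_word_chain[of x \<sigma> L w] by (simp add: word_chain_def w(1))
  qed
  moreover have "\<forall>(e, ts)\<in>set L'. length ts = Suc (length (c # p)) \<and> hd ts = (False, 0)
      \<and> (\<forall>t\<in>set ts. snd t < length (c # p))"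
    using L(1) s(1,2) by (fastforce simp: L'_def shift_def)
  ultimately show ?case
    by blast
qed

end

section \<open>Principal ample groupoids\<close>

locale principal_ample = topological_groupoid G for G :: "'a top_groupoid" +
  assumes Hausdorff: "Hausdorff_space (top_of G)"
    and principal: "principal_groupoid G"
    and ample: "ample G"
begin

abbreviation "T \<equiv> top_of G"

lemma topspace_T [simp]: "topspace T = arrows G"
  by (simp add: arrows_def)

definition compact_open_bisection :: "'a set \<Rightarrow> bool" where
  "compact_open_bisection B \<longleftrightarrow> open_bisection G B \<and> compactin T B"

lemma rng_unit: "x \<in> units G \<Longrightarrow> rng G x = x"
  by (auto simp: units_def rng_rng)

lemma src_unit: "x \<in> units G \<Longrightarrow> src G x = x"
  by (auto simp: units_def src_rng)

lemma rng_in_units: "g \<in> arrows G \<Longrightarrow> rng G g \<in> units G"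
  by (simp add: units_def)

lemma src_in_units: "g \<in> arrows G \<Longrightarrow> src G g \<in> units G"
  unfolding units_def by (metis image_eqI rng_src src_closed)

lemma units_subset: "units G \<subseteq> arrows G"
  by (auto simp: units_def rng_closed)

lemma openin_basis:
  assumes "openin T O'" "g \<in> O'"
  obtains B where "compact_open_bisection B" "g \<in> B" "B \<subseteq> O'"
proof -
  have "(arbitrary union_of (\<lambda>B. open_bisection G B \<and> compactin T B)) O'"
    using ample assms(1) unfolding ample_def by metis
  then show ?thesis
    using that assms(2) unfolding arbitrary_union_of_alt compact_open_bisection_def by metis
qed

lemma compact_open_bisectionD:
  assumes "compact_open_bisection B"
  shows "openin T B" "compactin T B" "B \<subseteq> arrows G" "inj_on (rng G) B" "inj_on (src G) B"
    "openin (unit_space G) (rng G ` B)" "openin (unit_space G) (src G ` B)"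
proof -
  have B: "openin T B" "B \<subseteq> arrows G" "compactin T B"
    and h: "homeomorphic_map (subtopology T B) (subtopology T (rng G ` B)) (rng G)"
      "homeomorphic_map (subtopology T B) (subtopology T (src G ` B)) (src G)"
    using assms by (auto simp: compact_open_bisection_def open_bisection_def bisection_def)
  show "openin T B" "compactin T B" "B \<subseteq> arrows G"
    by (fact B)+
  have "topspace (subtopology T B) = B"
    using B(2) by auto
  then show "inj_on (rng G) B" "inj_on (src G) B"
    using homeomorphic_imp_injective_map[OF h(1)] homeomorphic_imp_injective_map[OF h(2)] by auto
  show "openin (unit_space G) (rng G ` B)" "openin (unit_space G) (src G ` B)"
    using assms by (auto simp: compact_open_bisection_def open_bisection_def)
qed

lemma compact_open_bisection_closed: "compact_open_bisection B \<Longrightarrow> closedin T B"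
  by (simp add: compact_open_bisectionD compactin_imp_closedin Hausdorff)

text \<open>If g and its source lie in one bisection, they have the same source there, so g equals
  its source. This happens for all g near a unit.\<close>

lemma openin_units: "openin T (units G)"
proof (subst openin_subopen, intro ballI)
  fix x assume x: "x \<in> units G"
  then have "x \<in> arrows G"
    using units_subset by blast
  then obtain B where B: "compact_open_bisection B" "x \<in> B"
    by (rule openin_basis[OF openin_topspace, unfolded topspace_T])
  define W where "W = B \<inter> {g \<in> arrows G. src G g \<in> B}"
  have "openin T W"
    unfolding W_def
    using openin_continuous_map_preimage[OF continuous_src compact_open_bisectionD(1)[OF B(1)]] compact_open_bisectionD(1)[OF B(1)] by auto
  moreover have "W \<subseteq> units G"
  proof
    fix g assume "g \<in> W"
    then have g: "g \<in> B" "src G g \<in> B" "g \<in> arrows G"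
      by (auto simp: W_def)
    have "src G (src G g) = src G g"
      by (simp add: g src_src)
    then have "g = src G g"
      using g compact_open_bisectionD(5)[OF B(1)] by (auto dest: inj_onD)
    then show "g \<in> units G"
      using src_in_units g(3) by metis
  qed
  moreover have "x \<in> W"
    using x B \<open>x \<in> arrows G\<close> by (simp add: W_def src_unit)
  ultimately show "\<exists>W. openin T W \<and> x \<in> W \<and> W \<subseteq> units G"
    by blast
qed

lemma openin_unit_space: "openin (unit_space G) U \<longleftrightarrow> openin T U \<and> U \<subseteq> units G"
  unfolding unit_space_def by (rule openin_open_subtopology[OF openin_units])

lemma topspace_unit_space [simp]: "topspace (unit_space G) = units G"
  using units_subset by (auto simp: unit_space_def)

lemma open_rng:
  assumes "openin T O'"
  shows "openin T (rng G ` O')"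
proof (subst openin_subopen, intro ballI)
  fix x assume "x \<in> rng G ` O'"
  then obtain g where g: "g \<in> O'" "x = rng G g"
    by auto
  obtain B where B: "compact_open_bisection B" "g \<in> B" "B \<subseteq> O'"
    using openin_basis[OF assms g(1)] .
  then show "\<exists>W. openin T W \<and> x \<in> W \<and> W \<subseteq> rng G ` O'"
    using compact_open_bisectionD(6)[OF B(1)] g by (intro exI[of _ "rng G ` B"]) (auto simp: openin_unit_space)
qed

lemma open_src:
  assumes "openin T O'"
  shows "openin T (src G ` O')"
proof (subst openin_subopen, intro ballI)
  fix x assume "x \<in> src G ` O'"
  then obtain g where g: "g \<in> O'" "x = src G g"
    by auto
  obtain B where B: "compact_open_bisection B" "g \<in> B" "B \<subseteq> O'"
    using openin_basis[OF assms g(1)] .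
  then show "\<exists>W. openin T W \<and> x \<in> W \<and> W \<subseteq> src G ` O'"
    using compact_open_bisectionD(7)[OF B(1)] g by (intro exI[of _ "src G ` B"]) (auto simp: openin_unit_space)
qed

text \<open>The product of g with the inverse of h has equal range and source, hence is a unit by
  principality. Thus the groupoid is an equivalence relation on its units, with its own
  topology.\<close>

lemma arrow_unique:
  assumes "g \<in> arrows G" "h \<in> arrows G" "rng G g = rng G h" "src G g = src G h"
  shows "g = h"
proof -
  have c: "(g, ginv G h) \<in> composable_pairs G" "(ginv G h, h) \<in> composable_pairs G"
    using assms by (auto simp: composable_pairs_def ginv_closed rng_ginv src_ginv)
  define k where "k = gcomp G g (ginv G h)"
  have k: "k \<in> arrows G" "rng G k = rng G g" "src G k = rng G h"
    using c assms by (simp_all add: k_def comp_closed rng_comp src_comp src_ginv)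
  then have "k \<in> units G"
    using principal assms(3) by (auto simp: principal_groupoid_def)
  then have "k = rng G h"
    using k src_unit by metis
  moreover have "gcomp G k h = gcomp G g (src G h)"
    using comp_assoc[OF c] comp_ginv_left[OF assms(2)] by (simp add: k_def)
  ultimately show ?thesis
    using comp_unit_left[OF assms(2)] comp_unit_right[OF assms(1)] assms(4) by simp
qed

section \<open>The orbit equivalence relation\<close>

definition rel :: "'a \<Rightarrow> 'a \<Rightarrow> bool" where
  "rel x y \<longleftrightarrow> (\<exists>g\<in>arrows G. rng G g = x \<and> src G g = y)"

definition arr :: "'a \<Rightarrow> 'a \<Rightarrow> 'a" where
  "arr x y = (THE g. g \<in> arrows G \<and> rng G g = x \<and> src G g = y)"

lemma arr_eq: "g \<in> arrows G \<Longrightarrow> rng G g = x \<Longrightarrow> src G g = y \<Longrightarrow> arr x y = g"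
  unfolding arr_def by (rule the_equality) (auto intro: arrow_unique)

lemma rel_arr:
  assumes "rel x y"
  shows "arr x y \<in> arrows G" "rng G (arr x y) = x" "src G (arr x y) = y"
  using assms arr_eq unfolding rel_def by auto

lemma rel_units: "rel x y \<Longrightarrow> x \<in> units G \<and> y \<in> units G"
  unfolding rel_def using rng_in_units src_in_units by auto

lemma rel_refl: "x \<in> units G \<Longrightarrow> rel x x"
  unfolding rel_def using rng_unit src_unit units_subset by blast

lemma rel_sym: "rel x y \<Longrightarrow> rel y x"
  unfolding rel_def using ginv_closed rng_ginv src_ginv by metis

lemma composable_arr: "rel x y \<Longrightarrow> rel y z \<Longrightarrow> (arr x y, arr y z) \<in> composable_pairs G"
  by (simp add: composable_pairs_def rel_arr)

lemma rel_trans: "rel x y \<Longrightarrow> rel y z \<Longrightarrow> rel x z"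
  unfolding rel_def[of x z]
  using composable_arr[of x y z] rel_arr comp_closed rng_comp src_comp by metis

lemma arr_unit: "x \<in> units G \<Longrightarrow> arr x x = x"
  using units_subset by (intro arr_eq) (auto simp: rng_unit src_unit)

lemma arr_sym: "rel x y \<Longrightarrow> arr y x = ginv G (arr x y)"
  by (intro arr_eq) (auto simp: rel_arr ginv_closed rng_ginv src_ginv)

lemma arr_trans: "rel x y \<Longrightarrow> rel y z \<Longrightarrow> arr x z = gcomp G (arr x y) (arr y z)"
  using composable_arr[of x y z]
  by (intro arr_eq) (auto simp: rel_arr comp_closed rng_comp src_comp)

text \<open>Since composition and inversion are continuous, continuous families of arrows between
  families of units \<open>u\<close>, \<open>v\<close> define an equivalence relation on such families. All continuity
  statements about tuples of arrows are reduced to it.\<close>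

definition crel :: "'b topology \<Rightarrow> ('b \<Rightarrow> 'a) \<Rightarrow> ('b \<Rightarrow> 'a) \<Rightarrow> bool" where
  "crel Y u v \<longleftrightarrow> (\<forall>y\<in>topspace Y. rel (u y) (v y)) \<and> continuous_map Y T (\<lambda>y. arr (u y) (v y))"

lemma crel_rel: "crel Y u v \<Longrightarrow> y \<in> topspace Y \<Longrightarrow> rel (u y) (v y)"
  by (simp add: crel_def)

lemma crel_refl:
  assumes "continuous_map Y T u" "\<And>y. y \<in> topspace Y \<Longrightarrow> u y \<in> units G"
  shows "crel Y u u"
  unfolding crel_def
proof (intro conjI ballI)
  show "continuous_map Y T (\<lambda>y. arr (u y) (u y))"
    by (rule continuous_map_eq[OF assms(1)]) (simp add: assms(2) arr_unit)
qed (simp add: assms(2) rel_refl)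

lemma crel_sym: "crel Y u v \<Longrightarrow> crel Y v u"
  unfolding crel_def
proof (intro conjI ballI)
  assume a: "(\<forall>y\<in>topspace Y. rel (u y) (v y)) \<and> continuous_map Y T (\<lambda>y. arr (u y) (v y))"
  then show "rel (v y) (u y)" if "y \<in> topspace Y" for y
    using that rel_sym by blast
  have "continuous_map Y T (ginv G \<circ> (\<lambda>y. arr (u y) (v y)))"
    using a continuous_ginv by (blast intro: continuous_map_compose)
  then show "continuous_map Y T (\<lambda>y. arr (v y) (u y))"
    by (rule continuous_map_eq) (use a arr_sym in auto)
qed

lemma crel_trans:
  assumes "crel Y u v" "crel Y v w"
  shows "crel Y u w"
  unfolding crel_def
proof (intro conjI ballI)
  show "rel (u y) (w y)" if "y \<in> topspace Y" for y
    using that assms rel_trans unfolding crel_def by blast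
  have "continuous_map Y (subtopology (prod_topology T T) (composable_pairs G))
      (\<lambda>y. (arr (u y) (v y), arr (v y) (w y)))"
    using assms composable_arr
    by (auto simp: crel_def continuous_map_in_subtopology continuous_map_pairedI image_subset_iff_funcset Pi_iff)
  then have "continuous_map Y T ((\<lambda>(g, h). gcomp G g h) \<circ> (\<lambda>y. (arr (u y) (v y), arr (v y) (w y))))"
    using continuous_comp by (rule continuous_map_compose)
  then show "continuous_map Y T (\<lambda>y. arr (u y) (w y))"
    by (rule continuous_map_eq) (use assms arr_trans in \<open>auto simp: crel_def\<close>)
qed

lemma crel_continuous:
  assumes "crel Y u v"
  shows "continuous_map Y T u" "continuous_map Y T v"
proof -
  have "continuous_map Y T (rng G \<circ> (\<lambda>y. arr (u y) (v y)))"
    "continuous_map Y T (src G \<circ> (\<lambda>y. arr (u y) (v y)))"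
    using assms continuous_rng continuous_src by (auto simp: crel_def intro: continuous_map_compose)
  then show "continuous_map Y T u" "continuous_map Y T v"
    using rel_arr(2,3)[OF crel_rel[OF assms]] by (auto elim: continuous_map_eq)
qed

lemma crel_compose:
  assumes "crel Y u v" "continuous_map Z Y f"
  shows "crel Z (\<lambda>z. u (f z)) (\<lambda>z. v (f z))"
  unfolding crel_def
proof (intro conjI ballI)
  show "rel (u (f z)) (v (f z))" if "z \<in> topspace Z" for z
    using that assms by (auto simp: crel_def continuous_map_def)
  show "continuous_map Z T (\<lambda>z. arr (u (f z)) (v (f z)))"
    using continuous_map_compose[OF assms(2), of T "\<lambda>y. arr (u y) (v y)"] assms(1)
    by (simp add: crel_def comp_def)
qed

lemma crel_subtopology: "crel Y u v \<Longrightarrow> crel (subtopology Y S) u v"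
  by (auto simp: crel_def continuous_map_from_subtopology)

lemma crel_cong:
  assumes "crel Y u v" "\<And>y. y \<in> topspace Y \<Longrightarrow> u y = u' y" "\<And>y. y \<in> topspace Y \<Longrightarrow> v y = v' y"
  shows "crel Y u' v'"
  using assms unfolding crel_def by (auto elim: continuous_map_eq)

lemma crel_rng_src:
  assumes "continuous_map Y T f"
  shows "crel Y (\<lambda>y. rng G (f y)) (\<lambda>y. src G (f y))"
proof -
  have "f y \<in> arrows G" if "y \<in> topspace Y" for y
    using assms that by (auto simp: continuous_map_def)
  then show ?thesis
    unfolding crel_def rel_def
    by (intro conjI ballI continuous_map_eq[OF assms]) (blast, simp add: arr_eq[OF _ refl refl])
qed

section \<open>The nerve\<close>

text \<open>The passage to tuples of units: the arrow number j runs from vertex j to vertex j - 1.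
  In degree 0 the single unit is stored at index 1. The inverse passage is
  \<open>tup\<close>.\<close>

definition vert :: "nat \<Rightarrow> (nat \<Rightarrow> 'a) \<Rightarrow> nat \<Rightarrow> 'a" where
  "vert n g j = (if n = 0 then g 1 else if j = 0 then rng G (g 1) else src G (g j))"

definition tup :: "nat \<Rightarrow> (nat \<Rightarrow> 'a) \<Rightarrow> nat \<Rightarrow> 'a" where
  "tup n x = (if n = 0 then (\<lambda>j\<in>{1}. x 0) else (\<lambda>j\<in>{1..n}. arr (x (j - 1)) (x j)))"

abbreviation "N \<equiv> nerve G"

lemma topspace_nerve:
  "topspace (N n) = (if n = 0 then {1} \<rightarrow>\<^sub>E units G
     else {g \<in> {1..n} \<rightarrow>\<^sub>E arrows G. \<forall>i. 1 \<le> i \<and> i < n \<longrightarrow> src G (g i) = rng G (g (i + 1))})"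
  by (cases "n = 0") (simp_all add: nerve_def comp_def Collect_conj_eq)

lemma nerve_arrow: "g \<in> topspace (N n) \<Longrightarrow> j \<in> {1..n} \<Longrightarrow> g j \<in> arrows G"
  by (auto simp: topspace_nerve split: if_splits)

lemma vert_in_units: "g \<in> topspace (N n) \<Longrightarrow> j \<le> n \<Longrightarrow> vert n g j \<in> units G"
  using nerve_arrow[of g n]
  by (auto simp: vert_def rng_in_units src_in_units) (auto simp: topspace_nerve)

lemma rng_nerve: "g \<in> topspace (N n) \<Longrightarrow> j \<in> {1..n} \<Longrightarrow> rng G (g j) = vert n g (j - 1)"
  by (cases "j = 1") (auto simp: topspace_nerve vert_def dest!: spec[of _ "j - 1"])

lemma src_nerve: "j \<in> {1..n} \<Longrightarrow> src G (g j) = vert n g j"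
  by (auto simp: vert_def)

lemma tup_vert:
  assumes "g \<in> topspace (N n)"
  shows "tup n (vert n g) = g"
proof
  fix j
  show "tup n (vert n g) j = g j"
  proof (cases "n = 0")
    case True
    then show ?thesis
      using assms by (auto simp: tup_def vert_def topspace_nerve PiE_def extensional_def)
  next
    case False
    have "arr (vert n g (j - 1)) (vert n g j) = g j" if "j \<in> {1..n}"
      using that assms by (intro arr_eq) (auto simp: nerve_arrow rng_nerve src_nerve)
    then show ?thesis
      using assms False by (auto simp: tup_def topspace_nerve PiE_def extensional_def)
  qed
qed

lemma vert_inject:
  assumes "g \<in> topspace (N n)" "h \<in> topspace (N n)" "\<And>j. j \<le> n \<Longrightarrow> vert n g j = vert n h j"
  shows "g = h"
proof -
  have "tup n (vert n g) = tup n (vert n h)"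
    using assms(3) by (auto simp: tup_def fun_eq_iff)
  then show ?thesis
    using assms tup_vert by simp
qed

text \<open>Consecutive vertices are joined by a coordinate of the nerve, which is continuous;
  transitivity of \<open>crel\<close> chains these arrows together.\<close>

lemma crel_vert_0:
  assumes "j \<le> n"
  shows "crel (N n) (\<lambda>g. vert n g 0) (\<lambda>g. vert n g j)"
  using assms
proof (induction j)
  case 0
  have "continuous_map (N n) T (\<lambda>g. vert n g 0)"
  proof (cases "n = 0")
    case True
    have "continuous_map (product_topology (\<lambda>_. unit_space G) {1}) (unit_space G) (\<lambda>g. g (1::nat))"
      by (rule continuous_map_product_projection) simp
    then show ?thesis
      by (simp add: True nerve_def vert_def unit_space_def continuous_map_in_subtopology)
  next
    case False
    have "continuous_map (product_topology (\<lambda>_. T) {1..n}) T (\<lambda>g. g (1::nat))"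
      using False by (intro continuous_map_product_projection) simp
    then have "continuous_map (N n) T (rng G \<circ> (\<lambda>g. g 1))"
      using False continuous_rng
      by (auto simp: nerve_def intro: continuous_map_compose continuous_map_from_subtopology)
    then show ?thesis
      by (simp add: False vert_def comp_def)
  qed
  then show ?case
    by (rule crel_refl) (simp add: vert_in_units)
next
  case (Suc j)
  have "continuous_map (product_topology (\<lambda>_. T) {1..n}) T (\<lambda>g. g (Suc j))"
    using Suc.prems by (intro continuous_map_product_projection) simp
  then have "continuous_map (N n) T (\<lambda>g. g (Suc j))"
    using Suc.prems by (auto simp: nerve_def intro: continuous_map_from_subtopology)
  then have "crel (N n) (\<lambda>g. rng G (g (Suc j))) (\<lambda>g. src G (g (Suc j)))"
    by (rule crel_rng_src)
  then have "crel (N n) (\<lambda>g. vert n g j) (\<lambda>g. vert n g (Suc j))"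
    by (rule crel_cong) (use Suc.prems in \<open>auto simp: rng_nerve src_nerve\<close>)
  then show ?case
    using Suc by (auto intro: crel_trans)
qed

lemma crel_vert:
  assumes "i \<le> n" "j \<le> n"
  shows "crel (N n) (\<lambda>g. vert n g i) (\<lambda>g. vert n g j)"
  using crel_trans[OF crel_sym[OF crel_vert_0[OF assms(1)]] crel_vert_0[OF assms(2)]] .

lemma continuous_vert: "j \<le> n \<Longrightarrow> continuous_map (N n) T (\<lambda>g. vert n g j)"
  using crel_continuous(2)[OF crel_vert_0] .

lemma rel_vert: "g \<in> topspace (N n) \<Longrightarrow> i \<le> n \<Longrightarrow> j \<le> n \<Longrightarrow> rel (vert n g i) (vert n g j)"
  using crel_rel[OF crel_vert] .

lemma tup_in_nerve:
  assumes "\<And>j. j \<le> n \<Longrightarrow> rel (x 0) (x j)"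
  shows "tup n x \<in> topspace (N n)" "j \<le> n \<Longrightarrow> vert n (tup n x) j = x j"
proof -
  have r: "rel (x i) (x j)" if "i \<le> n" "j \<le> n" for i j
    using assms that rel_sym rel_trans by blast
  show "tup n x \<in> topspace (N n)"
  proof (cases "n = 0")
    case True
    then show ?thesis
      using rel_units[OF assms[of 0]] by (auto simp: tup_def topspace_nerve)
  next
    case False
    then show ?thesis
      using r by (auto simp: tup_def topspace_nerve rel_arr PiE_def)
  qed
  show "vert n (tup n x) j = x j" if "j \<le> n"
    using that r by (auto simp: vert_def tup_def rel_arr)
qed

text \<open>Converse to \<open>crel_vert\<close>: continuous maps into the nerve amount to families
  of units that are pairwise continuously related.\<close>

lemma continuous_tup:
  assumes "\<And>j. j \<le> n \<Longrightarrow> crel Y (\<lambda>y. x y 0) (\<lambda>y. x y j)"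
  shows "continuous_map Y (N n) (\<lambda>y. tup n (x y))"
proof -
  have r: "crel Y (\<lambda>y. x y i) (\<lambda>y. x y j)" if "i \<le> n" "j \<le> n" for i j
    using assms that crel_sym crel_trans by blast
  show ?thesis
  proof (cases "n = 0")
    case True
    have "continuous_map Y T (\<lambda>y. x y 0)"
      using crel_continuous[OF r] by blast
    then show ?thesis
      using rel_units crel_rel[OF r[of 0 0]]
      by (auto simp: True nerve_def tup_def continuous_map_componentwise unit_space_def
          continuous_map_in_subtopology)
  next
    case False
    have "tup n (x y) \<in> topspace (N n)" if "y \<in> topspace Y" for y
      using that by (intro tup_in_nerve crel_rel[OF assms])
    moreover have "continuous_map Y (product_topology (\<lambda>_. T) {1..n}) (\<lambda>y. tup n (x y))"
      unfolding continuous_map_componentwise using False r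
      by (auto simp: tup_def crel_def)
    ultimately show ?thesis
      using False by (auto simp: nerve_def continuous_map_in_subtopology)
  qed
qed

section \<open>Vertex maps of the nerve as local homeomorphisms\<close>

lemma Hausdorff_nerve: "Hausdorff_space (N n)"
  unfolding nerve_def unit_space_def
  using Hausdorff by (auto simp: Hausdorff_space_product_topology intro!: Hausdorff_space_subtopology)

text \<open>In a Hausdorff space the composability conditions are closed in the product, so a box of
  compact open bisections stays compact after restriction to them.\<close>

lemma compact_open_basis_nerve:
  assumes "openin (N n) O'" "g \<in> O'"
  obtains B where "openin (N n) B" "compactin (N n) B" "g \<in> B" "B \<subseteq> O'"
proof (cases "n = 0")
  case True
  then have "openin (product_topology (\<lambda>_. unit_space G) {1}) O'"
    using assms(1) by (simp add: nerve_def)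
  then obtain U where U: "openin (unit_space G) (U (1::nat))" "g \<in> PiE {1} U" "PiE {1} U \<subseteq> O'"
    unfolding openin_product_topology_alt using assms(2) by (metis singletonI)
  have "g 1 \<in> U 1"
    using U(2) by auto
  then obtain B where B: "compact_open_bisection B" "g 1 \<in> B" "B \<subseteq> U 1"
    using U(1) openin_basis openin_unit_space by metis
  have "openin (unit_space G) B" "compactin (unit_space G) B"
  proof -
    have "B \<subseteq> units G"
      using B(3) U(1) openin_unit_space by blast
    then show "openin (unit_space G) B" "compactin (unit_space G) B"
      using compact_open_bisectionD(1,2)[OF B(1)] by (simp_all add: openin_unit_space compactin_subtopology unit_space_def[THEN arg_cong[of _ _ "\<lambda>X. compactin X B"]])
  qed
  then have "openin (N n) (PiE {1} (\<lambda>_. B))" "compactin (N n) (PiE {1} (\<lambda>_. B))"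
    using True by (simp_all add: nerve_def compactin_PiE openin_PiE)
  moreover have "g \<in> PiE {1} (\<lambda>_. B)" "PiE {1} (\<lambda>_. B) \<subseteq> O'"
    using U(2,3) B by (auto simp: PiE_iff)
  ultimately show ?thesis
    using that by blast
next
  case False
  define P where "P = product_topology (\<lambda>_. T) {1..n}"
  define C where "C = {g. \<forall>i. 1 \<le> i \<and> i < n \<longrightarrow> src G (g i) = rng G (g (i + 1))}"
  have N: "N n = subtopology P C"
    using False by (simp add: nerve_def P_def C_def)
  obtain O2 where O2: "openin P O2" "O' = O2 \<inter> C"
    using assms(1) unfolding N openin_subtopology by auto
  then obtain U where U: "\<And>i. i \<in> {1..n} \<Longrightarrow> openin T (U i)" "g \<in> PiE {1..n} U" "PiE {1..n} U \<subseteq> O2"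
    using assms(2) unfolding P_def openin_product_topology_alt by (metis IntD1)
  have "\<exists>B. compact_open_bisection B \<and> g i \<in> B \<and> B \<subseteq> U i" if "i \<in> {1..n}" for i
    using U that openin_basis by (metis PiE_mem)
  then obtain B where B: "\<And>i. i \<in> {1..n} \<Longrightarrow> compact_open_bisection (B i) \<and> g i \<in> B i \<and> B i \<subseteq> U i"
    by metis
  define W where "W = PiE {1..n} B \<inter> C"
  have closed: "closedin P (topspace P \<inter> C)"
  proof -
    have eq: "topspace P \<inter> C = topspace P \<inter>
        (\<Inter>i\<in>{1..<n}. {g \<in> topspace P. src G (g i) = rng G (g (i + 1))})"
      by (auto simp: C_def)
    have "closedin P {g \<in> topspace P. src G (g i) = rng G (g (i + 1))}" if "i \<in> {1..<n}" for i
    proof (rule closedin_continuous_maps_eq[OF Hausdorff])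
      have "continuous_map P T (\<lambda>g. g i)" "continuous_map P T (\<lambda>g. g (i + 1))"
        using that unfolding P_def by (auto intro: continuous_map_product_projection)
      then show "continuous_map P T (\<lambda>g. src G (g i))" "continuous_map P T (\<lambda>g. rng G (g (i + 1)))"
        using continuous_map_compose[OF _ continuous_src] continuous_map_compose[OF _ continuous_rng]
        by (auto simp: comp_def)
    qed
    then show ?thesis
      unfolding eq by (cases "{1..<n} = {}") (auto intro!: closedin_Int closedin_INT)
  qed
  have op: "openin P (PiE {1..n} B)"
    unfolding P_def using B compact_open_bisectionD(1) by (simp add: openin_PiE)
  have cp: "compactin P (PiE {1..n} B)"
    unfolding P_def using B compact_open_bisectionD(2) by (auto simp: compactin_PiE)
  have "openin (N n) W"
    unfolding N W_def openin_subtopology using op by blast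
  moreover have "compactin (N n) W"
  proof -
    have "W = (topspace P \<inter> C) \<inter> PiE {1..n} B"
      unfolding W_def using openin_subset[OF op] by blast
    then show ?thesis
      using closed_Int_compactin[OF closed cp] unfolding N compactin_subtopology by (auto simp: W_def)
  qed
  moreover have "g \<in> W"
    using assms(2) O2(2) U(2) B unfolding W_def by (auto simp: PiE_iff)
  moreover have "PiE {1..n} B \<subseteq> PiE {1..n} U"
    using B by (intro PiE_mono) blast
  then have "W \<subseteq> O'"
    using O2(2) U(3) unfolding W_def by blast
  ultimately show ?thesis
    using that by blast
qed

lemma clopen_preimage_arr:
  assumes "compact_open_bisection C" "i \<le> n" "j \<le> n"
  defines "S \<equiv> {g \<in> topspace (N n). arr (vert n g i) (vert n g j) \<in> C}"
  shows "openin (N n) S" "closedin (N n) S"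
  using crel_vert[OF assms(2,3)] compact_open_bisectionD(1)[OF assms(1)] compact_open_bisection_closed[OF assms(1)]
  unfolding S_def crel_def
  by (auto intro: openin_continuous_map_preimage closedin_continuous_map_preimage)

text \<open>The basic set is cut down until all arrows from vertex j to vertex i lie in one
  bisection for each pair of indices. An arrow of a bisection is determined by its range, so one
  vertex determines the whole tuple.\<close>

lemma bisection_basis_nerve:
  assumes "openin (N n) O'" "g \<in> O'"
  obtains B where "openin (N n) B" "compactin (N n) B" "g \<in> B" "B \<subseteq> O'"
    "\<And>j. j \<le> n \<Longrightarrow> inj_on (\<lambda>g. vert n g j) B"
proof -
  have g: "g \<in> topspace (N n)"
    using assms openin_subset by blast
  have "\<exists>C. compact_open_bisection C \<and> arr (vert n g i) (vert n g j) \<in> C" if "i \<le> n" "j \<le> n" for i j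
    using openin_basis[OF openin_topspace] rel_arr(1)[OF rel_vert[OF g that]] by (metis topspace_T)
  then obtain C where C: "\<And>i j. i \<le> n \<Longrightarrow> j \<le> n \<Longrightarrow> compact_open_bisection (C i j) \<and> arr (vert n g i) (vert n g j) \<in> C i j"
    by metis
  obtain B where B: "openin (N n) B" "compactin (N n) B" "g \<in> B" "B \<subseteq> O'"
    using compact_open_basis_nerve[OF assms] .
  define S where "S i j = {g \<in> topspace (N n). arr (vert n g i) (vert n g j) \<in> C i j}" for i j
  define D where "D = B \<inter> (\<Inter>i\<le>n. \<Inter>j\<le>n. S i j)"
  have S: "openin (N n) (S i j)" "closedin (N n) (S i j)" if "i \<le> n" "j \<le> n" for i j
    using clopen_preimage_arr[OF _ that, of "C i j"] C[OF that] unfolding S_def by auto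
  have D: "openin (N n) D"
    unfolding D_def using B(1) S(1) by (intro openin_Int openin_INT2) auto
  have "closedin (N n) (\<Inter>i\<le>n. \<Inter>j\<le>n. S i j)"
    using S(2) by (intro closedin_INT) auto
  then have cD: "compactin (N n) D"
    unfolding D_def using B(2) by (simp add: compact_Int_closedin)
  have gD: "g \<in> D"
    using C g B(3) by (auto simp: D_def S_def)
  have "inj_on (\<lambda>g. vert n g j) D" if j: "j \<le> n" for j
  proof (rule inj_onI)
    fix x y assume xy: "x \<in> D" "y \<in> D" "vert n x j = vert n y j"
    then have t: "x \<in> topspace (N n)" "y \<in> topspace (N n)"
      using B(1) openin_subset by (auto simp: D_def)
    show "x = y"
    proof (rule vert_inject[OF t])
      fix l assume l: "l \<le> n"
      have "arr (vert n x j) (vert n x l) \<in> C j l" "arr (vert n y j) (vert n y l) \<in> C j l"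
        using xy(1,2) j l unfolding D_def S_def by blast+
      moreover have "rng G (arr (vert n x j) (vert n x l)) = rng G (arr (vert n y j) (vert n y l))"
        using rel_arr(2)[OF rel_vert[OF t(1) j l]] rel_arr(2)[OF rel_vert[OF t(2) j l]] xy(3) by argo
      ultimately have "arr (vert n x j) (vert n x l) = arr (vert n y j) (vert n y l)"
        using C[OF j l] compact_open_bisectionD(4) by (meson inj_onD)
      then show "vert n x l = vert n y l"
        using rel_arr(3)[OF rel_vert[OF t(1) j l]] rel_arr(3)[OF rel_vert[OF t(2) j l]] by argo
    qed
  qed
  then show ?thesis
    using that[OF D cD gD] B(4) by (auto simp: D_def)
qed

text \<open>The map \<open>u\<close> is the partial homeomorphism of the unit space defined by the
  bisection: it sends the range of an arrow to its source.\<close>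

lemma local_section:
  assumes "compact_open_bisection C" "g \<in> C"
  obtains W u where "openin T W" "rng G g \<in> W" "W \<subseteq> units G" "u (rng G g) = src G g"
    "crel (subtopology T W) (\<lambda>x. x) u" "\<And>x. x \<in> W \<Longrightarrow> arr x (u x) \<in> C"
proof -
  define W where "W = rng G ` C"
  have W: "openin T W" "W \<subseteq> units G"
    using compact_open_bisectionD(6)[OF assms(1)] by (simp_all add: W_def openin_unit_space)
  have "homeomorphic_map (subtopology T C) (subtopology T W) (rng G)"
    using assms(1) by (simp add: compact_open_bisection_def open_bisection_def bisection_def W_def)
  then obtain k where k: "homeomorphic_maps (subtopology T C) (subtopology T W) (rng G) k"
    using homeomorphic_map_maps by blast
  have kc: "continuous_map (subtopology T W) T k"
    using k by (auto simp: homeomorphic_maps_def continuous_map_in_subtopology)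
  have tW: "topspace (subtopology T W) = W" and tC: "topspace (subtopology T C) = C"
    using openin_subset[OF W(1)] compact_open_bisectionD(3)[OF assms(1)] by auto
  have k1: "k x \<in> C" "rng G (k x) = x" if "x \<in> W" for x
    using k that tW tC unfolding homeomorphic_maps_def continuous_map_def by auto
  have "k (rng G g) = g"
    using k assms(2) tC by (auto simp: homeomorphic_maps_def)
  moreover have "crel (subtopology T W) (\<lambda>x. x) (\<lambda>x. src G (k x))"
    using crel_rng_src[OF kc] by (rule crel_cong) (use k1 tW in auto)
  moreover have "arr x (src G (k x)) \<in> C" if "x \<in> W" for x
    using arr_eq[of "k x" x] k1[OF that] compact_open_bisectionD(3)[OF assms(1)] by auto
  ultimately show ?thesis
    using that[of W "\<lambda>x. src G (k x)"] W assms(2) by (auto simp: W_def)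
qed

text \<open>Through each g passes a continuous local section \<open>\<tau>\<close> of the vertex
  map, assembled from local sections along the arrows from vertex j to the other vertices.\<close>

lemma open_vert:
  assumes "openin (N n) O'" "j \<le> n"
  shows "openin T ((\<lambda>g. vert n g j) ` O')"
proof (subst openin_subopen, intro ballI)
  fix x0 assume "x0 \<in> (\<lambda>g. vert n g j) ` O'"
  then obtain g where g: "g \<in> O'" "x0 = vert n g j"
    by auto
  then have gN: "g \<in> topspace (N n)"
    using assms openin_subset by blast
  have "\<exists>W u. openin T W \<and> x0 \<in> W \<and> W \<subseteq> units G \<and> u x0 = vert n g l
      \<and> crel (subtopology T W) (\<lambda>x. x) u" if l: "l \<le> n" for l
  proof -
    note r = rel_arr[OF rel_vert[OF gN assms(2) l]]
    obtain C where C: "compact_open_bisection C" "arr (vert n g j) (vert n g l) \<in> C"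
      using openin_basis[OF openin_topspace] r(1) by (metis topspace_T)
    show ?thesis
      by (rule local_section[OF C]) (use r g(2) in auto)
  qed
  then obtain W u where W: "\<And>l. l \<le> n \<Longrightarrow> openin T (W l) \<and> x0 \<in> W l \<and> W l \<subseteq> units G
      \<and> u l x0 = vert n g l \<and> crel (subtopology T (W l)) (\<lambda>x. x) (u l)"
    by metis
  define V where "V = (\<Inter>l\<le>n. W l)"
  have V: "openin T V" "x0 \<in> V" "V \<subseteq> units G"
    unfolding V_def using W by (auto intro!: openin_INT2)
  have cu: "crel (subtopology T V) (\<lambda>x. x) (u l)" if "l \<le> n" for l
  proof -
    have "subtopology (subtopology T (W l)) V = subtopology T V"
      using that by (simp add: subtopology_subtopology V_def Int_absorb2 inf.absorb2 INT_lower)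
    then show ?thesis
      using W[OF that] crel_subtopology[of "subtopology T (W l)" _ _ V] by metis
  qed
  \<comment> \<open>The bisection chosen around the unit at vertex j may contain other arrows, so
    \<open>u j\<close> need not be the identity near x0; replacing it makes \<open>\<tau>\<close> an
    exact section.\<close>
  define u' where "u' = u(j := (\<lambda>x. x))"
  have cid: "crel (subtopology T V) (\<lambda>x. x) (\<lambda>x. x)"
    using V(3) by (intro crel_refl) auto
  have cu': "crel (subtopology T V) (\<lambda>x. x) (u' l)" if "l \<le> n" for l
    using cu[OF that] cid by (simp add: u'_def)
  have c0: "crel (subtopology T V) (\<lambda>x. u' 0 x) (\<lambda>x. u' l x)" if "l \<le> n" for l
    using crel_trans[OF crel_sym[OF cu'[of 0]] cu'[OF that]] by simp
  define \<tau> where "\<tau> x = tup n (\<lambda>l. u' l x)" for x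
  have \<tau>: "continuous_map (subtopology T V) (N n) \<tau>"
    unfolding \<tau>_def using c0 by (rule continuous_tup)
  have tV: "topspace (subtopology T V) = V"
    using openin_subset[OF V(1)] by auto
  have vert_\<tau>: "vert n (\<tau> x) l = u' l x" if "x \<in> V" "l \<le> n" for x l
    unfolding \<tau>_def using that crel_rel[OF c0] tV by (intro tup_in_nerve(2)) auto
  have "\<tau> x0 = g"
  proof (rule vert_inject[OF _ gN])
    show "\<tau> x0 \<in> topspace (N n)"
      using \<tau> V(2) tV by (auto simp: continuous_map_def)
    show "vert n (\<tau> x0) l = vert n g l" if "l \<le> n" for l
      using vert_\<tau>[OF V(2) that] W[OF that] g(2) by (simp add: u'_def)
  qed
  define Q where "Q = {x \<in> V. \<tau> x \<in> O'}"
  have "openin (subtopology T V) Q"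
    using openin_continuous_map_preimage[OF \<tau> assms(1)] unfolding tV Q_def .
  then have "openin T Q"
    using V(1) openin_open_subtopology by blast
  moreover have "x0 \<in> Q"
    using V(2) \<open>\<tau> x0 = g\<close> g(1) by (simp add: Q_def)
  moreover have "Q \<subseteq> (\<lambda>g. vert n g j) ` O'"
  proof
    fix x assume "x \<in> Q"
    then show "x \<in> (\<lambda>g. vert n g j) ` O'"
      using vert_\<tau>[of x j] assms(2) by (intro image_eqI[of _ _ "\<tau> x"]) (auto simp: Q_def u'_def)
  qed
  ultimately show "\<exists>Q. openin T Q \<and> x0 \<in> Q \<and> Q \<subseteq> (\<lambda>g. vert n g j) ` O'"
    by blast
qed

text \<open>Near a point z of the image, vertex k determines the tuple. A nearby w whose vertex k is
  vertex j of some h in \<open>B'\<close> therefore equals \<open>f h\<close>, and the set of these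
  vertices is open by \<open>open_vert\<close>.\<close>

lemma open_image_nerve:
  assumes "openin (N n) B" "continuous_map (subtopology (N n) B) (N m) f" "j \<le> n" "k \<le> m"
    "\<And>g. g \<in> B \<Longrightarrow> vert m (f g) k = vert n g j"
  shows "openin (N m) (f ` B)"
proof (subst openin_subopen, intro ballI)
  fix z assume "z \<in> f ` B"
  then obtain g where g: "g \<in> B" "z = f g"
    by auto
  have tB: "topspace (subtopology (N n) B) = B"
    using openin_subset[OF assms(1)] by auto
  then have "z \<in> topspace (N m)"
    using g assms(2) by (auto simp: continuous_map_def)
  then obtain W where W: "openin (N m) W" "z \<in> W" "inj_on (\<lambda>g. vert m g k) W"
    using bisection_basis_nerve[OF openin_topspace] assms(4) by metis
  define B' where "B' = {g \<in> B. f g \<in> W}"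
  have "openin (subtopology (N n) B) B'"
    using openin_continuous_map_preimage[OF assms(2) W(1)] unfolding tB B'_def .
  then have B': "openin (N n) B'"
    using assms(1) openin_open_subtopology by blast
  define Q where "Q = W \<inter> {z \<in> topspace (N m). vert m z k \<in> (\<lambda>g. vert n g j) ` B'}"
  have "openin (N m) Q"
    unfolding Q_def
    using W(1) openin_continuous_map_preimage[OF continuous_vert[OF assms(4)] open_vert[OF B' assms(3)]]
    by (rule openin_Int)
  moreover have "z \<in> Q"
    using W(2) \<open>z \<in> topspace (N m)\<close> g assms(5) by (auto simp: Q_def B'_def)
  moreover have "Q \<subseteq> f ` B"
  proof
    fix w assume w: "w \<in> Q"
    then obtain h where h: "h \<in> B'" "vert m w k = vert n h j"
      by (auto simp: Q_def)
    then have "vert m w k = vert m (f h) k" "f h \<in> W" "w \<in> W" "h \<in> B"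
      using assms(5) w by (auto simp: B'_def Q_def)
    then show "w \<in> f ` B"
      using inj_onD[OF W(3)] by blast
  qed
  ultimately show "\<exists>Q. openin (N m) Q \<and> z \<in> Q \<and> Q \<subseteq> f ` B"
    by blast
qed

end

section \<open>Compactly supported integer functions\<close>

lemma continuous_map_discrete_iff:
  "continuous_map Y (discrete_topology UNIV) a \<longleftrightarrow> (\<forall>k. openin Y {y \<in> topspace Y. a y = k})"
proof
  assume "continuous_map Y (discrete_topology UNIV) a"
  then show "\<forall>k. openin Y {y \<in> topspace Y. a y = k}"
    using openin_continuous_map_preimage[of Y "discrete_topology UNIV" a "{_}"] by simp
next
  assume a: "\<forall>k. openin Y {y \<in> topspace Y. a y = k}"
  have "openin Y {y \<in> topspace Y. a y \<in> S}" for S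
  proof -
    have "{y \<in> topspace Y. a y \<in> S} = (\<Union>k\<in>S. {y \<in> topspace Y. a y = k})"
      by auto
    then show ?thesis
      using a by auto
  qed
  then show "continuous_map Y (discrete_topology UNIV) a"
    by (simp add: continuous_map_def)
qed

text \<open>Continuous integer functions are locally constant, so the set where they are nonzero is
  already closed.\<close>

lemma cc_int_iff:
  "a \<in> cc_int Y \<longleftrightarrow> (\<forall>k. openin Y {y \<in> topspace Y. a y = k})
     \<and> compactin Y {y \<in> topspace Y. a y \<noteq> 0} \<and> (\<forall>y. y \<notin> topspace Y \<longrightarrow> a y = 0)"
proof -
  have "Y closure_of {y \<in> topspace Y. a y \<noteq> 0} = {y \<in> topspace Y. a y \<noteq> 0}"
    if "openin Y {y \<in> topspace Y. a y = 0}"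
  proof -
    have "{y \<in> topspace Y. a y \<noteq> 0} = topspace Y - {y \<in> topspace Y. a y = 0}"
      by auto
    then have "closedin Y {y \<in> topspace Y. a y \<noteq> 0}"
      using that by (metis closedin_diff closedin_topspace)
    then show ?thesis
      by (simp add: closure_of_closedin)
  qed
  then show ?thesis
    unfolding cc_int_def continuous_map_discrete_iff by auto
qed

lemma cc_int_indicator:
  assumes "Hausdorff_space Y" "openin Y B" "compactin Y B"
  shows "(\<lambda>y. if y \<in> B then c else 0) \<in> cc_int Y"
proof -
  have B: "B \<subseteq> topspace Y" "closedin Y B"
    using assms by (auto simp: openin_subset compactin_imp_closedin)
  have "openin Y {y \<in> topspace Y. (if y \<in> B then c else 0) = k}" for k
  proof -
    have "{y \<in> topspace Y. (if y \<in> B then c else 0) = k}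
        = (if c = k then B else {}) \<union> (if k = 0 then topspace Y - B else {})"
      using B(1) by auto
    then show ?thesis
      using assms(2) B(2) by auto
  qed
  moreover have "{y \<in> topspace Y. (if y \<in> B then c else 0) \<noteq> 0} = (if c = 0 then {} else B)"
    using B(1) by auto
  ultimately show ?thesis
    using assms(3) B(1) by (auto simp: cc_int_iff)
qed

lemma cc_int_restrict:
  assumes a: "a \<in> cc_int Y" and B: "openin Y B" "closedin Y B"
  shows "(\<lambda>y. if y \<in> B then a y else 0) \<in> cc_int Y"
proof -
  have "openin Y {y \<in> topspace Y. (if y \<in> B then a y else 0) = k}" for k
  proof -
    have "{y \<in> topspace Y. (if y \<in> B then a y else 0) = k}
        = ({y \<in> topspace Y. a y = k} \<inter> B) \<union> (if k = 0 then topspace Y - B else {})"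
      using openin_subset[OF B(1)] by auto
    moreover have "openin Y ({y \<in> topspace Y. a y = k} \<inter> B)"
      using a B(1) by (simp add: cc_int_iff openin_Int)
    moreover have "openin Y (if k = 0 then topspace Y - B else {})"
      using B(2) by (simp add: openin_diff)
    ultimately show ?thesis
      using openin_Un by metis
  qed
  moreover have "{y \<in> topspace Y. (if y \<in> B then a y else 0) \<noteq> 0} = {y \<in> topspace Y. a y \<noteq> 0} \<inter> B"
    by auto
  then have "compactin Y {y \<in> topspace Y. (if y \<in> B then a y else 0) \<noteq> 0}"
    using a B(2) by (simp add: cc_int_iff compact_Int_closedin)
  ultimately show ?thesis
    using openin_subset[OF B(1)] unfolding cc_int_iff by auto
qed

lemma cc_int_zero: "(\<lambda>_. 0) \<in> cc_int Y"
proof -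
  have "openin Y {y \<in> topspace Y. (0::int) = k}" for k
    by (cases "k = 0") auto
  then show ?thesis
    by (simp add: cc_int_iff)
qed

lemma cc_int_add:
  assumes "a \<in> cc_int Y" "b \<in> cc_int Y"
  shows "(\<lambda>y. a y + b y) \<in> cc_int Y"
proof -
  have o: "openin Y {y \<in> topspace Y. a y + b y = k}" for k
  proof -
    have "{y \<in> topspace Y. a y + b y = k}
        = (\<Union>l. {y \<in> topspace Y. a y = l} \<inter> {y \<in> topspace Y. b y = k - l})"
      by auto
    moreover have "openin Y ({y \<in> topspace Y. a y = l} \<inter> {y \<in> topspace Y. b y = k - l})" for l
      using assms by (simp add: cc_int_iff openin_Int)
    ultimately show ?thesis
      by (metis (no_types, lifting) imageE openin_Union)
  qed
  let ?K = "{y \<in> topspace Y. a y \<noteq> 0} \<union> {y \<in> topspace Y. b y \<noteq> 0}"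
  have K: "compactin Y ?K"
    using assms by (intro compactin_Un) (auto simp: cc_int_iff)
  have "{y \<in> topspace Y. a y + b y \<noteq> 0} = topspace Y - {y \<in> topspace Y. a y + b y = 0}"
    by auto
  then have c: "closedin Y {y \<in> topspace Y. a y + b y \<noteq> 0}"
    using closedin_diff[OF closedin_topspace o[of 0]] by simp
  have "{y \<in> topspace Y. a y + b y \<noteq> 0} \<subseteq> ?K"
    by auto
  then have "compactin Y {y \<in> topspace Y. a y + b y \<noteq> 0}"
    using closed_compactin[OF K _ c] by blast
  then show ?thesis
    using o assms by (auto simp: cc_int_iff)
qed

lemma cc_int_cmult:
  assumes "a \<in> cc_int Y"
  shows "(\<lambda>y. k * a y) \<in> cc_int Y"
proof (cases "k = 0")
  case False
  have "{y \<in> topspace Y. k * a y = l}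
      = (if k dvd l then {y \<in> topspace Y. a y = l div k} else {})" for l
    using False by auto
  then show ?thesis
    using assms False by (simp add: cc_int_iff)
qed (simp add: cc_int_zero)

text \<open>The support is covered by finitely many sets from \<Phi> on which a is constant, and
  these are made disjoint; this replaces \<open>B\<close> by a smaller compact open set, whence the
  case \<open>subset\<close>. The case \<open>basis\<close> is asked only at points where a is
  nonzero, so \<Phi> may encode conditions that hold only near the support.\<close>

lemma cc_int_induct [consumes 2, case_names basis compact_open subset zero add indicator]:
  assumes a: "a \<in> cc_int Y" and "Hausdorff_space Y"
    and basis: "\<And>y U. y \<in> topspace Y \<Longrightarrow> a y \<noteq> 0 \<Longrightarrow> openin Y U \<Longrightarrow> y \<in> U \<Longrightarrow>
        \<exists>B. \<Phi> B \<and> y \<in> B \<and> B \<subseteq> U"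
    and compact_open: "\<And>B. \<Phi> B \<Longrightarrow> openin Y B \<and> compactin Y B"
    and subset: "\<And>B B'. \<Phi> B \<Longrightarrow> openin Y B' \<Longrightarrow> compactin Y B' \<Longrightarrow> B' \<subseteq> B \<Longrightarrow> \<Phi> B'"
    and zero: "Q (\<lambda>_. 0)"
    and add: "\<And>a b. a \<in> cc_int Y \<Longrightarrow> b \<in> cc_int Y \<Longrightarrow> Q a \<Longrightarrow> Q b \<Longrightarrow> Q (\<lambda>y. a y + b y)"
    and indicator: "\<And>B c. \<Phi> B \<Longrightarrow> Q (\<lambda>y. if y \<in> B then c else 0)"
  shows "Q a"
proof -
  let ?S = "{y \<in> topspace Y. a y \<noteq> 0}"
  define \<F> where "\<F> = {B. \<Phi> B \<and> (\<exists>c. \<forall>y\<in>B. a y = c)}"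
  have "?S \<subseteq> \<Union>\<F>"
  proof
    fix y assume y: "y \<in> ?S"
    have "openin Y {z \<in> topspace Y. a z = a y}"
      using a by (simp add: cc_int_iff)
    then obtain B where "\<Phi> B" "y \<in> B" "B \<subseteq> {z \<in> topspace Y. a z = a y}"
      using basis[of y "{z \<in> topspace Y. a z = a y}"] y by auto
    then show "y \<in> \<Union>\<F>"
      by (auto simp: \<F>_def)
  qed
  moreover have "\<forall>B\<in>\<F>. openin Y B"
    using compact_open by (auto simp: \<F>_def)
  moreover have "compactin Y ?S"
    using a by (simp add: cc_int_iff)
  ultimately obtain \<G> where G: "finite \<G>" "\<G> \<subseteq> \<F>" "?S \<subseteq> \<Union>\<G>"
    using compactinD[of Y ?S \<F>] by blast
  have "openin Y (\<Union>\<G>) \<and> compactin Y (\<Union>\<G>) \<and> Q (\<lambda>y. if y \<in> \<Union>\<G> then a y else 0)"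
    using G(1,2)
  proof (induction \<G>)
    case empty
    then show ?case
      using zero by simp
  next
    case (insert B \<G>)
    then have IH: "openin Y (\<Union>\<G>)" "compactin Y (\<Union>\<G>)" "Q (\<lambda>y. if y \<in> \<Union>\<G> then a y else 0)"
      by auto
    obtain c where B: "\<Phi> B" "\<And>y. y \<in> B \<Longrightarrow> a y = c"
      using insert.prems by (auto simp: \<F>_def)
    note co = compact_open[OF B(1)]
    have cl: "closedin Y (\<Union>\<G>)"
      using IH(2) assms(2) compactin_imp_closedin by blast
    have D: "openin Y (B - \<Union>\<G>)"
      using co cl by (simp add: openin_diff)
    have "closedin Y (B - \<Union>\<G>)"
      using co compactin_imp_closedin[OF assms(2)] IH(1) by (simp add: closedin_diff)
    then have D': "compactin Y (B - \<Union>\<G>)"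
      using co by (meson Diff_subset closed_compactin)
    have 2: "Q (\<lambda>y. if y \<in> B - \<Union>\<G> then c else 0)"
      by (rule indicator, rule subset[OF B(1) D D']) auto
    have 1: "(\<lambda>y. if y \<in> \<Union>\<G> then a y else 0) \<in> cc_int Y"
      by (rule cc_int_restrict[OF a IH(1) cl])
    have "Q (\<lambda>y. (if y \<in> \<Union>\<G> then a y else 0) + (if y \<in> B - \<Union>\<G> then c else 0))"
      by (rule add[OF 1 cc_int_indicator[OF assms(2) D D'] IH(3) 2])
    moreover have "(\<lambda>y. (if y \<in> \<Union>\<G> then a y else 0) + (if y \<in> B - \<Union>\<G> then c else 0))
        = (\<lambda>y. if y \<in> \<Union>(insert B \<G>) then a y else 0)"
      using B(2) by auto
    ultimately show ?case
      using co IH by (auto intro: compactin_Un)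
  qed
  moreover have "(\<lambda>y. if y \<in> \<Union>\<G> then a y else 0) = a"
    using G(3) a by (fastforce simp: cc_int_iff)
  ultimately show ?thesis
    by simp
qed

section \<open>Chains as functions on lists of units\<close>

context principal_ample
begin

definition vertices :: "nat \<Rightarrow> (nat \<Rightarrow> 'a) \<Rightarrow> 'a list" where
  "vertices n g = map (vert n g) [0..<Suc n]"

definition orbit_tuples :: "nat \<Rightarrow> 'a list set" where
  "orbit_tuples n = {xs. length xs = Suc n \<and> (\<forall>j\<le>n. rel (xs ! 0) (xs ! j))}"

text \<open>Extension by 0 to all lists lets \<open>ext\<close> and the algebra of lists act on
  chains; \<open>unhat\<close> returns to the nerve and is 0 off it, as \<open>cc_int\<close>
  demands.\<close>

definition hat :: "nat \<Rightarrow> ((nat \<Rightarrow> 'a) \<Rightarrow> int) \<Rightarrow> 'a list \<Rightarrow> int" where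
  "hat n a xs = (if xs \<in> orbit_tuples n then a (tup n ((!) xs)) else 0)"

definition unhat :: "nat \<Rightarrow> ('a list \<Rightarrow> int) \<Rightarrow> (nat \<Rightarrow> 'a) \<Rightarrow> int" where
  "unhat n A g = (if g \<in> topspace (N n) then A (vertices n g) else 0)"

lemma length_vertices [simp]: "length (vertices n g) = Suc n"
  by (simp add: vertices_def)

lemma nth_vertices [simp]: "j \<le> n \<Longrightarrow> vertices n g ! j = vert n g j"
  unfolding vertices_def by (subst nth_map) (auto simp del: upt_Suc)

lemma set_vertices: "set (vertices n g) = vert n g ` {..n}"
  by (simp add: vertices_def atMost_atLeast0 atLeastLessThanSuc_atLeastAtMost del: upt_Suc)

lemma vertices_in_orbit_tuples: "g \<in> topspace (N n) \<Longrightarrow> vertices n g \<in> orbit_tuples n"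
  by (auto simp: orbit_tuples_def rel_vert)

lemma tup_cong: "(\<And>j. j \<le> n \<Longrightarrow> x j = y j) \<Longrightarrow> tup n x = tup n y"
  by (auto simp: tup_def fun_eq_iff)

lemma tup_vertices: "g \<in> topspace (N n) \<Longrightarrow> tup n ((!) (vertices n g)) = g"
  using tup_vert tup_cong[of n "(!) (vertices n g)" "vert n g"] by simp

lemma tup_orbit_tuples: "xs \<in> orbit_tuples n \<Longrightarrow> tup n ((!) xs) \<in> topspace (N n)"
  by (rule tup_in_nerve) (auto simp: orbit_tuples_def)

lemma vertices_tup: "xs \<in> orbit_tuples n \<Longrightarrow> vertices n (tup n ((!) xs)) = xs"
  by (rule nth_equalityI) (auto simp: orbit_tuples_def less_Suc_eq_le tup_in_nerve(2))

lemma vertices_inj: "g \<in> topspace (N n) \<Longrightarrow> h \<in> topspace (N n) \<Longrightarrow> vertices n g = vertices n h \<Longrightarrow> g = h"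
  using tup_vertices by metis

lemma hat_vertices [simp]: "g \<in> topspace (N n) \<Longrightarrow> hat n a (vertices n g) = a g"
  by (simp add: hat_def vertices_in_orbit_tuples tup_vertices)

lemma hat_nonzero: "hat n a xs \<noteq> 0 \<Longrightarrow> \<exists>g\<in>topspace (N n). xs = vertices n g \<and> a g \<noteq> 0"
  unfolding hat_def using tup_orbit_tuples vertices_tup by metis

lemma hat_unhat:
  assumes "\<And>xs. A xs \<noteq> 0 \<Longrightarrow> xs \<in> orbit_tuples n"
  shows "hat n (unhat n A) = A"
  unfolding hat_def unhat_def using assms by (auto simp: fun_eq_iff tup_orbit_tuples vertices_tup)

lemma hat_add: "hat n (\<lambda>g. a g + b g) = (\<lambda>xs. hat n a xs + hat n b xs)"
  by (auto simp: hat_def)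

lemma hat_cmult: "hat n (\<lambda>g. k * a g) = (\<lambda>xs. k * hat n a xs)"
  by (auto simp: hat_def)

lemma hat_zero: "hat n (\<lambda>g. 0) = (\<lambda>xs. 0)"
  by (auto simp: hat_def)

text \<open>It suffices to treat indicators of sets on which all vertex maps are injective: there x
  occurs at position j in at most one tuple.\<close>

lemma locally_finite_hat:
  assumes "a \<in> cc_int (N n)"
  shows "locally_finite (hat n a)"
  using assms Hausdorff_nerve
proof (induction a rule: cc_int_induct[where \<Phi> = "\<lambda>B. openin (N n) B \<and> compactin (N n) B
    \<and> (\<forall>j\<le>n. inj_on (\<lambda>g. vert n g j) B)"])
  case (basis y U)
  then show ?case
    using bisection_basis_nerve by metis
next
  case (subset B B')
  then show ?case
    using inj_on_subset by blast
next
  case zero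
  then show ?case
    by (simp add: hat_zero locally_finite_def)
next
  case (add a b)
  have "{y. hat n a y + hat n b y \<noteq> 0 \<and> x \<in> set y}
      \<subseteq> {y. hat n a y \<noteq> 0 \<and> x \<in> set y} \<union> {y. hat n b y \<noteq> 0 \<and> x \<in> set y}" for x
    by auto
  then show ?case
    using add.IH unfolding hat_add locally_finite_def by (meson finite_Un finite_subset)
next
  case (indicator B c)
  show ?case
    unfolding locally_finite_def
  proof
    fix x
    have B: "B \<subseteq> topspace (N n)"
      using indicator openin_subset by blast
    have sub: "{y. hat n (\<lambda>g. if g \<in> B then c else 0) y \<noteq> 0 \<and> x \<in> set y}
        \<subseteq> (\<Union>j\<le>n. vertices n ` {g \<in> B. vert n g j = x})"
    proof clarify
      fix y assume y: "hat n (\<lambda>g. if g \<in> B then c else 0) y \<noteq> 0" "x \<in> set y"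
      then obtain g where "y = vertices n g" "g \<in> B"
        using hat_nonzero[OF y(1)] by (auto split: if_splits)
      with y(2) show "y \<in> (\<Union>j\<le>n. vertices n ` {g \<in> B. vert n g j = x})"
        by (auto simp: set_vertices)
    qed
    have "finite {g \<in> B. vert n g j = x}" if "j \<le> n" for j
    proof -
      have "finite ((\<lambda>g. vert n g j) ` {g \<in> B. vert n g j = x})"
        by (rule finite_subset[of _ "{x}"]) auto
      moreover have "inj_on (\<lambda>g. vert n g j) {g \<in> B. vert n g j = x}"
        using indicator that by (auto intro: inj_on_subset)
      ultimately show ?thesis
        by (rule finite_imageD)
    qed
    then show "finite {y. hat n (\<lambda>g. if g \<in> B then c else 0) y \<noteq> 0 \<and> x \<in> set y}"
      by (intro finite_subset[OF sub] finite_UN_I finite_imageI) auto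
  qed
qed auto

section \<open>Operators on chains\<close>

text \<open>Two clauses carry the topology. Moved vertices are continuously related to the original
  ones over \<open>B\<close>, which makes the induced maps of nerves continuous; some token of each
  word leaves a vertex in place, which makes them open, and injective on small sets.\<close>

definition words_on :: "('a \<Rightarrow> 'a) \<Rightarrow> nat \<Rightarrow> nat \<Rightarrow> ('a list \<Rightarrow> ('a list \<Rightarrow>\<^sub>0 int)) \<Rightarrow> (nat \<Rightarrow> 'a) set
    \<Rightarrow> (int \<times> (bool \<times> nat) list) list \<Rightarrow> bool" where
  "words_on \<sigma> n m S B L \<longleftrightarrow> (\<forall>h\<in>B. S (vertices n h) = word_chain \<sigma> L (vertices n h))
     \<and> (\<forall>(e, ts)\<in>set L. length ts = Suc m \<and> (\<exists>k\<le>m. \<not> fst (ts ! k))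
          \<and> (\<forall>t\<in>set ts. snd t \<le> n \<and> (fst t \<longrightarrow>
               crel (subtopology (N n) B) (\<lambda>h. vert n h (snd t)) (\<lambda>h. \<sigma> (vert n h (snd t))))))"

lemma words_on_subset: "words_on \<sigma> n m S B L \<Longrightarrow> B' \<subseteq> B \<Longrightarrow> words_on \<sigma> n m S B' L"
proof -
  assume w: "words_on \<sigma> n m S B L" and "B' \<subseteq> B"
  then have "subtopology (N n) B' = subtopology (subtopology (N n) B) B'"
    by (simp add: subtopology_subtopology Int_absorb1)
  then show ?thesis
    using w \<open>B' \<subseteq> B\<close> unfolding words_on_def by (fastforce intro: crel_subtopology)
qed

definition word_map :: "('a \<Rightarrow> 'a) \<Rightarrow> nat \<Rightarrow> nat \<Rightarrow> (bool \<times> nat) list \<Rightarrow> (nat \<Rightarrow> 'a) \<Rightarrow> nat \<Rightarrow> 'a" where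
  "word_map \<sigma> n m ts h = tup m (\<lambda>k. tok \<sigma> (vertices n h) (ts ! k))"

text \<open>Continuity comes from \<open>continuous_tup\<close>. As vertex k of the image is vertex
  j of the argument, \<open>open_image_nerve\<close> gives openness, and injectivity of the vertex
  map passes to the word map.\<close>

lemma word_map:
  assumes w: "words_on \<sigma> n m S B L" "(e, ts) \<in> set L" and B: "openin (N n) B"
  shows "\<And>h. h \<in> B \<Longrightarrow> word_map \<sigma> n m ts h \<in> topspace (N m)"
    and "\<And>h. h \<in> B \<Longrightarrow> vertices m (word_map \<sigma> n m ts h) = map (tok \<sigma> (vertices n h)) ts"
    and "(\<And>j. j \<le> n \<Longrightarrow> inj_on (\<lambda>g. vert n g j) B) \<Longrightarrow> inj_on (word_map \<sigma> n m ts) B"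
    and "openin (N m) (word_map \<sigma> n m ts ` B)"
    and "compactin (N n) B \<Longrightarrow> compactin (N m) (word_map \<sigma> n m ts ` B)"
proof -
  let ?Y = "subtopology (N n) B"
  let ?F = "word_map \<sigma> n m ts"
  have tB: "topspace ?Y = B"
    using openin_subset[OF B] by auto
  have ts: "length ts = Suc m" "\<And>t. t \<in> set ts \<Longrightarrow> snd t \<le> n"
    "\<And>t. t \<in> set ts \<Longrightarrow> fst t \<Longrightarrow>
       crel ?Y (\<lambda>h. vert n h (snd t)) (\<lambda>h. \<sigma> (vert n h (snd t)))"
    using w unfolding words_on_def by auto
  obtain k where k: "k \<le> m" "\<not> fst (ts ! k)"
    using w unfolding words_on_def by auto
  have c: "crel ?Y (\<lambda>h. vert n h 0) (\<lambda>h. tok \<sigma> (vertices n h) (ts ! i))" if "i \<le> m" for i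
  proof -
    have mem: "ts ! i \<in> set ts"
      using that ts(1) by simp
    have 1: "crel ?Y (\<lambda>h. vert n h 0) (\<lambda>h. vert n h (snd (ts ! i)))"
      by (intro crel_subtopology crel_vert ts(2)[OF mem]) simp
    show ?thesis
    proof (cases "fst (ts ! i)")
      case True
      then show ?thesis
        using crel_trans[OF 1 ts(3)[OF mem True]] ts(2)[OF mem] by (simp add: tok_def)
    next
      case False
      then show ?thesis
        using 1 ts(2)[OF mem] by (simp add: tok_def)
    qed
  qed
  have c': "crel ?Y (\<lambda>h. tok \<sigma> (vertices n h) (ts ! 0)) (\<lambda>h. tok \<sigma> (vertices n h) (ts ! i))" if "i \<le> m" for i
    using crel_trans[OF crel_sym[OF c[of 0]] c[OF that]] by simp
  have r: "rel (tok \<sigma> (vertices n h) (ts ! 0)) (tok \<sigma> (vertices n h) (ts ! i))" if "h \<in> B" "i \<le> m" for h i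
    using crel_rel[OF c'] that tB by auto
  show top: "?F h \<in> topspace (N m)" if "h \<in> B" for h
    unfolding word_map_def using r[OF that] by (rule tup_in_nerve)
  have vF: "vert m (?F h) i = tok \<sigma> (vertices n h) (ts ! i)" if "h \<in> B" "i \<le> m" for h i
    unfolding word_map_def using r[OF that(1)] that(2) by (rule tup_in_nerve(2))
  show "vertices m (?F h) = map (tok \<sigma> (vertices n h)) ts" if "h \<in> B" for h
    using vF[OF that] ts(1) by (intro nth_equalityI) (auto simp: less_Suc_eq_le)
  define j where "j = snd (ts ! k)"
  have j: "j \<le> n"
    using ts(1,2) k(1) by (simp add: j_def)
  have vk: "vert m (?F h) k = vert n h j" if "h \<in> B" for h
    using vF[OF that k(1)] k(2) j by (simp add: tok_def j_def)
  show "inj_on ?F B" if "\<And>j. j \<le> n \<Longrightarrow> inj_on (\<lambda>g. vert n g j) B"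
    using that[OF j] vk by (metis (mono_tags, lifting) inj_on_def)
  have cont: "continuous_map ?Y (N m) ?F"
    unfolding word_map_def using c' by (rule continuous_tup)
  show "openin (N m) (?F ` B)"
    by (rule open_image_nerve[OF B cont j k(1) vk])
  show "compactin (N m) (?F ` B)" if "compactin (N n) B"
    using that by (intro image_compactin[OF _ cont]) (simp add: compactin_subtopology)
qed

lemma coef_word_chain:
  "coef (word_chain \<sigma> L xs) z = (\<Sum>(e, ts)\<leftarrow>L. if map (tok \<sigma> xs) ts = z then e else 0)"
  unfolding word_chain_def by (induction L) (auto simp: lookup_add)

text \<open>Over \<open>B\<close> the operator is a combination of pushforwards along the word maps.
  These are injective on \<open>B\<close>, so each sends the indicator of \<open>B\<close> to the
  indicator of the image.\<close>

lemma ext_indicator: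
  assumes w: "words_on \<sigma> n m S B L" and B: "openin (N n) B"
    and inj: "\<And>j. j \<le> n \<Longrightarrow> inj_on (\<lambda>g. vert n g j) B"
  shows "unhat m (ext S (hat n (\<lambda>g. if g \<in> B then c else 0)))
     = (\<lambda>z. \<Sum>(e, ts)\<leftarrow>L. if z \<in> word_map \<sigma> n m ts ` B then c * e else 0)"
proof
  fix z
  let ?F = "word_map \<sigma> n m"
  have BN: "B \<subseteq> topspace (N n)"
    by (rule openin_subset[OF B])
  note wm = word_map[OF w _ B]
  show "unhat m (ext S (hat n (\<lambda>g. if g \<in> B then c else 0))) z
     = (\<Sum>(e, ts)\<leftarrow>L. if z \<in> ?F ts ` B then c * e else 0)"
  proof (cases "z \<in> topspace (N m)")
    case False
    have "(\<Sum>(e, ts)\<leftarrow>L'. if z \<in> ?F ts ` B then c * e else 0) = 0" if "set L' \<subseteq> set L" for L'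
      using that False wm(1) by (induction L') fastforce+
    then show ?thesis
      using False by (simp add: unhat_def)
  next
    case True
    \<comment> \<open>The tuples of \<open>B\<close> that some word sends to z: at most one for each
      word, hence finitely many.\<close>
    define H where "H = {h \<in> B. \<exists>(e, ts)\<in>set L. ?F ts h = z}"
    have inj': "inj_on (?F ts) B" if "(e, ts) \<in> set L" for e ts
      using wm(3)[OF that] inj by auto
    have fin: "finite {h \<in> B. ?F ts h = z}" if "(e, ts) \<in> set L" for e ts
    proof (rule finite_imageD)
      show "finite (?F ts ` {h \<in> B. ?F ts h = z})"
        by (rule finite_subset[of _ "{z}"]) auto
      show "inj_on (?F ts) {h \<in> B. ?F ts h = z}"
        using inj'[OF that] by (rule inj_on_subset) auto
    qed
    have sub: "H \<subseteq> (\<Union>(e, ts)\<in>set L. {h \<in> B. ?F ts h = z})"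
      by (auto simp: H_def)
    have finH: "finite H"
      using fin by (intro finite_subset[OF sub] finite_UN_I) auto
    have injv: "inj_on (vertices n) H"
      using vertices_inj BN by (auto simp: inj_on_def H_def)
    have iff: "map (tok \<sigma> (vertices n h)) ts = vertices m z \<longleftrightarrow> ?F ts h = z" if "h \<in> B" "(e, ts) \<in> set L" for h e ts
      using wm(2)[OF that(2,1)] vertices_inj[OF wm(1)[OF that(2,1)] True] by auto
    have coef: "coef (S (vertices n h)) (vertices m z) = (\<Sum>(e, ts)\<leftarrow>L. if ?F ts h = z then e else 0)" if "h \<in> B" for h
    proof -
      have "S (vertices n h) = word_chain \<sigma> L (vertices n h)"
        using w that by (simp add: words_on_def)
      then have "coef (S (vertices n h)) (vertices m z) = (\<Sum>(e, ts)\<leftarrow>L. if map (tok \<sigma> (vertices n h)) ts = vertices m z then e else 0)"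
        by (simp add: coef_word_chain)
      also have "\<dots> = (\<Sum>(e, ts)\<leftarrow>L. if ?F ts h = z then e else 0)"
        using iff[OF that] by (intro arg_cong[of _ _ sum_list] map_cong) auto
      finally show ?thesis .
    qed
    have "ext S (hat n (\<lambda>g. if g \<in> B then c else 0)) (vertices m z)
        = (\<Sum>y\<in>vertices n ` H. hat n (\<lambda>g. if g \<in> B then c else 0) y * coef (S y) (vertices m z))"
    proof (rule ext_eq)
      show "finite (vertices n ` H)"
        using finH by simp
      fix y assume y: "hat n (\<lambda>g. if g \<in> B then c else 0) y \<noteq> 0" "coef (S y) (vertices m z) \<noteq> 0"
      obtain h where h: "y = vertices n h" "h \<in> B"
        using hat_nonzero[OF y(1)] by (auto split: if_splits)
      have "\<exists>(e, ts)\<in>set L. ?F ts h = z"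
      proof (rule ccontr)
        assume no: "\<not> ?thesis"
        have "(\<Sum>(e, ts)\<leftarrow>L'. if ?F ts h = z then e else 0) = 0" if "set L' \<subseteq> set L" for L'
          using that no by (induction L') auto
        then show False
          using y(2) coef[OF h(2)] h(1) by simp
      qed
      then show "y \<in> vertices n ` H"
        using h by (auto simp: H_def)
    qed
    also have "\<dots> = (\<Sum>h\<in>H. c * (\<Sum>(e, ts)\<leftarrow>L. if ?F ts h = z then e else 0))"
      unfolding sum.reindex[OF injv] using BN by (intro sum.cong) (auto simp: H_def coef subset_iff)
    also have "\<dots> = (\<Sum>(e, ts)\<leftarrow>L. if z \<in> ?F ts ` B then c * e else 0)"
    proof -
      have "(\<Sum>h\<in>H. c * (\<Sum>(e, ts)\<leftarrow>L'. if ?F ts h = z then e else 0))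
          = (\<Sum>(e, ts)\<leftarrow>L'. if z \<in> ?F ts ` B then c * e else 0)" if "set L' \<subseteq> set L" for L'
        using that
      proof (induction L')
        case (Cons a L')
        obtain e ts where a: "a = (e, ts)"
          by (cases a)
        then have mem: "(e, ts) \<in> set L"
          using Cons.prems by auto
        have "(\<Sum>h\<in>H. c * (if ?F ts h = z then e else 0)) = (if z \<in> ?F ts ` B then c * e else 0)"
        proof (cases "z \<in> ?F ts ` B")
          case True
          then obtain h where h: "h \<in> B" "z = ?F ts h"
            by auto
          have "h \<in> H"
            using h mem by (auto simp: H_def)
          have "(\<Sum>x\<in>H. c * (if ?F ts x = z then e else 0)) = (\<Sum>x\<in>H. if x = h then c * e else 0)"
            using inj_onD[OF inj'[OF mem]] h by (intro sum.cong) (auto simp: H_def)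
          then show ?thesis
            using True finH \<open>h \<in> H\<close> by simp
        next
          case False
          then have "?F ts h \<noteq> z" if "h \<in> H" for h
            using that unfolding H_def by blast
          then show ?thesis
            using False by simp
        qed
        then show ?case
          using Cons by (simp add: a distrib_left sum.distrib)
      qed simp
      then show ?thesis
        by simp
    qed
    finally show ?thesis
      using True by (simp add: unhat_def)
  qed
qed

text \<open>By the induction principle only indicators of small sets inside a domain of constant
  words have to be considered, and there the result is a finite combination of indicators of compact
  open images. The words need to exist only around points of the support.\<close>

lemma unhat_ext_cc_int:
  assumes a: "a \<in> cc_int (N n)" and S: "local_op S"
    and words: "\<And>g. g \<in> topspace (N n) \<Longrightarrow> a g \<noteq> 0 \<Longrightarrow>
      \<exists>U L. openin (N n) U \<and> g \<in> U \<and> words_on \<sigma> n m S U L"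
  shows "unhat m (ext S (hat n a)) \<in> cc_int (N m)"
  using a Hausdorff_nerve
proof (induction a rule: cc_int_induct[where \<Phi> = "\<lambda>B. openin (N n) B \<and> compactin (N n) B
    \<and> (\<forall>j\<le>n. inj_on (\<lambda>g. vert n g j) B) \<and> (\<exists>L. words_on \<sigma> n m S B L)"])
  case (basis y V)
  obtain U L where U: "openin (N n) U" "y \<in> U" "words_on \<sigma> n m S U L"
    using words basis by blast
  obtain B where B: "openin (N n) B" "compactin (N n) B" "y \<in> B" "B \<subseteq> U \<inter> V"
    "\<And>j. j \<le> n \<Longrightarrow> inj_on (\<lambda>g. vert n g j) B"
    using bisection_basis_nerve[of n "U \<inter> V" y] U(1,2) basis(3,4) by (metis IntI openin_Int)
  have "words_on \<sigma> n m S B L"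
    using words_on_subset[OF U(3)] B(4) by simp
  then show ?case
    using B by (intro exI[of _ B]) auto
next
  case (subset B B')
  then obtain L where "words_on \<sigma> n m S B L"
    by blast
  then have "words_on \<sigma> n m S B' L"
    using words_on_subset subset by blast
  then show ?case
    using subset inj_on_subset by blast
next
  case zero
  have "unhat m (ext S (hat n (\<lambda>_. 0))) = (\<lambda>_. 0)"
    by (auto simp: hat_zero unhat_def ext_def)
  then show ?case
    using cc_int_zero by simp
next
  case (add a b)
  have "unhat m (ext S (hat n (\<lambda>y. a y + b y))) =
      (\<lambda>z. unhat m (ext S (hat n a)) z + unhat m (ext S (hat n b)) z)"
  proof
    fix z
    have "vertices m z \<noteq> []"
      by (simp add: vertices_def)
    then show "unhat m (ext S (hat n (\<lambda>y. a y + b y))) z =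
        unhat m (ext S (hat n a)) z + unhat m (ext S (hat n b)) z"
      using add.hyps S by (simp add: unhat_def hat_add ext_add locally_finite_hat)
  qed
  then show ?case
    using add.IH cc_int_add by simp
next
  case (indicator B c)
  then obtain L where L: "words_on \<sigma> n m S B L" and B: "openin (N n) B" "compactin (N n) B"
    "\<And>j. j \<le> n \<Longrightarrow> inj_on (\<lambda>g. vert n g j) B"
    by blast
  have "(\<lambda>z. \<Sum>(e, ts)\<leftarrow>L'. if z \<in> word_map \<sigma> n m ts ` B then c * e else 0) \<in> cc_int (N m)"
    if "set L' \<subseteq> set L" for L'
    using that
  proof (induction L')
    case (Cons x L')
    obtain e ts where x: "x = (e, ts)"
      by (cases x)
    have "(\<lambda>z. if z \<in> word_map \<sigma> n m ts ` B then c * e else 0) \<in> cc_int (N m)"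
      using Cons.prems word_map(4,5)[OF L _ B(1)] B(2) Hausdorff_nerve
      by (intro cc_int_indicator) (auto simp: x)
    then show ?case
      using Cons by (simp add: x cc_int_add)
  qed (simp add: cc_int_zero)
  from this[of L] show ?case
    by (subst ext_indicator[OF L B(1)]) (auto dest: B(3))
qed auto

section \<open>The boundary operator\<close>

lemma arr_nerve:
  assumes "y \<in> topspace (N n)" "1 \<le> j" "j \<le> n"
  shows "arr (vert n y (j - 1)) (vert n y j) = y j"
  using assms by (intro arr_eq) (auto simp: nerve_arrow rng_nerve src_nerve)

lemma face_eq_tup:
  assumes "y \<in> topspace (N n)" "1 \<le> n" "i \<le> n"
  shows "face G n i y = tup (n - 1) (\<lambda>j. vert n y (if j < i then j else Suc j))"
\<comment> \<open>Degree 0 has its own encoding, so faces into it are treated separately. Afterwards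
  only the case \<open>j = i\<close> involves a composition of arrows.\<close>
proof (cases "n = 1")
  case True
  then show ?thesis
    using assms by (auto simp: face_def tup_def vert_def)
next
  case False
  show ?thesis
  proof
    fix j
    consider "j \<notin> {1..n - 1}" | "j \<in> {1..n - 1}" "j < i" | "j \<in> {1..n - 1}" "i < j" | "j \<in> {1..n - 1}" "j = i"
      by linarith
    then show "face G n i y j = tup (n - 1) (\<lambda>j. vert n y (if j < i then j else Suc j)) j"
    proof cases
      case 1
      then show ?thesis
        using False assms by (auto simp: face_def tup_def)
    next
      case 2
      then have "arr (vert n y (j - 1)) (vert n y j) = y j"
        using assms by (intro arr_nerve) auto
      then show ?thesis
        using 2 False assms by (auto simp: face_def tup_def)
    next
      case 3
      then have "arr (vert n y j) (vert n y (Suc j)) = y (Suc j)"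
        using arr_nerve[OF assms(1), of "Suc j"] by auto
      then show ?thesis
        using 3 False assms by (auto simp: face_def tup_def)
    next
      case 4
      have "arr (vert n y (j - 1)) (vert n y j) = y j" "arr (vert n y j) (vert n y (Suc j)) = y (Suc j)"
        using 4 assms arr_nerve[OF assms(1), of j] arr_nerve[OF assms(1), of "Suc j"] by auto
      moreover have "arr (vert n y (j - 1)) (vert n y (Suc j))
          = gcomp G (arr (vert n y (j - 1)) (vert n y j)) (arr (vert n y j) (vert n y (Suc j)))"
        using 4 assms by (intro arr_trans rel_vert) auto
      ultimately show ?thesis
        using 4 False assms by (auto simp: face_def tup_def)
    qed
  qed
qed

lemma face_nerve:
  assumes "y \<in> topspace (N n)" "1 \<le> n" "i \<le> n"
  shows "face G n i y \<in> topspace (N (n - 1))" "vertices (n - 1) (face G n i y) = del i (vertices n y)"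
proof -
  let ?x = "\<lambda>j. vert n y (if j < i then j else Suc j)"
  have r: "rel (?x 0) (?x j)" if "j \<le> n - 1" for j
    using that assms by (intro rel_vert) auto
  show "face G n i y \<in> topspace (N (n - 1))"
    unfolding face_eq_tup[OF assms] using r by (rule tup_in_nerve)
  show "vertices (n - 1) (face G n i y) = del i (vertices n y)"
  proof (rule nth_equalityI)
    show len: "length (vertices (n - 1) (face G n i y)) = length (del i (vertices n y))"
      using assms by (simp add: length_del)
    fix j assume "j < length (vertices (n - 1) (face G n i y))"
    then have j: "j \<le> n - 1"
      by simp
    have "vertices (n - 1) (face G n i y) ! j = ?x j"
      unfolding face_eq_tup[OF assms] using j tup_in_nerve(2)[of "n - 1" ?x, OF r j] by simp
    also have "\<dots> = del i (vertices n y) ! j"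
      using j assms by (auto simp: del_def nth_append min_def)
    finally show "vertices (n - 1) (face G n i y) ! j = del i (vertices n y) ! j" .
  qed
qed

lemma coef_bd: "coef (bd xs) z = (\<Sum>i<length xs. if del i xs = z then (- 1) ^ i else 0)"
  unfolding bd_def by (auto simp: lookup_sum intro!: sum.cong)

text \<open>Turns the pushforwards along the faces into deletions of vertices. For fixed z only the
  tuples in \<open>H\<close> contribute; all contain the first vertex of z, so local finiteness
  makes \<open>H\<close> finite.\<close>

lemma boundary_eq:
  assumes a: "a \<in> cc_int (N n)" and n: "1 \<le> n"
  shows "boundary G n a = unhat (n - 1) (ext bd (hat n a))"
proof
  fix z
  define H where "H = {y \<in> topspace (N n). a y \<noteq> 0 \<and> (\<exists>i\<le>n. face G n i y = z)}"
  show "boundary G n a z = unhat (n - 1) (ext bd (hat n a)) z"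
  proof (cases "z \<in> topspace (N (n - 1))")
    case False
    then have "pushforward (N n) (face G n i) a z = 0" if "i \<le> n" for i
      unfolding pushforward_def using face_nerve(1)[OF _ n that] by (intro sum.neutral) auto
    then show ?thesis
      using False n by (simp add: boundary_def unhat_def)
  next
    case True
    have "vertices n ` H \<subseteq> {xs. hat n a xs \<noteq> 0 \<and> vert (n - 1) z 0 \<in> set xs}"
    proof clarify
      fix y assume "y \<in> H"
      then obtain i where y: "y \<in> topspace (N n)" "a y \<noteq> 0" "i \<le> n" "face G n i y = z"
        by (auto simp: H_def)
      have "vert (n - 1) z 0 \<in> set (vertices (n - 1) z)"
        by (simp add: set_vertices)
      then show "hat n a (vertices n y) \<noteq> 0 \<and> vert (n - 1) z 0 \<in> set (vertices n y)"
        using face_nerve(2)[OF y(1) n y(3)] y set_del[of i "vertices n y"] by auto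
    qed
    then have "finite (vertices n ` H)"
      using locally_finite_hat[OF a] unfolding locally_finite_def by (meson finite_subset)
    moreover have injv: "inj_on (vertices n) H"
      using vertices_inj by (auto simp: inj_on_def H_def)
    ultimately have finH: "finite H"
      by (rule finite_imageD)
    have iff: "del i (vertices n y) = vertices (n - 1) z \<longleftrightarrow> face G n i y = z" if "y \<in> topspace (N n)" "i \<le> n" for i y
      using face_nerve[OF that(1) n that(2)] vertices_inj[OF _ True] by metis
    have coef: "coef (bd (vertices n y)) (vertices (n - 1) z) = (\<Sum>i\<le>n. if face G n i y = z then (- 1) ^ i else 0)"
      if "y \<in> topspace (N n)" for y
      unfolding coef_bd using iff[OF that] by (intro sum.cong) auto
    have "unhat (n - 1) (ext bd (hat n a)) z = ext bd (hat n a) (vertices (n - 1) z)"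
      using True by (simp add: unhat_def)
    also have "\<dots> = (\<Sum>xs\<in>vertices n ` H. hat n a xs * coef (bd xs) (vertices (n - 1) z))"
    proof (rule ext_eq)
      show "finite (vertices n ` H)"
        using finH by simp
      fix xs assume xs: "hat n a xs \<noteq> 0" "coef (bd xs) (vertices (n - 1) z) \<noteq> 0"
      obtain y where y: "y \<in> topspace (N n)" "xs = vertices n y" "a y \<noteq> 0"
        using hat_nonzero[OF xs(1)] by blast
      then have "(\<Sum>i\<le>n. if face G n i y = z then (- 1 :: int) ^ i else 0) \<noteq> 0"
        using coef xs(2) by simp
      then obtain i where "i \<le> n" "face G n i y = z"
        by (auto elim!: sum.not_neutral_contains_not_neutral split: if_splits)
      then show "xs \<in> vertices n ` H"
        using y by (auto simp: H_def)
    qed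
    also have "\<dots> = (\<Sum>y\<in>H. a y * (\<Sum>i\<le>n. if face G n i y = z then (- 1) ^ i else 0))"
      unfolding sum.reindex[OF injv] comp_def
      by (rule sum.cong[OF refl]) (subst coef, auto simp: H_def)
    also have "\<dots> = (\<Sum>i\<le>n. \<Sum>y\<in>H. (if face G n i y = z then (- 1) ^ i * a y else 0))"
      by (subst sum.swap) (auto simp: sum_distrib_left intro!: sum.cong)
    also have "\<dots> = (\<Sum>i\<le>n. (- 1) ^ i * pushforward (N n) (face G n i) a z)"
    proof (intro sum.cong refl)
      fix i assume i: "i \<in> {..n}"
      have "pushforward (N n) (face G n i) a z = (\<Sum>y\<in>H. if face G n i y = z then a y else 0)"
        unfolding pushforward_def
        using finH i by (intro sum.mono_neutral_cong_left) (auto simp: H_def)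
      then show "(\<Sum>y\<in>H. (if face G n i y = z then (- 1) ^ i * a y else 0))
          = (- 1) ^ i * pushforward (N n) (face G n i) a z"
        by (auto simp: sum_distrib_left intro!: sum.cong)
    qed
    finally show ?thesis
      using n by (simp add: boundary_def)
  qed
qed

lemma hat_boundary:
  assumes "a \<in> cc_int (N n)" "1 \<le> n"
  shows "hat (n - 1) (boundary G n a) = ext bd (hat n a)"
  unfolding boundary_eq[OF assms]
proof (rule hat_unhat)
  fix xs assume "ext bd (hat n a) xs \<noteq> 0"
  then obtain ys where ys: "hat n a ys \<noteq> 0" "coef (bd ys) xs \<noteq> 0"
    unfolding ext_def by (auto elim: sum.not_neutral_contains_not_neutral)
  obtain y where y: "y \<in> topspace (N n)" "ys = vertices n y"
    using hat_nonzero[OF ys(1)] by blast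
  obtain i where i: "i \<le> n" "xs = del i ys"
    using keys_bd[of xs ys] ys(2) y(2) by (auto simp: in_keys_iff less_Suc_eq_le)
  then show "xs \<in> orbit_tuples (n - 1)"
    using face_nerve[OF y(1) assms(2) i(1)] vertices_in_orbit_tuples y(2) by metis
qed

text \<open>The boundary is given by one list of words on the whole nerve and moves no vertices, so
  the identity serves as \<sigma>. Since \<open>n \<ge> 1\<close>, the words are nonempty and
  contain an unmoved vertex.\<close>

lemma boundary_cc_int:
  assumes "a \<in> cc_int (N n)" "1 \<le> n"
  shows "boundary G n a \<in> cc_int (N (n - 1))"
  unfolding boundary_eq[OF assms]
proof (rule unhat_ext_cc_int[OF assms(1) local_op_bd])
  fix g assume g: "g \<in> topspace (N n)"
  obtain L where L: "\<forall>(e, ts)\<in>set L. length ts = Suc n - 1 \<and> (\<forall>t\<in>set ts. \<not> fst t \<and> snd t < Suc n)"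
    "\<And>xs. length xs = Suc n \<Longrightarrow> bd xs = word_chain (\<lambda>x. x) L (xs :: 'a list)"
    using bd_word[of "Suc n" "\<lambda>x. x"] by blast
  have "words_on (\<lambda>x. x) n (n - 1) bd (topspace (N n)) L"
    unfolding words_on_def
  proof (intro conjI ballI)
    show "bd (vertices n h) = word_chain (\<lambda>x. x) L (vertices n h)" for h
      by (rule L(2)) simp
    fix p assume "p \<in> set L"
    then obtain e ts where p: "p = (e, ts)" "length ts = n" "\<forall>t\<in>set ts. \<not> fst t \<and> snd t \<le> n"
      using L(1) by (cases p) (auto simp: less_Suc_eq_le)
    then have "\<not> fst (ts ! 0)"
      using assms(2) by simp
    then show "case p of (e, ts) \<Rightarrow> length ts = Suc (n - 1) \<and> (\<exists>k\<le>n - 1. \<not> fst (ts ! k))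
        \<and> (\<forall>t\<in>set ts. snd t \<le> n \<and> (fst t \<longrightarrow> crel (subtopology (N n) (topspace (N n)))
          (\<lambda>h. vert n h (snd t)) (\<lambda>h. vert n h (snd t))))"
      using p assms(2) by auto
  qed
  then show "\<exists>U L. openin (N n) U \<and> g \<in> U \<and> words_on (\<lambda>x. x) n (n - 1) bd U L"
    using g by blast
qed

lemma boundary_boundary:
  assumes "a \<in> cc_int (N n)" "2 \<le> n"
  shows "boundary G (n - 1) (boundary G n a) = (\<lambda>_. 0)"
proof
  fix z
  have "boundary G (n - 1) (boundary G n a) = unhat (n - 1 - 1) (ext bd (ext bd (hat n a)))"
    using assms boundary_eq[of "boundary G n a" "n - 1"] boundary_cc_int[of a n] hat_boundary[of a n]
    by simp
  moreover have "ext bd (ext bd (hat n a)) (vertices (n - 1 - 1) z) = 0"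
    by (subst ext_ext) (auto simp: locally_finite_hat assms(1) local_op_bd vertices_def bd_bd ext_def)
  ultimately show "boundary G (n - 1) (boundary G n a) z = 0"
    by (simp add: unhat_def)
qed

lemma boundary_add:
  assumes "a \<in> cc_int (N n)" "b \<in> cc_int (N n)"
  shows "boundary G n (\<lambda>y. a y + b y) = (\<lambda>z. boundary G n a z + boundary G n b z)"
proof (cases "n = 0")
  case False
  then show ?thesis
    using assms locally_finite_hat local_op_bd
    by (auto simp: boundary_eq cc_int_add unhat_def hat_add fun_eq_iff vertices_def intro!: ext_add)
qed (simp add: boundary_def)

lemma boundary_cmult:
  assumes "a \<in> cc_int (N n)"
  shows "boundary G n (\<lambda>y. k * a y) = (\<lambda>z. k * boundary G n a z)"
proof (cases "n = 0")
  case False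
  then show ?thesis
    using assms by (auto simp: boundary_eq cc_int_cmult unhat_def hat_cmult ext_cmult fun_eq_iff)
qed (simp add: boundary_def)

section \<open>Compact open equivalence relations\<close>

lemma compact_cover:
  assumes "compactin T C" "\<And>x. x \<in> C \<Longrightarrow> \<exists>B. \<Phi> B \<and> openin T B \<and> x \<in> B"
  shows "\<exists>\<B>. finite \<B> \<and> C \<subseteq> \<Union>\<B> \<and> (\<forall>B\<in>\<B>. \<Phi> B \<and> openin T B)"
proof -
  have "\<exists>\<B>. finite \<B> \<and> \<B> \<subseteq> {B. \<Phi> B \<and> openin T B} \<and> C \<subseteq> \<Union>\<B>"
    using assms by (intro compactinD[OF assms(1)]) blast+
  then show ?thesis
    by blast
qed

definition compact_open :: "'a set \<Rightarrow> bool" where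
  "compact_open K \<longleftrightarrow> openin T K \<and> compactin T K"

lemma compact_open_closed: "compact_open K \<Longrightarrow> closedin T K"
  using Hausdorff by (simp add: compact_open_def compactin_imp_closedin)

lemma compact_open_Un: "compact_open K \<Longrightarrow> compact_open L \<Longrightarrow> compact_open (K \<union> L)"
  by (simp add: compact_open_def compactin_Un openin_Un)

lemma compact_open_Union:
  "finite \<B> \<Longrightarrow> (\<And>B. B \<in> \<B> \<Longrightarrow> compact_open B) \<Longrightarrow> compact_open (\<Union>\<B>)"
  unfolding compact_open_def by (auto intro: compactin_Union)

lemma compact_open_Int_clopen:
  "compact_open K \<Longrightarrow> openin T L \<Longrightarrow> closedin T L \<Longrightarrow> compact_open (K \<inter> L)"
  by (simp add: compact_open_def compact_Int_closedin openin_Int)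

lemma compact_open_Diff: "compact_open K \<Longrightarrow> compact_open L \<Longrightarrow> compact_open (K - L)"
proof -
  assume K: "compact_open K" "compact_open L"
  then have "openin T (K - L)" "closedin T (K - L)"
    using compact_open_closed by (simp_all add: compact_open_def closedin_diff openin_diff)
  then show ?thesis
    using K(1) unfolding compact_open_def by (meson Diff_subset closed_compactin)
qed

lemma compact_open_subset: "compact_open K \<Longrightarrow> K \<subseteq> arrows G"
  using openin_subset[of T K] by (simp add: compact_open_def)

lemma compact_open_rng: "compact_open K \<Longrightarrow> compact_open (rng G ` K)"
  by (simp add: compact_open_def open_rng image_compactin[OF _ continuous_rng])

lemma compact_open_src: "compact_open K \<Longrightarrow> compact_open (src G ` K)"
  by (simp add: compact_open_def open_src image_compactin[OF _ continuous_src])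

lemma compact_open_bisection_compact_open: "compact_open_bisection B \<Longrightarrow> compact_open B"
  by (simp add: compact_open_def compact_open_bisectionD)

lemma ginv_ginv: "g \<in> arrows G \<Longrightarrow> ginv G (ginv G g) = g"
  by (rule arrow_unique) (auto simp: ginv_closed rng_ginv src_ginv)

lemma compact_open_ginv: "compact_open K \<Longrightarrow> compact_open (ginv G ` K)"
proof -
  assume K: "compact_open K"
  have "ginv G ` K = {g \<in> topspace T. ginv G g \<in> K}"
    using compact_open_subset[OF K] ginv_ginv ginv_closed by (auto simp: image_iff subset_iff) metis
  then have "openin T (ginv G ` K)"
    using openin_continuous_map_preimage[OF continuous_ginv] K by (auto simp: compact_open_def)
  then show ?thesis
    using K by (simp add: compact_open_def image_compactin[OF _ continuous_ginv])
qed

lemma compact_subset_compact_open: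
  assumes "compactin T C"
  obtains K where "compact_open K" "C \<subseteq> K"
proof -
  have "\<exists>B. compact_open_bisection B \<and> openin T B \<and> x \<in> B" if "x \<in> C" for x
    using openin_basis[OF openin_topspace] compactin_subset_topspace[OF assms] that compact_open_bisectionD(1)
    by (metis subsetD)
  then obtain \<B> where "finite \<B>" "C \<subseteq> \<Union>\<B>" "\<forall>B\<in>\<B>. compact_open_bisection B \<and> openin T B"
    using compact_cover[OF assms, of compact_open_bisection] by blast
  then show ?thesis
    using that[of "\<Union>\<B>"] compact_open_Union compact_open_bisection_compact_open by blast
qed

definition prodset :: "'a set \<Rightarrow> 'a set \<Rightarrow> 'a set" where
  "prodset A B = (\<lambda>(g, h). gcomp G g h) ` (A \<times> B \<inter> composable_pairs G)"

text \<open>For compactness, composability is a closed condition. For openness, g0 is placed in a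
  bisection inside \<open>A\<close>; each k near the product then factors through the arrow of that
  bisection with the range of k, and the second factor varies continuously, so it stays in
  \<open>B\<close>.\<close>

lemma compact_open_prodset:
  assumes A: "compact_open A" and B: "compact_open B"
  shows "compact_open (prodset A B)"
  unfolding compact_open_def
proof
  let ?P = "prod_topology T T"
  have "compactin ?P (A \<times> B)"
    using A B by (simp add: compactin_Times compact_open_def)
  moreover have "closedin ?P {p \<in> topspace ?P. (src G \<circ> fst) p = (rng G \<circ> snd) p}"
    by (intro closedin_continuous_maps_eq[OF Hausdorff]
        continuous_map_compose[OF continuous_map_fst continuous_src]
        continuous_map_compose[OF continuous_map_snd continuous_rng])
  ultimately have "compactin ?P (A \<times> B \<inter> {p \<in> topspace ?P. (src G \<circ> fst) p = (rng G \<circ> snd) p})"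
    by (rule compact_Int_closedin)
  moreover have "A \<times> B \<inter> {p \<in> topspace ?P. (src G \<circ> fst) p = (rng G \<circ> snd) p} = A \<times> B \<inter> composable_pairs G"
    by (auto simp: composable_pairs_def)
  ultimately have "compactin (subtopology ?P (composable_pairs G)) (A \<times> B \<inter> composable_pairs G)"
    by (simp add: compactin_subtopology)
  then show "compactin T (prodset A B)"
    unfolding prodset_def using continuous_comp by (rule image_compactin)
  show "openin T (prodset A B)"
  proof (subst openin_subopen, intro ballI)
    fix k0 assume "k0 \<in> prodset A B"
    then obtain g0 h0 where gh: "g0 \<in> A" "h0 \<in> B" "(g0, h0) \<in> composable_pairs G" "k0 = gcomp G g0 h0"
      by (auto simp: prodset_def)
    obtain C where C: "compact_open_bisection C" "g0 \<in> C" "C \<subseteq> A"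
      using openin_basis[of A g0] A gh(1) by (auto simp: compact_open_def)
    obtain W u where W: "openin T W" "rng G g0 \<in> W" "W \<subseteq> units G" "u (rng G g0) = src G g0"
      "crel (subtopology T W) (\<lambda>x. x) u" "\<And>x. x \<in> W \<Longrightarrow> arr x (u x) \<in> C"
      by (rule local_section[OF C(1,2)]) blast
    define P where "P = {k \<in> topspace T. rng G k \<in> W}"
    have P: "openin T P"
      unfolding P_def by (rule openin_continuous_map_preimage[OF continuous_rng W(1)])
    have tP: "topspace (subtopology T P) = P"
      by (auto simp: P_def)
    have "continuous_map (subtopology T P) (subtopology T W) (rng G)"
      using continuous_rng by (auto simp: continuous_map_in_subtopology continuous_map_from_subtopology P_def)
    then have 1: "crel (subtopology T P) (\<lambda>k. rng G k) (\<lambda>k. u (rng G k))"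
      using crel_compose[OF W(5)] by blast
    have "continuous_map (subtopology T P) T (\<lambda>k. k)"
      by (simp add: continuous_map_from_subtopology)
    then have "crel (subtopology T P) (\<lambda>k. rng G k) (\<lambda>k. src G k)"
      by (rule crel_rng_src)
    then have 2: "crel (subtopology T P) (\<lambda>k. u (rng G k)) (\<lambda>k. src G k)"
      using crel_trans[OF crel_sym[OF 1]] by blast
    define Q where "Q = {k \<in> topspace (subtopology T P). arr (u (rng G k)) (src G k) \<in> B}"
    have "openin (subtopology T P) Q"
      unfolding Q_def using 2 B
      by (intro openin_continuous_map_preimage[of _ T]) (auto simp: crel_def compact_open_def)
    then have "openin T Q"
      using P openin_open_subtopology by blast
    moreover have "k0 \<in> Q"
    proof -
      have "arr (src G g0) (src G h0) = h0"
        using gh(3) by (intro arr_eq) (auto simp: composable_pairs_def)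
      then show ?thesis
        unfolding Q_def tP using gh W(2,4) by (simp add: P_def comp_closed rng_comp src_comp)
    qed
    moreover have "Q \<subseteq> prodset A B"
    proof
      fix k assume k: "k \<in> Q"
      let ?g = "arr (rng G k) (u (rng G k))" and ?h = "arr (u (rng G k)) (src G k)"
      have kP: "k \<in> P" "k \<in> arrows G"
        using k unfolding Q_def tP by (auto simp: P_def)
      have r: "rel (rng G k) (u (rng G k))" "rel (u (rng G k)) (src G k)"
        using crel_rel[OF 1] crel_rel[OF 2] kP(1) tP by auto
      have "k = gcomp G ?g ?h"
        using arr_trans[OF r] arr_eq[OF kP(2) refl refl] by simp
      moreover have "?g \<in> A"
        using W(6) C(3) kP(1) by (auto simp: P_def)
      moreover have "?h \<in> B"
        using k by (simp add: Q_def)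
      ultimately show "k \<in> prodset A B"
        unfolding prodset_def using composable_arr[OF r] by (intro image_eqI[of _ _ "(?g, ?h)"]) auto
    qed
    ultimately show "\<exists>Q. openin T Q \<and> k0 \<in> Q \<and> Q \<subseteq> prodset A B"
      by blast
  qed
qed

text \<open>Compactness and openness of a relation on units refer to the topology of the arrows,
  which is finer than that of pairs; hence relations are turned into sets of arrows.\<close>

definition arrows_of :: "('a \<times> 'a) set \<Rightarrow> 'a set" where
  "arrows_of E = {g \<in> arrows G. (rng G g, src G g) \<in> E}"

lemma arrows_of_relcomp:
  assumes "\<And>x y. (x, y) \<in> E \<Longrightarrow> rel x y" "\<And>x y. (x, y) \<in> F \<Longrightarrow> rel x y"
  shows "arrows_of (E O F) = prodset (arrows_of E) (arrows_of F)"
proof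
  show "prodset (arrows_of E) (arrows_of F) \<subseteq> arrows_of (E O F)"
    by (auto simp: prodset_def arrows_of_def composable_pairs_def comp_closed rng_comp src_comp)
  show "arrows_of (E O F) \<subseteq> prodset (arrows_of E) (arrows_of F)"
  proof
    fix g assume "g \<in> arrows_of (E O F)"
    then obtain y where g: "g \<in> arrows G" "(rng G g, y) \<in> E" "(y, src G g) \<in> F"
      by (auto simp: arrows_of_def)
    note r = assms(1)[OF g(2)] assms(2)[OF g(3)]
    have "g = gcomp G (arr (rng G g) y) (arr y (src G g))"
      using arr_trans[OF r] arr_eq[OF g(1) refl refl] by simp
    then show "g \<in> prodset (arrows_of E) (arrows_of F)"
      unfolding prodset_def using composable_arr[OF r] g rel_arr[OF r(1)] rel_arr[OF r(2)]
      by (intro image_eqI[of _ _ "(arr (rng G g) y, arr y (src G g))"]) (auto simp: arrows_of_def)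
  qed
qed

text \<open>A path from x never leaves the class of x, so the number of steps can be bounded in
  terms of that finite class.\<close>

lemma relpow_within:
  "(x, y) \<in> S ^^ k \<Longrightarrow> (x, y) \<in> (S \<inter> (S\<^sup>* `` {x}) \<times> (S\<^sup>* `` {x})) ^^ k"
proof (induction k arbitrary: y)
  case (Suc k)
  then obtain z where z: "(x, z) \<in> S ^^ k" "(z, y) \<in> S"
    by auto
  then have "(x, z) \<in> S\<^sup>*"
    by (simp add: relpow_imp_rtrancl)
  moreover from this have "(x, y) \<in> S\<^sup>*"
    using z(2) by simp
  ultimately show ?case
    using Suc.IH[OF z(1)] z(2) by auto
qed simp

text \<open>Since the classes have bounded size, the generated equivalence relation is reached after
  boundedly many steps.\<close>

lemma compact_open_rtrancl:
  assumes S: "compact_open (arrows_of S)" "\<And>x y. (x, y) \<in> S \<Longrightarrow> rel x y"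
    and bd: "\<And>x. x \<in> Domain S \<Longrightarrow> finite (S\<^sup>* `` {x}) \<and> card (S\<^sup>* `` {x}) \<le> M"
  shows "compact_open (arrows_of (S\<^sup>+))"
proof -
  have r: "rel x y" if "(x, y) \<in> S ^^ Suc k" for x y k
    using that S(2) rel_trans by (induction k arbitrary: y) (auto, blast)
  have co: "compact_open (arrows_of (S ^^ Suc k))" for k
  proof (induction k)
    case (Suc k)
    have "arrows_of (S ^^ Suc (Suc k)) = prodset (arrows_of (S ^^ Suc k)) (arrows_of S)"
      using arrows_of_relcomp[of "S ^^ Suc k" S] r S(2) by simp
    then show ?case
      using compact_open_prodset[OF Suc S(1)] by simp
  qed (simp add: S(1))
  have "S\<^sup>+ = (\<Union>n\<in>{..<M * M}. S ^^ Suc n)"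
  proof
    show "(\<Union>n\<in>{..<M * M}. S ^^ Suc n) \<subseteq> S\<^sup>+"
      using trancl_power zero_less_Suc by (blast intro: trancl_power[THEN iffD2])
    show "S\<^sup>+ \<subseteq> (\<Union>n\<in>{..<M * M}. S ^^ Suc n)"
    proof clarify
      fix x y assume xy: "(x, y) \<in> S\<^sup>+"
      let ?C = "S\<^sup>* `` {x}"
      \<comment> \<open>A class has at most \<open>M\<close> elements, so at most
        \<open>M * M\<close> pairs of the relation lie inside it, and by
        \<open>relpow_finite_bounded1\<close> that many steps suffice.\<close>
      let ?S = "S \<inter> ?C \<times> ?C"
      have x: "x \<in> Domain S"
        using xy by (metis Domain.DomainI tranclD)
      note b = bd[OF x]
      have fin: "finite ?S"
        using b by auto
      have "card ?S \<le> card (?C \<times> ?C)"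
        using b by (intro card_mono) auto
      also have "\<dots> \<le> M * M"
        using b by (simp add: card_cartesian_product mult_le_mono)
      finally have card: "card ?S \<le> M * M" .
      obtain k where "k > 0" "(x, y) \<in> S ^^ k"
        using xy by (auto simp: trancl_power)
      then obtain n where n: "0 < n" "n \<le> card ?S" "(x, y) \<in> ?S ^^ n"
        using relpow_finite_bounded1[OF fin, of k] relpow_within[of x y k S] by blast
      moreover have "?S ^^ n \<subseteq> S ^^ n"
        by (induction n) auto
      ultimately show "(x, y) \<in> (\<Union>n\<in>{..<M * M}. S ^^ Suc n)"
        using card by (intro UN_I[of "n - 1"]) (auto simp del: relpow.simps)
    qed
  qed
  then have "arrows_of (S\<^sup>+) = \<Union>((\<lambda>n. arrows_of (S ^^ Suc n)) ` {..<M * M})"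
    by (auto simp: arrows_of_def)
  then show ?thesis
    using co by (auto intro!: compact_open_Union simp del: relpow.simps)
qed

text \<open>\<open>X\<close> is covered by finitely many compact open sets, each meeting every class
  at most once. The selector picks from a class its element in the first of these sets that meets
  the class.\<close>

lemma continuous_selector:
  assumes X: "compact_open X" "X \<subseteq> units G"
    and E: "equiv X E" "\<And>x y. (x, y) \<in> E \<Longrightarrow> rel x y" "compact_open (arrows_of E)"
  obtains \<sigma> where "\<And>x. x \<in> X \<Longrightarrow> (x, \<sigma> x) \<in> E" "\<And>x y. (x, y) \<in> E \<Longrightarrow> \<sigma> x = \<sigma> y"
    "crel (subtopology T X) (\<lambda>x. x) \<sigma>"
proof -
  let ?R = "arrows_of E"
  have Erefl: "(x, x) \<in> E" if "x \<in> X" for x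
    using E(1) that by (simp add: equiv_def refl_on_def)
  have Esym: "(y, x) \<in> E" if "(x, y) \<in> E" for x y
    using E(1) that by (meson equiv_def symD)
  have Etrans: "(x, z) \<in> E" if "(x, y) \<in> E" "(y, z) \<in> E" for x y z
    using E(1) that by (meson equiv_def transD)
  have EX: "x \<in> X" "y \<in> X" if "(x, y) \<in> E" for x y
    using E(1) that by (auto simp: equiv_def)
  define indep where "indep B \<longleftrightarrow> compact_open B \<and> (\<forall>x\<in>B. \<forall>y\<in>B. (x, y) \<in> E \<longrightarrow> x = y)" for B
  have "\<exists>B. indep B \<and> openin T B \<and> x \<in> B" if x: "x \<in> X" for x
  proof -
    let ?P = "prod_topology T T"
    let ?p = "\<lambda>g. (rng G g, src G g)"
    \<comment> \<open>The units are open, so the other arrows of the relation form a compact set.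
      Its image among pairs is closed and, by principality, misses the diagonal; hence x has a
      neighbourhood without related pairs of distinct points.\<close>
    have "compactin T (?R - units G)"
      using E(3) openin_units unfolding compact_open_def
      by (metis Diff_subset Hausdorff closed_compactin closedin_diff compactin_imp_closedin)
    then have "compactin ?P (?p ` (?R - units G))"
      by (rule image_compactin) (simp add: continuous_map_pairedI continuous_rng continuous_src)
    then have "closedin ?P (?p ` (?R - units G))"
      using Hausdorff by (simp add: compactin_imp_closedin Hausdorff_space_prod_topology)
    then have op: "openin ?P (topspace ?P - ?p ` (?R - units G))"
      by blast
    have xx: "(x, x) \<in> topspace ?P - ?p ` (?R - units G)"
    proof -
      have "rng G g \<noteq> src G g" if "g \<in> ?R - units G" for g
        using principal that by (auto simp: principal_groupoid_def arrows_of_def)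
      then show ?thesis
        using x X units_subset by fastforce
    qed
    obtain U V where UV: "openin T U" "openin T V" "x \<in> U" "x \<in> V"
      "U \<times> V \<subseteq> topspace ?P - ?p ` (?R - units G)"
      using op[unfolded openin_prod_topology_alt, rule_format, OF xx] by (elim exE conjE)
    then have "openin T (U \<inter> V \<inter> X)" "x \<in> U \<inter> V \<inter> X"
      using X(1) x by (auto simp: compact_open_def)
    then obtain B where B: "compact_open_bisection B" "x \<in> B" "B \<subseteq> U \<inter> V \<inter> X"
      by (rule openin_basis)
    have "y = z" if "y \<in> B" "z \<in> B" "(y, z) \<in> E" for y z
    proof (rule ccontr)
      assume "y \<noteq> z"
      note r = rel_arr[OF E(2)[OF that(3)]]
      have "arr y z \<in> ?R"
        using r that(3) by (simp add: arrows_of_def)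
      moreover have "arr y z \<notin> units G"
        using r \<open>y \<noteq> z\<close> rng_unit src_unit by metis
      ultimately have "(y, z) \<in> ?p ` (?R - units G)"
        using r by (intro image_eqI[of _ _ "arr y z"]) auto
      then show False
        using UV(5) B(3) that(1,2) by blast
    qed
    then show ?thesis
      using B(1,2) compact_open_bisection_compact_open compact_open_bisectionD(1) unfolding indep_def by blast
  qed
  then obtain \<B> where \<B>: "finite \<B>" "X \<subseteq> \<Union>\<B>" "\<forall>B\<in>\<B>. indep B \<and> openin T B"
    using compact_cover[of X indep] X(1) unfolding compact_open_def by blast
  obtain Bs where Bs: "set Bs = \<B>"
    using finite_list[OF \<B>(1)] by blast
  \<comment> \<open>\<open>D j\<close> is the union of the classes meeting the set number j. It is
    the image of the compact open set \<open>R j\<close> under the range map, hence compact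
    open.\<close>
  define D where "D j = {x. j < length Bs \<and> (\<exists>y\<in>Bs ! j. (x, y) \<in> E)}" for j
  define R where "R j = ?R \<inter> {g \<in> topspace T. src G g \<in> Bs ! j}" for j
  have ind: "indep (Bs ! j)" if "j < length Bs" for j
    using that \<B>(3) Bs nth_mem by blast
  have R: "compact_open (R j)" if "j < length Bs" for j
    unfolding R_def
  proof (intro compact_open_Int_clopen[OF E(3)])
    have "compact_open (Bs ! j)"
      using ind[OF that] by (simp add: indep_def)
    then show "openin T {g \<in> topspace T. src G g \<in> Bs ! j}" "closedin T {g \<in> topspace T. src G g \<in> Bs ! j}"
      using openin_continuous_map_preimage[OF continuous_src]
        closedin_continuous_map_preimage[OF continuous_src] compact_open_closed
      unfolding compact_open_def by blast+
  qed
  have D_eq: "D j = rng G ` R j" if "j < length Bs" for j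
  proof
    show "rng G ` R j \<subseteq> D j"
      using that by (auto simp: D_def R_def arrows_of_def)
    show "D j \<subseteq> rng G ` R j"
    proof
      fix x assume "x \<in> D j"
      then obtain y where y: "y \<in> Bs ! j" "(x, y) \<in> E"
        by (auto simp: D_def)
      note r = rel_arr[OF E(2)[OF y(2)]]
      show "x \<in> rng G ` R j"
        using r y by (intro image_eqI[of _ _ "arr x y"]) (auto simp: R_def arrows_of_def)
    qed
  qed
  have D: "compact_open (D j)" for j
  proof (cases "j < length Bs")
    case True
    then show ?thesis
      using D_eq R compact_open_rng by simp
  qed (simp add: D_def compact_open_def)
  have ex: "\<exists>j. x \<in> D j" if x: "x \<in> X" for x
  proof -
    obtain j where "j < length Bs" "x \<in> Bs ! j"
      using \<B>(2) Bs x by (metis UnionE in_set_conv_nth subsetD)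
    then show ?thesis
      using Erefl[OF x] by (auto simp: D_def)
  qed
  define J where "J x = (LEAST j. x \<in> D j)" for x
  have J: "x \<in> D (J x)" if "x \<in> X" for x
    unfolding J_def using ex[OF that] by (rule LeastI_ex)
  have D_inv: "x \<in> D j \<longleftrightarrow> y \<in> D j" if "(x, y) \<in> E" for x y j
    unfolding D_def using that Esym Etrans by blast
  define \<sigma> where "\<sigma> x = (THE y. y \<in> Bs ! J x \<and> (x, y) \<in> E)" for x
  have uniq: "\<exists>!y. y \<in> Bs ! J x \<and> (x, y) \<in> E" if "x \<in> X" for x
  proof -
    have "J x < length Bs" "\<exists>y\<in>Bs ! J x. (x, y) \<in> E"
      using J[OF that] by (auto simp: D_def)
    then show ?thesis
      using ind[of "J x"] Esym Etrans unfolding indep_def by metis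
  qed
  have \<sigma>: "\<sigma> x \<in> Bs ! J x" "(x, \<sigma> x) \<in> E" if "x \<in> X" for x
    using theI'[OF uniq[OF that]] by (simp_all add: \<sigma>_def)
  have \<sigma>_inv: "\<sigma> x = \<sigma> y" if "(x, y) \<in> E" for x y
  proof -
    have "J x = J y"
      using D_inv[OF that] by (simp add: J_def)
    then have "\<sigma> y \<in> Bs ! J x \<and> (x, \<sigma> y) \<in> E"
      using \<sigma>[OF EX(2)[OF that]] that Etrans by auto
    then show ?thesis
      using uniq[OF EX(1)[OF that]] \<sigma>[OF EX(1)[OF that]] by blast
  qed
  have "continuous_map (subtopology T X) T (\<lambda>x. arr x (\<sigma> x))"
    unfolding continuous_map_def
  proof (intro conjI allI impI)
    have tX: "topspace (subtopology T X) = X"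
      using compact_open_subset[OF X(1)] by auto
    show "(\<lambda>x. arr x (\<sigma> x)) \<in> topspace (subtopology T X) \<rightarrow> topspace T"
      unfolding tX using \<sigma>(2) E(2) rel_arr(1) by auto
    fix O' assume O': "openin T O'"
    define W where "W j = D j - \<Union>(D ` {..<j})" for j
    have W: "openin T (W j)" for j
      unfolding W_def using D compact_open_Diff[OF D compact_open_Union[of "D ` {..<j}"]]
      by (auto simp: compact_open_def)
    have WX: "x \<in> W j \<longleftrightarrow> J x = j" if "x \<in> X" for x j
    proof
      show "J x = j" if "x \<in> W j"
        unfolding J_def using that by (intro Least_equality) (auto simp: W_def not_less[symmetric])
      show "x \<in> W j" if "J x = j"
        using J[OF \<open>x \<in> X\<close>] that not_less_Least by (auto simp: W_def J_def)
    qed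
    \<comment> \<open>Where the first set met is number j, \<open>arr x (\<sigma> x)\<close> is the
      only arrow in \<open>R j\<close> with range x, so preimages are images under the open range
      map, cut down to \<open>W j\<close>.\<close>
    have "{x \<in> topspace (subtopology T X). arr x (\<sigma> x) \<in> O'}
        = X \<inter> (\<Union>j<length Bs. W j \<inter> rng G ` (R j \<inter> O'))"
    proof (intro equalityI subsetI)
      fix x assume x: "x \<in> {x \<in> topspace (subtopology T X). arr x (\<sigma> x) \<in> O'}"
      then have xX: "x \<in> X"
        using tX by auto
      note r = rel_arr[OF E(2)[OF \<sigma>(2)[OF xX]]]
      have "arr x (\<sigma> x) \<in> R (J x)"
        using \<sigma>[OF xX] r by (simp add: R_def arrows_of_def)
      moreover have "J x < length Bs" "x \<in> W (J x)"
        using J[OF xX] WX[OF xX] by (auto simp: D_def)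
      ultimately show "x \<in> X \<inter> (\<Union>j<length Bs. W j \<inter> rng G ` (R j \<inter> O'))"
        using x xX r(2) by (auto simp: image_iff intro!: bexI[of _ "J x"] bexI[of _ "arr x (\<sigma> x)"])
    next
      fix x assume x: "x \<in> X \<inter> (\<Union>j<length Bs. W j \<inter> rng G ` (R j \<inter> O'))"
      then obtain j g where g: "x \<in> X" "x \<in> W j" "g \<in> R j" "g \<in> O'" "x = rng G g"
        by auto
      have "J x = j"
        using WX g by blast
      then have "src G g \<in> Bs ! J x \<and> (x, src G g) \<in> E"
        using g by (auto simp: R_def arrows_of_def)
      then have "\<sigma> x = src G g"
        using uniq[OF g(1)] \<sigma>[OF g(1)] by blast
      then have "arr x (\<sigma> x) = g"
        using g by (intro arr_eq) (auto simp: R_def)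
      then show "x \<in> {x \<in> topspace (subtopology T X). arr x (\<sigma> x) \<in> O'}"
        using g tX by simp
    qed
    moreover have "openin T (\<Union>j<length Bs. W j \<inter> rng G ` (R j \<inter> O'))"
    proof -
      have "openin T (W j \<inter> rng G ` (R j \<inter> O'))" if "j < length Bs" for j
        using W R[OF that] O' by (intro openin_Int open_rng) (auto simp: compact_open_def)
      then show ?thesis
        by (intro openin_Union) blast
    qed
    ultimately show "openin (subtopology T X) {x \<in> topspace (subtopology T X). arr x (\<sigma> x) \<in> O'}"
      by (simp only: openin_subtopology_Int2)
  qed
  then have "crel (subtopology T X) (\<lambda>x. x) \<sigma>"
    using \<sigma>(2) E(2) by (auto simp: crel_def)
  then show ?thesis
    using that \<sigma>(2) \<sigma>_inv by blast
qed

section \<open>From dynamic asymptotic dimension to a selector\<close>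

lemma finite_fibre_bound:
  assumes "relatively_compactin T H"
  shows "\<exists>M. \<forall>x. finite {y. \<exists>g\<in>H. rng G g = x \<and> src G g = y}
    \<and> card {y. \<exists>g\<in>H. rng G g = x \<and> src G g = y} \<le> M"
proof -
  have "compactin T (T closure_of H)" "H \<subseteq> T closure_of H"
    using assms closure_of_subset[of H T] by (simp_all add: relatively_compactin_def)
  moreover have "\<exists>B. compact_open_bisection B \<and> openin T B \<and> x \<in> B" if "x \<in> T closure_of H" for x
    using openin_basis[OF openin_topspace] that closure_of_subset_topspace[of T H] compact_open_bisectionD(1)
    by (metis subsetD)
  ultimately obtain \<B> where \<B>: "finite \<B>" "H \<subseteq> \<Union>\<B>" "\<forall>B\<in>\<B>. compact_open_bisection B \<and> openin T B"
    using compact_cover[of "T closure_of H" compact_open_bisection] by blast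
  \<comment> \<open>The bound is the number of bisections in the cover: each contains at most one
    arrow with range x.\<close>
  have "finite {y. \<exists>g\<in>H. rng G g = x \<and> src G g = y}
    \<and> card {y. \<exists>g\<in>H. rng G g = x \<and> src G g = y} \<le> card \<B>" for x
  proof -
    define p where "p B = src G (THE g. g \<in> B \<and> rng G g = x)" for B
    have "{y. \<exists>g\<in>H. rng G g = x \<and> src G g = y} \<subseteq> p ` \<B>"
    proof clarify
      fix g assume g: "g \<in> H" "x = rng G g"
      then obtain B where B: "B \<in> \<B>" "g \<in> B"
        using \<B>(2) by blast
      have "(THE g. g \<in> B \<and> rng G g = x) = g"
        using B g \<B>(3) compact_open_bisectionD(4) by (intro the_equality) (auto dest: inj_onD)
      then show "src G g \<in> p ` \<B>"
        using B(1) by (auto simp: p_def)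
    qed
    then show ?thesis
      using \<B>(1) by (meson card_image_le card_mono finite_imageI finite_subset le_trans)
  qed
  then show ?thesis
    by blast
qed

text \<open>The sets \<open>U i\<close> may overlap and need not be closed. A finite cover of
  \<open>X\<close> by compact open sets inside them repairs both: \<open>V i\<close> is compact
  open, and taking the least i makes the colour classes disjoint.\<close>

lemma colouring:
  assumes X: "compact_open X" and U: "\<And>i. i \<le> d \<Longrightarrow> openin T (U i)" "X \<subseteq> (\<Union>i\<le>d. U i)"
  obtains col :: "'a \<Rightarrow> nat" where "\<And>x. x \<in> X \<Longrightarrow> col x \<le> d \<and> x \<in> U (col x)"
    "\<And>k. compact_open {x \<in> X. col x = k}"
proof -
  define \<Phi> where "\<Phi> B \<longleftrightarrow> compact_open B \<and> (\<exists>i\<le>d. B \<subseteq> U i)" for B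
  have "\<exists>B. \<Phi> B \<and> openin T B \<and> x \<in> B" if x: "x \<in> X" for x
  proof -
    obtain i where i: "i \<le> d" "x \<in> U i"
      using U(2) x by auto
    then obtain B where "compact_open_bisection B" "x \<in> B" "B \<subseteq> U i"
      using openin_basis U(1) by metis
    then show ?thesis
      using i compact_open_bisection_compact_open compact_open_bisectionD(1) unfolding \<Phi>_def by blast
  qed
  then obtain \<B> where \<B>: "finite \<B>" "X \<subseteq> \<Union>\<B>" "\<forall>B\<in>\<B>. \<Phi> B \<and> openin T B"
    using compact_cover[of X \<Phi>] X unfolding compact_open_def by blast
  define c where "c B = (SOME i. i \<le> d \<and> B \<subseteq> U i)" for B
  have c: "c B \<le> d \<and> B \<subseteq> U (c B)" if "B \<in> \<B>" for B
  proof -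
    have "\<exists>i. i \<le> d \<and> B \<subseteq> U i"
      using \<B>(3) that by (auto simp: \<Phi>_def)
    from someI_ex[OF this] show ?thesis
      by (simp add: c_def)
  qed
  define V where "V i = \<Union>{B \<in> \<B>. c B = i}" for i
  have V: "compact_open (V i)" for i
    unfolding V_def using \<B> by (intro compact_open_Union) (auto simp: \<Phi>_def)
  have ex: "\<exists>i. x \<in> V i" if "x \<in> X" for x
    using \<B>(2) that by (auto simp: V_def)
  define col where "col x = (LEAST i. x \<in> V i)" for x
  have col: "x \<in> V (col x)" if "x \<in> X" for x
    unfolding col_def using ex[OF that] by (rule LeastI_ex)
  have "{x \<in> X. col x = k} = X \<inter> (V k - \<Union>(V ` {..<k}))" for k
  proof (intro equalityI subsetI)
    fix x assume "x \<in> {x \<in> X. col x = k}"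
    then show "x \<in> X \<inter> (V k - \<Union>(V ` {..<k}))"
      using col not_less_Least by (auto simp: col_def)
  next
    fix x assume x: "x \<in> X \<inter> (V k - \<Union>(V ` {..<k}))"
    then have "col x = k"
      unfolding col_def by (intro Least_equality) (auto simp: not_less[symmetric])
    then show "x \<in> {x \<in> X. col x = k}"
      using x by simp
  qed
  moreover have "compact_open (V k - \<Union>(V ` {..<k}))" for k
    using V by (intro compact_open_Diff compact_open_Union) auto
  then have "compact_open (X \<inter> (V k - \<Union>(V ` {..<k})))" for k
    using compact_open_Int_clopen[OF X] compact_open_closed by (auto simp: compact_open_def)
  ultimately have "compact_open {x \<in> X. col x = k}" for k
    by simp
  moreover have "col x \<le> d \<and> x \<in> U (col x)" if x: "x \<in> X" for x
  proof -
    obtain B where "B \<in> \<B>" "c B = col x" "x \<in> B"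
      using col[OF x] by (auto simp: V_def)
    then show ?thesis
      using c[of B] by auto
  qed
  ultimately show ?thesis
    using that by blast
qed

text \<open>\<open>S\<close> joins units of equal colour by arrows of the compact open set
  \<open>K\<close>. The subgroupoids bound its classes, so \<open>compact_open_rtrancl\<close> and
  \<open>continuous_selector\<close> apply; the fibres of the selector lie in classes and are
  therefore finite.\<close>

lemma selector_exists:
  assumes dad: "dad_at_most G d" and C: "compactin T C"
  obtains X and \<sigma> :: "'a \<Rightarrow> 'a" and col :: "'a \<Rightarrow> nat" where
    "compact_open X" "X \<subseteq> units G" "rng G ` C \<union> src G ` C \<subseteq> X"
    "\<And>x. x \<in> X \<Longrightarrow> col x \<le> d" "\<And>k. compact_open {x \<in> X. col x = k}"
    "\<And>x. x \<in> X \<Longrightarrow> \<sigma> x \<in> X \<and> col (\<sigma> x) = col x"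
    "crel (subtopology T X) (\<lambda>x. x) \<sigma>"
    "\<And>x. finite {y \<in> X. \<sigma> y = x}"
    "\<And>g. g \<in> C \<Longrightarrow> col (rng G g) = col (src G g) \<Longrightarrow> \<sigma> (rng G g) = \<sigma> (src G g)"
proof -
  obtain K0 where K0: "compact_open K0" "C \<subseteq> K0"
    using compact_subset_compact_open[OF C] .
  define X where "X = rng G ` K0 \<union> src G ` K0"
  \<comment> \<open>Inverses make \<open>S\<close> symmetric. The units of \<open>X\<close> make it
    reflexive on \<open>X\<close> and put all of \<open>X\<close> into the range of
    \<open>K\<close>, so that the sets \<open>U i\<close> cover \<open>X\<close>.\<close>
  define K where "K = (K0 \<union> ginv G ` K0) \<union> X"
  have K0G: "K0 \<subseteq> arrows G"
    by (rule compact_open_subset[OF K0(1)])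
  have X: "compact_open X"
    unfolding X_def by (intro compact_open_Un compact_open_rng compact_open_src K0)
  have K: "compact_open K"
    unfolding K_def by (intro compact_open_Un compact_open_ginv K0 X)
  have Xu: "X \<subseteq> units G"
    using K0G by (auto simp: X_def rng_in_units src_in_units)
  have KG: "K \<subseteq> arrows G"
    by (rule compact_open_subset[OF K])
  have X_unit: "x \<in> arrows G" "rng G x = x" "src G x = x" "x \<in> K" if "x \<in> X" for x
    using that Xu units_subset rng_unit src_unit unfolding K_def by blast+
  have KX: "rng G g \<in> X \<and> src G g \<in> X" and K_inv: "ginv G g \<in> K" if g: "g \<in> K" for g
  proof -
    consider "g \<in> K0" | h where "g = ginv G h" "h \<in> K0" | "g \<in> X"
      using g unfolding K_def by blast
    then have "(rng G g \<in> X \<and> src G g \<in> X) \<and> ginv G g \<in> K"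
    proof cases
      case 1
      then show ?thesis
        by (simp add: K_def X_def)
    next
      case 2
      then have "h \<in> arrows G"
        using K0G by blast
      then show ?thesis
        using 2 by (simp add: K_def X_def rng_ginv src_ginv ginv_ginv)
    next
      case 3
      note u = X_unit[OF 3]
      have "ginv G g = g"
        by (rule arrow_unique) (simp_all add: u rng_ginv src_ginv ginv_closed)
      then show ?thesis
        using 3 u by simp
    qed
    then show "rng G g \<in> X \<and> src G g \<in> X" "ginv G g \<in> K"
      by simp_all
  qed
  have "T closure_of K = K"
    using K compact_open_closed by (simp add: closure_of_closedin)
  then have "openin T K \<and> relatively_compactin T K"
    using K KG by (simp add: relatively_compactin_def compact_open_def)
  from dad[unfolded dad_at_most_def, rule_format, OF this]
  obtain U :: "nat \<Rightarrow> 'a set" where U: "\<forall>i\<le>d. openin (unit_space G) (U i)"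
    "rng G ` K \<union> src G ` K \<subseteq> (\<Union>i\<le>d. U i)"
    "\<forall>i\<le>d. \<exists>H. subgroupoid G H \<and> relatively_compactin T H
        \<and> {g \<in> K. src G g \<in> U i \<and> rng G g \<in> U i} \<subseteq> H"
    by (elim exE conjE)
  then have "\<forall>i. \<exists>H. i \<le> d \<longrightarrow> subgroupoid G H \<and> relatively_compactin T H
        \<and> {g \<in> K. src G g \<in> U i \<and> rng G g \<in> U i} \<subseteq> H"
    by blast
  then obtain H where H: "\<And>i. i \<le> d \<Longrightarrow> subgroupoid G (H i) \<and> relatively_compactin T (H i)
        \<and> {g \<in> K. src G g \<in> U i \<and> rng G g \<in> U i} \<subseteq> H i"
    using choice[of "\<lambda>i H. i \<le> d \<longrightarrow> subgroupoid G H \<and> relatively_compactin T H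
        \<and> {g \<in> K. src G g \<in> U i \<and> rng G g \<in> U i} \<subseteq> H"] by blast
  have XU: "X \<subseteq> (\<Union>i\<le>d. U i)"
  proof
    fix x assume "x \<in> X"
    then have "x \<in> rng G ` K"
      using X_unit by (intro image_eqI[of _ _ x]) simp_all
    then show "x \<in> (\<Union>i\<le>d. U i)"
      using U(2) by blast
  qed
  obtain col where col: "\<And>x. x \<in> X \<Longrightarrow> col x \<le> d \<and> x \<in> U (col x)"
    "\<And>k. compact_open {x \<in> X. col x = k}"
    using colouring[OF X _ XU] U(1) openin_unit_space by blast
  define S where "S = {(rng G g, src G g) | g. g \<in> K \<and> col (rng G g) = col (src G g)}"
  have S_rel: "rel x y" if "(x, y) \<in> S" for x y
    using that KG by (auto simp: S_def rel_def)
  have arr_S: "arrows_of S = {g \<in> K. col (rng G g) = col (src G g)}"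
  proof (intro equalityI subsetI)
    fix g assume "g \<in> arrows_of S"
    then obtain h where h: "g \<in> arrows G" "h \<in> K" "rng G g = rng G h" "src G g = src G h"
      "col (rng G h) = col (src G h)"
      by (auto simp: arrows_of_def S_def)
    then have "g = h"
      using KG arrow_unique by blast
    then show "g \<in> {g \<in> K. col (rng G g) = col (src G g)}"
      using h by simp
  qed (use KG in \<open>auto simp: arrows_of_def S_def\<close>)
  have S_co: "compact_open (arrows_of S)"
  proof -
    let ?X = "\<lambda>k. {x \<in> X. col x = k}"
    let ?L = "\<lambda>k. {g \<in> topspace T. rng G g \<in> ?X k} \<inter> {g \<in> topspace T. src G g \<in> ?X k}"
    have "arrows_of S = \<Union>((\<lambda>k. K \<inter> ?L k) ` {..d})"
      unfolding arr_S using KX col(1) KG by auto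
    moreover have "compact_open (K \<inter> ?L k)" for k
    proof (rule compact_open_Int_clopen[OF K])
      show "openin T (?L k)"
        using col(2)[of k] unfolding compact_open_def
        by (intro openin_Int openin_continuous_map_preimage[OF continuous_rng]
            openin_continuous_map_preimage[OF continuous_src]) auto
      show "closedin T (?L k)"
        using compact_open_closed[OF col(2)[of k]]
        by (intro closedin_Int closedin_continuous_map_preimage[OF continuous_rng]
            closedin_continuous_map_preimage[OF continuous_src])
    qed
    then have "compact_open (\<Union>((\<lambda>k. K \<inter> ?L k) ` {..d}))"
      by (intro compact_open_Union) blast+
    ultimately show ?thesis
      by (simp only:)
  qed
  have S_X: "x \<in> X" "y \<in> X" "col x = col y" if "(x, y) \<in> S" for x y
    using that KX by (auto simp: S_def)
  have S_refl: "(x, x) \<in> S" if "x \<in> X" for x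
  proof -
    show ?thesis
      unfolding S_def using X_unit[OF that] by (intro CollectI exI[of _ x]) simp
  qed
  have S_sym: "(y, x) \<in> S" if xy: "(x, y) \<in> S" for x y
  proof -
    obtain g where g: "g \<in> K" "x = rng G g" "y = src G g" "col x = col y"
      using xy by (auto simp: S_def)
    have "rng G (ginv G g) = y" "src G (ginv G g) = x"
      using g KG rng_ginv src_ginv by auto
    then show ?thesis
      using g K_inv[OF g(1)] unfolding S_def by force
  qed
  \<comment> \<open>The decisive use of the dimension: along a path the colour i is constant, so
    every arrow lies in the subgroupoid \<open>H i\<close>, and so does their product. A class thus
    embeds into a fibre of \<open>H i\<close>.\<close>
  have S_path: "y \<in> X \<and> col y = col x \<and> (\<exists>g\<in>H (col x). rng G g = x \<and> src G g = y)"
    if "(x, y) \<in> S\<^sup>*" "x \<in> X" for x y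
    using that
  proof (induction rule: rtrancl_induct)
    case base
    note u = X_unit[OF base]
    have "x \<in> H (col x)"
      using H[of "col x"] col(1)[OF base] u by auto
    then show ?case
      using base u by (intro conjI refl bexI[of _ x]) simp_all
  next
    case (step y z)
    then obtain g where g: "y \<in> X" "col y = col x" "g \<in> H (col x)" "rng G g = x" "src G g = y"
      by auto
    obtain h where h: "h \<in> K" "y = rng G h" "z = src G h"
      using step(2) by (auto simp: S_def)
    note z = S_X[OF step(2)]
    have d: "col x \<le> d"
      using col(1) step.prems by blast
    have "y \<in> U (col x)" "z \<in> U (col x)"
      using col(1)[OF z(1)] col(1)[OF z(2)] z(3) g(2) by auto
    then have "h \<in> H (col x)"
      using H[OF d] h by auto
    then have "gcomp G g h \<in> H (col x)"
      using H[OF d] g h unfolding subgroupoid_def by auto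
    moreover have "(g, h) \<in> composable_pairs G"
      using H[OF d] g \<open>h \<in> H (col x)\<close> h unfolding composable_pairs_def subgroupoid_def by auto
    then have "rng G (gcomp G g h) = x" "src G (gcomp G g h) = z"
      using g h by (auto simp: rng_comp src_comp)
    ultimately show ?case
      using z g(2) by auto
  qed
  define F where "F i x = {y. \<exists>g\<in>H i. rng G g = x \<and> src G g = y}" for i x
  have "\<exists>M. i \<le> d \<longrightarrow> (\<forall>x. finite (F i x) \<and> card (F i x) \<le> M)" for i
    using finite_fibre_bound[of "H i"] H[of i] unfolding F_def by blast
  then obtain m where m: "\<And>i x. i \<le> d \<Longrightarrow> finite (F i x) \<and> card (F i x) \<le> m i"
    using choice[of "\<lambda>i M. i \<le> d \<longrightarrow> (\<forall>x. finite (F i x) \<and> card (F i x) \<le> M)"] by blast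
  \<comment> \<open>One bound for all colours; the sum dominates each \<open>m i\<close>.\<close>
  define M where "M = (\<Sum>i\<le>d. m i)"
  have "m i \<le> M" if "i \<le> d" for i
    unfolding M_def using that by (intro member_le_sum) auto
  then have M: "finite (F i x) \<and> card (F i x) \<le> M" if "i \<le> d" for i x
    using m[OF that, of x] that le_trans by blast
  have class_bound: "finite (S\<^sup>* `` {x}) \<and> card (S\<^sup>* `` {x}) \<le> M" if "x \<in> X" for x
  proof -
    have "S\<^sup>* `` {x} \<subseteq> F (col x) x"
      unfolding F_def using S_path that by blast
    then show ?thesis
      using M[of "col x" x] col(1)[OF that] by (meson card_mono finite_subset le_trans)
  qed
  \<comment> \<open>Since \<open>S\<close> is reflexive on \<open>X\<close>, this is already the
    generated equivalence relation there; the reflexive closure would add pairs outside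
    \<open>X\<close>.\<close>
  define E where "E = S\<^sup>+"
  have E_co: "compact_open (arrows_of E)"
    unfolding E_def
  proof (rule compact_open_rtrancl[OF S_co S_rel])
    show "finite (S\<^sup>* `` {x}) \<and> card (S\<^sup>* `` {x}) \<le> M" if "x \<in> Domain S" for x
      using that S_X(1) class_bound by blast
  qed
  have E_path: "x \<in> X \<and> y \<in> X \<and> col y = col x \<and> rel x y" if "(x, y) \<in> E" for x y
    using that unfolding E_def
  proof (induction rule: trancl_induct)
    case (base y)
    then show ?case
      using S_X[OF base] S_rel by auto
  next
    case (step y z)
    then show ?case
      using S_X[OF step(2)] S_rel[OF step(2)] rel_trans by metis
  qed
  have E_equiv: "equiv X E"
  proof (rule equivI)
    show "E \<subseteq> X \<times> X"
      using E_path by auto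
    show "refl_on X E"
      using S_refl by (auto simp: refl_on_def E_def)
    show "sym E"
      unfolding E_def using S_sym by (intro sym_trancl) (simp add: sym_def)
    show "trans E"
      by (simp add: E_def)
  qed
  obtain \<sigma> where \<sigma>: "\<And>x. x \<in> X \<Longrightarrow> (x, \<sigma> x) \<in> E" "\<And>x y. (x, y) \<in> E \<Longrightarrow> \<sigma> x = \<sigma> y"
    "crel (subtopology T X) (\<lambda>x. x) \<sigma>"
    using continuous_selector[OF X Xu E_equiv _ E_co] E_path by blast
  show ?thesis
  proof (rule that[OF X Xu _ _ col(2) _ \<sigma>(3)])
    show "rng G ` C \<union> src G ` C \<subseteq> X"
      using K0(2) by (auto simp: X_def)
    show "col x \<le> d" if "x \<in> X" for x
      using col(1)[OF that] by simp
    show "\<sigma> x \<in> X \<and> col (\<sigma> x) = col x" if "x \<in> X" for x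
      using E_path[OF \<sigma>(1)[OF that]] by simp
    show "finite {y \<in> X. \<sigma> y = x}" for x
    proof (cases "x \<in> X")
      case True
      have "y \<in> S\<^sup>* `` {x}" if "y \<in> X" "\<sigma> y = x" for y
      proof -
        have "(x, y) \<in> E"
          using \<sigma>(1)[OF that(1)] that(2) E_equiv by (auto simp: equiv_def dest: symD)
        then show ?thesis
          by (simp add: E_def trancl_into_rtrancl)
      qed
      then have "{y \<in> X. \<sigma> y = x} \<subseteq> S\<^sup>* `` {x}"
        by blast
      then show ?thesis
        using class_bound[OF True] finite_subset by blast
    next
      case False
      then have "{y \<in> X. \<sigma> y = x} = {}"
        using E_path \<sigma>(1) by blast
      then show ?thesis
        by (simp only: finite.emptyI)
    qed
    show "\<sigma> (rng G g) = \<sigma> (src G g)" if "g \<in> C" "col (rng G g) = col (src G g)" for g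
    proof (rule \<sigma>(2))
      have "g \<in> K"
        using that(1) K0(2) by (auto simp: K_def)
      then show "(rng G g, src G g) \<in> E"
        using that(2) unfolding E_def S_def by blast
    qed
  qed
qed

end

section \<open>Contraction above the dynamic asymptotic dimension\<close>

context principal_ample
begin

lemma compactin_support_arrows:
  assumes "a \<in> cc_int (N n)"
  shows "compactin T (\<Union>i\<le>n. \<Union>j\<le>n. (\<lambda>g. arr (vert n g i) (vert n g j)) ` {g \<in> topspace (N n). a g \<noteq> 0})"
proof -
  have "compactin T ((\<lambda>g. arr (vert n g i) (vert n g j)) ` {g \<in> topspace (N n). a g \<noteq> 0})"
    if "i \<le> n" "j \<le> n" for i j
    using assms crel_vert[OF that] by (intro image_compactin[of "N n"]) (auto simp: cc_int_iff crel_def)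
  then show ?thesis
    by (auto intro!: compactin_Union)
qed

text \<open>\<open>H\<close> is the prism operator from degree n - 1 to n and \<open>B\<close> the
  prism of b. \<open>H\<close> is defined on all functions, but continuity and compact support are
  obtained only for chains whose vertices the selector controls; so the selector is chosen for b and
  c together, and the torsion argument can use \<open>H c\<close>.\<close>

lemma contraction:
  assumes dad: "dad_at_most G d" and b: "b \<in> cc_int (N n)" and n: "d < n" and c: "c \<in> cc_int (N (n - 1))"
  obtains B H where "B \<in> cc_int (N (Suc n))" "H c \<in> cc_int (N n)"
    "\<And>k a. H (\<lambda>g. k * a g) = (\<lambda>g. k * H a g)"
    "b = (\<lambda>g. boundary G (Suc n) B g + H (boundary G n b) g)"
proof -
  define C where "C m a = (\<Union>i\<le>m. \<Union>j\<le>m. (\<lambda>g. arr (vert m g i) (vert m g j)) ` {g \<in> topspace (N m). a g \<noteq> 0})"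
    for m and a :: "(nat \<Rightarrow> 'a) \<Rightarrow> int"
  have cC: "compactin T (C n b \<union> C (n - 1) c)"
    unfolding C_def using b c compactin_support_arrows by (intro compactin_Un) auto
  obtain X \<sigma> and col :: "'a \<Rightarrow> nat" where X: "compact_open X" "X \<subseteq> units G"
    "rng G ` (C n b \<union> C (n - 1) c) \<union> src G ` (C n b \<union> C (n - 1) c) \<subseteq> X"
    and col: "\<And>x. x \<in> X \<Longrightarrow> col x \<le> d" "\<And>k. compact_open {x \<in> X. col x = k}"
    and \<sigma>: "\<And>x. x \<in> X \<Longrightarrow> \<sigma> x \<in> X \<and> col (\<sigma> x) = col x"
      "crel (subtopology T X) (\<lambda>x. x) \<sigma>" "\<And>x. finite {y \<in> X. \<sigma> y = x}"
      "\<And>g. g \<in> C n b \<union> C (n - 1) c \<Longrightarrow> col (rng G g) = col (src G g) \<Longrightarrow> \<sigma> (rng G g) = \<sigma> (src G g)"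
    by (rule selector_exists[OF dad cC]) blast
  \<comment> \<open>Outside \<open>X\<close> the identity and the new colour \<open>Suc d\<close>
    give a total selector with finite fibres; the vertices of tuples in the supports of b and c all
    lie in \<open>X\<close>.\<close>
  define \<sigma>' where "\<sigma>' x = (if x \<in> X then \<sigma> x else x)" for x
  define col' where "col' x = (if x \<in> X then col x else Suc d)" for x
  interpret selector col' \<sigma>'
    by unfold_locales (auto simp: col'_def \<sigma>'_def \<sigma>(1))
  have loc: "local_op prism"
  proof (rule local_op_prism)
    fix x
    have "\<sigma>' -` {x} \<subseteq> insert x {y \<in> X. \<sigma> y = x}"
      by (auto simp: \<sigma>'_def split: if_splits)
    then show "finite (\<sigma>' -` {x})"
      using \<sigma>(3) by (meson finite_insert finite_subset)
  qed
  have inX: "vert m g j \<in> X" if "g \<in> topspace (N m)" "a g \<noteq> 0" "j \<le> m"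
    "C m a \<subseteq> C n b \<union> C (n - 1) c" for m a g j
  proof -
    have "arr (vert m g j) (vert m g j) \<in> C m a"
      unfolding C_def using that by blast
    then have "rng G (arr (vert m g j) (vert m g j)) \<in> X"
      using X(3) that(4) by blast
    then show ?thesis
      using rel_arr(2)[OF rel_vert[OF that(1,3,3)]] by simp
  qed
  have rel_\<sigma>: "rel x (\<sigma>' x)" if "x \<in> units G" for x
  proof (cases "x \<in> X")
    case True
    then show ?thesis
      using crel_rel[OF \<sigma>(2), of x] compact_open_subset[OF X(1)] by (auto simp: \<sigma>'_def)
  qed (simp add: \<sigma>'_def rel_refl that)
  define H where "H a = unhat n (ext prism (hat (n - 1) a))" for a
  have prism_cc: "unhat (Suc m) (ext prism (hat m a)) \<in> cc_int (N (Suc m))"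
    if a: "a \<in> cc_int (N m)" and C: "C m a \<subseteq> C n b \<union> C (n - 1) c" for m a
  proof (rule unhat_ext_cc_int[OF a loc])
    fix g assume g: "g \<in> topspace (N m)" "a g \<noteq> 0"
    \<comment> \<open>On \<open>U\<close> every vertex has the colour of the corresponding vertex of
      g, so one list of words gives \<open>prism\<close> there; \<open>U\<close> is open because the
      colour classes are.\<close>
    define U where "U = (\<Inter>j\<le>m. {h \<in> topspace (N m). vert m h j \<in> {x \<in> X. col x = col (vert m g j)}})"
    have U: "openin (N m) U"
      unfolding U_def using col(2) continuous_vert
      by (intro openin_INT2 openin_continuous_map_preimage[of _ T]) (auto simp: compact_open_def)
    have gU: "g \<in> U"
      unfolding U_def using g inX[OF g _ C] by auto
    obtain L where L: "\<forall>(e, ts)\<in>set L. length ts = Suc (length (map col' (vertices m g))) \<and> hd ts = (False, 0)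
        \<and> (\<forall>t\<in>set ts. snd t < length (map col' (vertices m g)))"
      "\<And>xs. map col' xs = map col' (vertices m g) \<Longrightarrow> prism xs = word_chain \<sigma>' L xs"
      using prism_word[of "map col' (vertices m g)"] by blast
    have tU: "topspace (subtopology (N m) U) = U"
      using openin_subset[OF U] by auto
    have "words_on \<sigma>' m (Suc m) prism U L"
      unfolding words_on_def
    proof (intro conjI ballI)
      fix h assume h: "h \<in> U"
      have "col' (vert m h j) = col' (vert m g j)" if "j \<le> m" for j
        using h gU that by (auto simp: U_def col'_def)
      then have "map col' (vertices m h) = map col' (vertices m g)"
        by (simp add: vertices_def)
      then show "prism (vertices m h) = word_chain \<sigma>' L (vertices m h)"
        by (rule L(2))
    next
      fix p assume "p \<in> set L"
      then obtain e ts where p: "p = (e, ts)" "length ts = Suc (Suc m)" "hd ts = (False, 0)"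
        "\<forall>t\<in>set ts. snd t \<le> m"
        using L(1) by (cases p) (auto simp: less_Suc_eq_le)
      have "ts ! 0 = (False, 0)"
        using p(2,3) by (cases ts) auto
      then have "\<exists>k\<le>Suc m. \<not> fst (ts ! k)"
        by (intro exI[of _ 0]) simp
      moreover have "crel (subtopology (N m) U) (\<lambda>h. vert m h j) (\<lambda>h. \<sigma>' (vert m h j))" if "j \<le> m" for j
      proof -
        have UX: "vert m h j \<in> X" if "h \<in> U" for h
          using that \<open>j \<le> m\<close> by (auto simp: U_def)
        have "continuous_map (subtopology (N m) U) (subtopology T X) (\<lambda>h. vert m h j)"
          using continuous_vert[OF that] UX
          by (auto simp: continuous_map_in_subtopology continuous_map_from_subtopology)
        then have "crel (subtopology (N m) U) (\<lambda>h. vert m h j) (\<lambda>h. \<sigma> (vert m h j))"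
          by (rule crel_compose[OF \<sigma>(2)])
        then show ?thesis
          by (rule crel_cong) (use UX tU in \<open>auto simp: \<sigma>'_def\<close>)
      qed
      ultimately show "case p of (e, ts) \<Rightarrow> length ts = Suc (Suc m) \<and> (\<exists>k\<le>Suc m. \<not> fst (ts ! k))
          \<and> (\<forall>t\<in>set ts. snd t \<le> m \<and> (fst t \<longrightarrow> crel (subtopology (N m) U)
            (\<lambda>h. vert m h (snd t)) (\<lambda>h. \<sigma>' (vert m h (snd t)))))"
        using p by simp
    qed
    then show "\<exists>U L. openin (N m) U \<and> g \<in> U \<and> words_on \<sigma>' m (Suc m) prism U L"
      using U gU by blast
  qed
  define B where "B = unhat (Suc n) (ext prism (hat n b))"
  have B: "B \<in> cc_int (N (Suc n))"
    unfolding B_def by (rule prism_cc[OF b]) simp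
  have Hc: "H c \<in> cc_int (N n)"
    using prism_cc[OF c] n unfolding H_def by simp
  have hat_B: "hat (Suc n) B = ext prism (hat n b)"
    unfolding B_def
  proof (rule hat_unhat)
    fix z assume "ext prism (hat n b) z \<noteq> 0"
    then obtain y where y: "hat n b y \<noteq> 0" "coef (prism y) z \<noteq> 0"
      unfolding ext_def by (auto elim: sum.not_neutral_contains_not_neutral)
    obtain g where g: "g \<in> topspace (N n)" "y = vertices n g"
      using hat_nonzero[OF y(1)] by blast
    have k: "z \<noteq> []" "set z \<subseteq> set y \<union> \<sigma>' ` set y" "length z = Suc (Suc n)"
      using keys_prism[of z y] y(2) g(2) by (auto simp: in_keys_iff)
    have r0: "rel (vert n g 0) x" if "x \<in> set z" for x
    proof -
      obtain j where j: "j \<le> n" "x = vert n g j \<or> x = \<sigma>' (vert n g j)"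
        using k(2) \<open>x \<in> set z\<close> by (auto simp: g(2) set_vertices)
      have "rel (vert n g 0) (vert n g j)"
        using rel_vert[OF g(1)] j(1) by simp
      moreover have "rel (vert n g j) (\<sigma>' (vert n g j))"
        using rel_\<sigma> vert_in_units[OF g(1) j(1)] .
      ultimately show ?thesis
        using j(2) rel_trans by blast
    qed
    have "rel (z ! 0) (z ! j)" if "j \<le> Suc n" for j
    proof -
      have "z ! 0 \<in> set z" "z ! j \<in> set z"
        using k(3) that by simp_all
      then show ?thesis
        using r0 rel_sym rel_trans by blast
    qed
    then show "z \<in> orbit_tuples (Suc n)"
      using k(3) by (simp add: orbit_tuples_def)
  qed
  have compat: "compat y \<and> srt y = 0" if nz: "hat n b y \<noteq> 0" for y
  proof -
    obtain g where g: "g \<in> topspace (N n)" "y = vertices n g" "b g \<noteq> 0"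
      using hat_nonzero[OF nz] by blast
    have gX: "vert n g j \<in> X" if "j \<le> n" for j
      using inX[of g n b j] g(1,3) that by simp
    have "\<sigma>' (vert n g i) = \<sigma>' (vert n g j)"
      if ij: "i \<le> n" "j \<le> n" "col' (vert n g i) = col' (vert n g j)" for i j
    proof -
      have "arr (vert n g i) (vert n g j) \<in> C n b"
        unfolding C_def using ij g(1,3) by blast
      then have "\<sigma> (vert n g i) = \<sigma> (vert n g j)"
        using \<sigma>(4)[of "arr (vert n g i) (vert n g j)"] ij rel_arr[OF rel_vert[OF g(1) ij(1,2)]] gX
        by (simp add: col'_def)
      then show ?thesis
        using gX ij by (simp add: \<sigma>'_def)
    qed
    then have "compat y"
      unfolding compat_def g(2) set_vertices by blast
    moreover have "srt y = 0"
      using n col(1) gX by (intro srt_eq_0[of _ d]) (auto simp: g(2) set_vertices col'_def)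
    ultimately show ?thesis
      by blast
  qed
  have key: "hat n b z = ext bd (ext prism (hat n b)) z + ext prism (ext bd (hat n b)) z" if z: "z \<noteq> []" for z
  proof -
    have lf: "locally_finite (hat n b)"
      by (rule locally_finite_hat[OF b])
    have l1: "local_op (\<lambda>y. frag_extend bd (prism y))" and l2: "local_op (\<lambda>y. frag_extend prism (bd y))"
      by (intro local_op_compose loc local_op_bd)+
    have "ext bd (ext prism (hat n b)) z + ext prism (ext bd (hat n b)) z
        = ext (\<lambda>y. frag_extend bd (prism y) + frag_extend prism (bd y)) (hat n b) z"
      using lf z by (simp add: ext_ext loc local_op_bd ext_fun_add l1 l2)
    also have "\<dots> = ext frag_of (hat n b) z"
    proof -
      have "frag_extend bd (prism y) + frag_extend prism (bd y) = frag_of y" if "hat n b y \<noteq> 0" for y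
        using prism_homotopy[of y] compat[OF that] by simp
      then have "ext (\<lambda>y. frag_extend bd (prism y) + frag_extend prism (bd y)) (hat n b) = ext frag_of (hat n b)"
        by (rule ext_cong)
      then show ?thesis
        by (simp only:)
    qed
    finally show ?thesis
      by simp
  qed
  have n1: "1 \<le> n"
    using n by simp
  have "b g = boundary G (Suc n) B g + H (boundary G n b) g" for g
  proof (cases "g \<in> topspace (N n)")
    case True
    have "b g = hat n b (vertices n g)"
      using True by simp
    also have "\<dots> = ext bd (hat (Suc n) B) (vertices n g) + ext prism (hat (n - 1) (boundary G n b)) (vertices n g)"
      unfolding hat_B hat_boundary[OF b n1] by (rule key) (simp add: vertices_def)
    also have "\<dots> = boundary G (Suc n) B g + H (boundary G n b) g"
      using True boundary_eq[OF B] by (simp add: H_def unhat_def)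
    finally show ?thesis .
  next
    case False
    then show ?thesis
      using b boundary_eq[OF B] by (simp add: cc_int_iff H_def unhat_def)
  qed
  then have eq: "b = (\<lambda>g. boundary G (Suc n) B g + H (boundary G n b) g)"
    by blast
  have "H (\<lambda>g. k * a g) = (\<lambda>g. k * H a g)" for k a
    by (auto simp: H_def unhat_def hat_cmult ext_cmult)
  then show ?thesis
    using that[OF B Hc _ eq] by blast
qed

text \<open>The remainder is \<open>H\<close> of the zero function, which vanishes by homogeneity
  with \<open>k = 0\<close>. The zero chain serves as c.\<close>

lemma cycle_is_boundary:
  assumes "dad_at_most G d" "b \<in> cc_int (N n)" "d < n" "boundary G n b = (\<lambda>_. 0)"
  shows "b \<in> boundary G (Suc n) ` cc_int (N (Suc n))"
proof -
  obtain B and H :: "((nat \<Rightarrow> 'a) \<Rightarrow> int) \<Rightarrow> (nat \<Rightarrow> 'a) \<Rightarrow> int" where B: "B \<in> cc_int (N (Suc n))"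
    "\<And>k a. H (\<lambda>g. k * a g) = (\<lambda>g. k * H a g)"
    "b = (\<lambda>g. boundary G (Suc n) B g + H (boundary G n b) g)"
    by (rule contraction[OF assms(1-3) cc_int_zero]) blast
  have "H (boundary G n b) = (\<lambda>_. 0)"
    using B(2)[of 0 "\<lambda>_. 0"] assms(4) by simp
  then have "b = boundary G (Suc n) B"
    using B(3) by simp
  then show ?thesis
    using B(1) by blast
qed

lemma torsion_cycle_is_boundary:
  assumes dad: "dad_at_most G d" and c: "c \<in> cc_int (N d)" and k: "k \<noteq> 0"
    and b: "b \<in> cc_int (N (Suc d))" "(\<lambda>g. k * c g) = boundary G (Suc d) b"
  shows "c \<in> boundary G (Suc d) ` cc_int (N (Suc d))"
proof -
  have c': "c \<in> cc_int (N (Suc d - 1))"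
    using c by simp
  obtain B H where B: "B \<in> cc_int (N (Suc (Suc d)))" and H: "H c \<in> cc_int (N (Suc d))"
    "\<And>k a. H (\<lambda>g. k * a g) = (\<lambda>g. k * H a g)"
    and eq: "b = (\<lambda>g. boundary G (Suc (Suc d)) B g + H (boundary G (Suc d) b) g)"
    by (rule contraction[OF dad b(1) lessI c']) blast
  have BB: "boundary G (Suc (Suc d)) B \<in> cc_int (N (Suc d))"
    using boundary_cc_int[OF B] by simp
  \<comment> \<open>Homogeneity replaces \<open>H\<close> of the boundary of b by \<open>k\<close>
    times \<open>H c\<close>, and \<open>H c\<close> is a chain, so the boundary operator can be
    applied to the equation.\<close>
  have "b = (\<lambda>g. boundary G (Suc (Suc d)) B g + k * H c g)"
    using eq H(2) unfolding b(2)[symmetric] by simp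
  then have "boundary G (Suc d) b
      = (\<lambda>z. boundary G (Suc d) (boundary G (Suc (Suc d)) B) z + k * boundary G (Suc d) (H c) z)"
    using boundary_add[OF BB cc_int_cmult[OF H(1)]] boundary_cmult[OF H(1)] by metis
  also have "\<dots> = (\<lambda>z. k * boundary G (Suc d) (H c) z)"
    using boundary_boundary[OF B] by simp
  finally have "(\<lambda>g. k * c g) = (\<lambda>z. k * boundary G (Suc d) (H c) z)"
    using b(2) by simp
  then have "c = boundary G (Suc d) (H c)"
    using k by (simp add: fun_eq_iff)
  then show ?thesis
    using H(1) by blast
qed

section \<open>The homology groups\<close>

definition cycles :: "nat \<Rightarrow> ((nat \<Rightarrow> 'a) \<Rightarrow> int) set" where
  "cycles n = {a \<in> cc_int (N n). boundary G n a = (\<lambda>_. 0)}"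

definition boundaries :: "nat \<Rightarrow> ((nat \<Rightarrow> 'a) \<Rightarrow> int) set" where
  "boundaries n = boundary G (Suc n) ` cc_int (N (Suc n))"

definition cycle_group :: "nat \<Rightarrow> ((nat \<Rightarrow> 'a) \<Rightarrow> int) monoid" where
  "cycle_group n = (groupoid_chain_group G n)\<lparr>carrier := cycles n\<rparr>"

lemma groupoid_homology_eq: "groupoid_homology G n = cycle_group n Mod boundaries n"
  by (simp add: groupoid_homology_def cycle_group_def cycles_def boundaries_def kernel_def cc_int_group_def)

lemma boundary_neg:
  assumes "a \<in> cc_int (N n)"
  shows "boundary G n (\<lambda>y. - a y) = (\<lambda>z. - boundary G n a z)"
  using boundary_cmult[OF assms, of "-1"] by simp

lemma cc_int_neg: "a \<in> cc_int Y \<Longrightarrow> (\<lambda>y. - a y) \<in> cc_int Y"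
  using cc_int_cmult[of a Y "-1"] by simp

lemma comm_group_cycles: "comm_group (cycle_group n)"
proof (rule comm_groupI)
  fix a assume "a \<in> carrier (cycle_group n)"
  then show "\<exists>b\<in>carrier (cycle_group n). b \<otimes>\<^bsub>cycle_group n\<^esub> a = \<one>\<^bsub>cycle_group n\<^esub>"
    by (intro bexI[of _ "\<lambda>y. - a y"])
       (auto simp: cycle_group_def cycles_def cc_int_group_def cc_int_neg boundary_neg)
next
  show "\<one>\<^bsub>cycle_group n\<^esub> \<in> carrier (cycle_group n)"
    using boundary_cmult[OF cc_int_zero, of n 0]
    by (simp add: cycle_group_def cycles_def cc_int_group_def cc_int_zero)
qed (auto simp: cycle_group_def cycles_def cc_int_group_def cc_int_add boundary_add add_ac)

lemma boundaries_subset: "boundaries n \<subseteq> cycles n"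
proof
  fix a assume "a \<in> boundaries n"
  then obtain b where b: "b \<in> cc_int (N (Suc n))" "a = boundary G (Suc n) b"
    by (auto simp: boundaries_def)
  have "a \<in> cc_int (N n)"
    using boundary_cc_int[OF b(1)] b(2) by simp
  moreover have "boundary G n a = (\<lambda>_. 0)"
  proof (cases "n = 0")
    case False
    then show ?thesis
      using boundary_boundary[OF b(1)] b(2) by simp
  qed (simp add: boundary_def)
  ultimately show "a \<in> cycles n"
    by (simp add: cycles_def)
qed

lemma normal_boundaries: "boundaries n \<lhd> cycle_group n"
proof -
  interpret Z: comm_group "cycle_group n"
    by (rule comm_group_cycles)
  have "subgroup (boundaries n) (cycle_group n)"
  proof (rule Z.subgroupI)
    show "boundaries n \<subseteq> carrier (cycle_group n)"
      using boundaries_subset by (simp add: cycle_group_def)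
    show "boundaries n \<noteq> {}"
      using cc_int_zero by (auto simp: boundaries_def)
    fix a assume a: "a \<in> boundaries n"
    then obtain a' where a': "a' \<in> cc_int (N (Suc n))" "a = boundary G (Suc n) a'"
      by (auto simp: boundaries_def)
    have neg: "(\<lambda>y. - a y) \<in> boundaries n"
      using boundary_neg[OF a'(1)] cc_int_neg[OF a'(1)] a'(2) unfolding boundaries_def by force
    moreover have "inv\<^bsub>cycle_group n\<^esub> a = (\<lambda>y. - a y)"
      using a neg boundaries_subset[of n]
      by (intro Z.inv_equality) (auto simp: cycle_group_def cc_int_group_def)
    ultimately show "inv\<^bsub>cycle_group n\<^esub> a \<in> boundaries n"
      by simp
    fix b assume "b \<in> boundaries n"
    then obtain b' where b': "b' \<in> cc_int (N (Suc n))" "b = boundary G (Suc n) b'"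
      by (auto simp: boundaries_def)
    have "a \<otimes>\<^bsub>cycle_group n\<^esub> b = boundary G (Suc n) (\<lambda>y. a' y + b' y)"
      using boundary_add[OF a'(1) b'(1)] a'(2) b'(2) by (simp add: cycle_group_def cc_int_group_def)
    then show "a \<otimes>\<^bsub>cycle_group n\<^esub> b \<in> boundaries n"
      using cc_int_add[OF a'(1) b'(1)] by (simp add: boundaries_def)
  qed
  then show ?thesis
    by (rule Z.subgroup_imp_normal)
qed

lemma trivial_homology:
  assumes "dad_at_most G d" "d < n"
  shows "trivial_group (groupoid_homology G n)"
proof -
  interpret normal "boundaries n" "cycle_group n"
    by (rule normal_boundaries)
  have eq: "boundaries n = carrier (cycle_group n)"
    using boundaries_subset[of n] cycle_is_boundary[OF assms(1) _ assms(2)]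
    by (auto simp: cycle_group_def cycles_def boundaries_def)
  interpret Q: group "cycle_group n Mod boundaries n"
    by (rule factorgroup_is_group)
  have "boundaries n #>\<^bsub>cycle_group n\<^esub> a = boundaries n" if "a \<in> carrier (cycle_group n)" for a
    using that eq by (intro coset_join2 subgroup_axioms) auto
  then have "carrier (cycle_group n Mod boundaries n) \<subseteq> {\<one>\<^bsub>cycle_group n Mod boundaries n\<^esub>}"
    by (auto simp: FactGroup_def RCOSETS_def)
  then show ?thesis
    by (simp add: Q.trivial_group_subset groupoid_homology_eq)
qed

lemma torsion_free_homology:
  assumes "dad_at_most G d"
  shows "torsion_free_group (groupoid_homology G d)"
  unfolding torsion_free_group_def groupoid_homology_eq
proof (intro ballI allI impI)
  let ?Z = "cycle_group d" and ?B = "boundaries d"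
  interpret normal ?B ?Z
    by (rule normal_boundaries)
  fix x and k :: nat
  assume x: "x \<in> carrier (?Z Mod ?B)" and k: "0 < k \<and> x [^]\<^bsub>?Z Mod ?B\<^esub> k = \<one>\<^bsub>?Z Mod ?B\<^esub>"
  obtain c where c: "c \<in> carrier ?Z" "x = ?B #>\<^bsub>?Z\<^esub> c"
    using x by (auto simp: FactGroup_def RCOSETS_def)
  interpret q: group_hom ?Z "?Z Mod ?B" "\<lambda>a. ?B #>\<^bsub>?Z\<^esub> a"
    using r_coset_hom_Mod factorgroup_is_group is_group by (simp add: group_hom_def group_hom_axioms_def)
  \<comment> \<open>In the multiplicative notation of groups, powers are integer multiples of
    functions.\<close>
  have pow: "c [^]\<^bsub>?Z\<^esub> m = (\<lambda>y. int m * c y)" for m :: nat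
    by (induction m) (auto simp: cycle_group_def cc_int_group_def nat_pow_def algebra_simps)
  have "?B #>\<^bsub>?Z\<^esub> (c [^]\<^bsub>?Z\<^esub> k) = ?B"
    using q.hom_nat_pow[OF c(1), of k] k c(2) by (simp add: FactGroup_def)
  then have "c [^]\<^bsub>?Z\<^esub> k \<in> ?B"
    using c(1) subgroup_axioms rcos_self by (metis nat_pow_closed)
  then obtain b where "b \<in> cc_int (N (Suc d))" "(\<lambda>y. int k * c y) = boundary G (Suc d) b"
    unfolding pow boundaries_def by blast
  moreover have "c \<in> cc_int (N d)"
    using c(1) by (simp add: cycle_group_def cycles_def)
  ultimately have "c \<in> ?B"
    unfolding boundaries_def using k by (intro torsion_cycle_is_boundary[OF assms, of c "int k" b]) auto
  then show "x = \<one>\<^bsub>?Z Mod ?B\<^esub>"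
    using c coset_join2[OF c(1) subgroup_axioms] by (simp add: FactGroup_def)
qed

end

theorem theoremA:
  fixes G :: "'a top_groupoid" and d :: nat
  assumes "topological_groupoid G"
    and "locally_compact_space (top_of G)"
    and "Hausdorff_space (top_of G)"
    and "etale G"
    and "principal_groupoid G"
    and "sigma_compact_space (top_of G)"
    and "ample G"
    and "dad_at_most G d"
  shows "(\<forall>n>d. trivial_group (groupoid_homology G n))
    \<and> torsion_free_group (groupoid_homology G d)"
proof -
  interpret principal_ample G
    using assms by (simp add: principal_ample_def principal_ample_axioms_def)
  show ?thesis
    using trivial_homology torsion_free_homology assms(8) by blast
qed

end
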